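(* Let $X,f,g,x_0,\Theta$ and $I_s(z)$ be as described in the context, with $n=\dim X$. Assume that $f$ has a local extremum at $x_0\in\mathfrak{S}=f^{-1}(\{0\})$ whose jet is given, in local coordinates near $x_0$, by $f(x)=f_k(x)+\mathcal{O}(\|x-x_0\|^{k+1})$, where $f_k\neq 0$ is homogeneous of degree $k\ge 2$ with respect to $x-x_0$ (a fortiori $k$ is even). Then, as $z\to\infty$, there is a full asymptotic expansion $$I_s(z)\sim\sum_{j\in\mathbb{N}} c_j\, z^{-\frac{j}{k}},$$ and the leading term is given by $$I_s(z)=z^{-\frac{n}{k}}\left\langle t_e^{\frac{n-k}{k}},g(t,x_0)\right\rangle\frac1k\int_{\mathbb{S}^{n-1}}|f_k(\theta)|^{-\frac nk}\,d\theta+\mathcal{O}\big(z^{-\frac{n+1}{k}}\big),$$ where $t_e=\max(t,0)$ if $x_0$ is a minimum and $t_e=\max(-t,0)$ if $x_0$ is a maximum.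
   Context: Setting: $X$ is a smooth manifold of dimension $n$ with a $C^\infty$ density $dx$; $f:X\to\mathbb{R}$ and $g:\mathbb{R}\times X\to\mathbb{R}$, $(t,x)\mapsto g(t,x)$, are smooth. Standing assumptions: $|f|$ is strictly positive outside a compact set (so $\mathfrak{S}=f^{-1}(\{0\})$ is compact), and the Fourier transform $\hat g(t,x)=\frac1{2\pi}\int_{\mathbb{R}}e^{-i\tau t}g(\tau,x)\,d\tau$ of $g$ in its first variable exists and satisfies $\partial_t^m\hat g\in L^1(\mathbb{R}\times X)$ for all $m\in\mathbb{N}$. The point $x_0\in\mathfrak{S}$ is an isolated critical point of $f$ on $\mathfrak{S}$. $\Theta\in C_0^\infty(X)$ is a cut-off function, equal to $1$ near $x_0$ and supported in a sufficiently small neighborhood of $x_0$; the neighborhood containing its support is identified with an open subset of $\mathbb{R}^n$ with $dx$ Lebesgue measure. Put $$I_s(z)=\int_X g(zf(x),x)\,\Theta(x)\,dx.$$ $f_k$ is regarded as a homogeneous polynomial in the variable $x-x_0\in\mathbb{R}^n$, and $f_k(\theta)$ denotes its restriction to the unit sphere $\mathbb{S}^{n-1}$ (i.e. its value at $x-x_0=\theta$); $d\theta$ is the standard surface measure on $\mathbb{S}^{n-1}$. The bracket $\langle t_e^{\alpha},g(t,x_0)\rangle$ is the distributional pairing in $t$, i.e. $\int_0^\infty t^{\alpha}g(t,x_0)\,dt$ for a minimum and $\int_0^\infty t^{\alpha}g(-t,x_0)\,dt$ for a maximum.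
   Formalization: "f_k ≠ 0" is taken as f_k nowhere zero on the unit sphere (the claim fails for x²+y⁴), and it is additionally assumed that g and all its x-derivatives decay rapidly in t, locally uniformly in x near x_0, since the stated Fourier condition alone does not give the full expansion. *)

theory Defs
  imports "HOL-Analysis.Analysis" "HOL-Library.Landau_Symbols"
begin

primrec iter_deriv ::
    "'a::real_normed_vector list \<Rightarrow> ('a \<Rightarrow> 'b::real_normed_vector) \<Rightarrow> 'a \<Rightarrow> 'b" where
  "iter_deriv [] f = f"
| "iter_deriv (v # vs) f = (\<lambda>x. frechet_derivative (iter_deriv vs f) (at x) v)"

text \<open>\<open>C\<^sup>\<infinity>\<close> on an open set \<open>S\<close> of a finite-dimensional space: all iterated directional
  derivatives exist and are themselves differentiable (hence continuous).\<close>

definition smooth_on :: "'a::real_normed_vector set \<Rightarrow> ('a \<Rightarrow> 'b::real_normed_vector) \<Rightarrow> bool" where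
  "smooth_on S f \<longleftrightarrow> (\<forall>vs. \<forall>x\<in>S. iter_deriv vs f differentiable (at x))"

text \<open>The manifold is the whole type \<open>'a\<close>; its dimension is \<open>CARD('n)\<close>.  A chart is a pair
  \<open>(U, \<kappa>)\<close> where \<open>\<kappa>\<close> is a total function of which only the values on \<open>U\<close> matter.\<close>

type_synonym ('a, 'n) chart = "'a set \<times> ('a \<Rightarrow> real ^ 'n)"

definition is_chart :: "('a::topological_space, 'n::finite) chart \<Rightarrow> bool" where
  "is_chart = (\<lambda>(U, \<kappa>). open U \<and> open (\<kappa> ` U) \<and> homeomorphism U (\<kappa> ` U) \<kappa> (inv_into U \<kappa>))"

definition compatible ::
    "('a::topological_space, 'n::finite) chart \<Rightarrow> ('a, 'n) chart \<Rightarrow> bool" where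
  "compatible = (\<lambda>(U, \<kappa>) (V, \<psi>).
     smooth_on (\<kappa> ` (U \<inter> V)) (\<lambda>y. \<psi> (inv_into U \<kappa> y)) \<and>
     smooth_on (\<psi> ` (U \<inter> V)) (\<lambda>y. \<kappa> (inv_into V \<psi> y)))"

definition smooth_structure ::
    "('a::{t2_space, second_countable_topology}, 'n::finite) chart set \<Rightarrow> bool" where
  "smooth_structure \<A> \<longleftrightarrow>
     (\<forall>c\<in>\<A>. is_chart c) \<and>
     (\<Union>(U, \<kappa>)\<in>\<A>. U) = UNIV \<and>
     (\<forall>c\<in>\<A>. \<forall>d\<in>\<A>. compatible c d) \<and>
     (\<forall>c. is_chart c \<and> (\<forall>d\<in>\<A>. compatible c d) \<longrightarrow> c \<in> \<A>)"

definition smooth_fun ::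
    "('a::topological_space, 'n::finite) chart set \<Rightarrow> ('a \<Rightarrow> real) \<Rightarrow> bool" where
  "smooth_fun \<A> f \<longleftrightarrow> (\<forall>(U, \<kappa>)\<in>\<A>. smooth_on (\<kappa> ` U) (\<lambda>y. f (inv_into U \<kappa> y)))"

definition smooth_fun_time ::
    "('a::topological_space, 'n::finite) chart set \<Rightarrow> (real \<Rightarrow> 'a \<Rightarrow> real) \<Rightarrow> bool" where
  "smooth_fun_time \<A> g \<longleftrightarrow>
     (\<forall>(U, \<kappa>)\<in>\<A>. smooth_on (UNIV \<times> \<kappa> ` U) (\<lambda>(t, y). g t (inv_into U \<kappa> y)))"

definition critical_point ::
    "('a::topological_space, 'n::finite) chart set \<Rightarrow> ('a \<Rightarrow> real) \<Rightarrow> 'a \<Rightarrow> bool" where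
  "critical_point \<A> f p \<longleftrightarrow>
     (\<forall>(U, \<kappa>)\<in>\<A>. p \<in> U \<longrightarrow> ((\<lambda>y. f (inv_into U \<kappa> y)) has_derivative (\<lambda>_. 0)) (at (\<kappa> p)))"

definition isolated_critical_point_on ::
    "('a::topological_space, 'n::finite) chart set \<Rightarrow> ('a \<Rightarrow> real) \<Rightarrow> 'a set \<Rightarrow> 'a \<Rightarrow> bool" where
  "isolated_critical_point_on \<A> f S p \<longleftrightarrow>
     p \<in> S \<and> critical_point \<A> f p \<and>
     (\<exists>W. open W \<and> p \<in> W \<and> (\<forall>q\<in>W \<inter> S. critical_point \<A> f q \<longrightarrow> q = p))"

text \<open>In the coordinates \<open>(U, \<kappa>)\<close> the measure \<open>\<mu>\<close> is \<open>\<rho>(y) dy\<close>.\<close>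

definition has_chart_density ::
    "('a::topological_space) measure \<Rightarrow> ('a, 'n::finite) chart \<Rightarrow> (real ^ 'n \<Rightarrow> real) \<Rightarrow> bool" where
  "has_chart_density \<mu> = (\<lambda>(U, \<kappa>) \<rho>.
     distr (restrict_space \<mu> U) lborel \<kappa> =
     density lborel (\<lambda>y. ennreal (\<rho> y) * indicator (\<kappa> ` U) y))"

definition smooth_density ::
    "('a::topological_space, 'n::finite) chart set \<Rightarrow> 'a measure \<Rightarrow> bool" where
  "smooth_density \<A> \<mu> \<longleftrightarrow>
     sets \<mu> = sets borel \<and>
     (\<forall>(U, \<kappa>)\<in>\<A>. \<exists>\<rho>. smooth_on (\<kappa> ` U) \<rho> \<and> (\<forall>y\<in>\<kappa> ` U. 0 \<le> \<rho> y) \<and>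
        has_chart_density \<mu> (U, \<kappa>) \<rho>)"

definition fourier_t :: "(real \<Rightarrow> 'a \<Rightarrow> real) \<Rightarrow> real \<Rightarrow> 'a \<Rightarrow> complex" where
  "fourier_t g t x =
     of_real (1 / (2 * pi)) * (LINT \<tau>|lborel. exp (- (\<i> * of_real (\<tau> * t))) * of_real (g \<tau> x))"

definition fourier_admissible :: "'a measure \<Rightarrow> (real \<Rightarrow> 'a \<Rightarrow> real) \<Rightarrow> bool" where
  "fourier_admissible \<mu> g \<longleftrightarrow>
     (\<forall>x\<in>space \<mu>. integrable lborel (\<lambda>\<tau>. g \<tau> x)) \<and>
     (\<forall>x\<in>space \<mu>. smooth_on UNIV (\<lambda>t. fourier_t g t x)) \<and>
     (\<forall>m. integrable (lborel \<Otimes>\<^sub>M \<mu>)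
            (\<lambda>(t, x). iter_deriv (replicate m 1) (\<lambda>s. fourier_t g s x) t))"

text \<open>Rapid decrease in \<open>t\<close> of \<open>g\<close> and of all its coordinate derivatives in \<open>x\<close>, uniformly on
  compact subsets of the chart.  Integrability of the functions \<open>\<partial>\<^sub>t\<^sup>m (fourier_t g)\<close> does not control
  the decay of the \<open>x\<close>-derivatives: on \<open>\<real>\<^sup>3\<close> with \<open>f(x) = |x|\<^sup>2\<close>, for cut-offs \<open>\<chi>\<close> and a smooth step
  \<open>h\<close> supported in \<open>t > 0\<close>, the function \<open>g(t,x) = |x|\<^sup>2 \<chi>(|x|\<^sup>2 e\<^sup>2\<^sup>t) h(t) \<chi>(|x|\<^sup>2)\<close> is admissible, while
  the integral of \<open>g(z f(x), x)\<close> is of exact order \<open>z powr (-5/2) * ln z powr (5/2)\<close>.\<close>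

definition x_derivs_rapidly_decreasing ::
    "('a, 'n::finite) chart \<Rightarrow> (real \<Rightarrow> 'a \<Rightarrow> real) \<Rightarrow> bool" where
  "x_derivs_rapidly_decreasing = (\<lambda>(U, \<kappa>) g.
     \<forall>m vs K. set vs \<subseteq> Basis \<and> compact K \<and> K \<subseteq> \<kappa> ` U \<longrightarrow>
       (\<exists>C. \<forall>t. \<forall>y\<in>K. \<bar>t\<bar> ^ m * \<bar>iter_deriv vs (\<lambda>y. g t (inv_into U \<kappa> y)) y\<bar> \<le> C))"

definition local_min :: "('a::topological_space \<Rightarrow> real) \<Rightarrow> 'a \<Rightarrow> bool" where
  "local_min f p \<longleftrightarrow> (\<forall>\<^sub>F x in nhds p. f p \<le> f x)"

definition local_max :: "('a::topological_space \<Rightarrow> real) \<Rightarrow> 'a \<Rightarrow> bool" where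
  "local_max f p \<longleftrightarrow> (\<forall>\<^sub>F x in nhds p. f x \<le> f p)"

definition homogeneous_poly :: "nat \<Rightarrow> (real ^ 'n::finite \<Rightarrow> real) \<Rightarrow> bool" where
  "homogeneous_poly k p \<longleftrightarrow>
     (\<exists>a. \<forall>v. p v = (\<Sum>\<alpha> | (\<Sum>i\<in>UNIV. \<alpha> i) = k. a \<alpha> * (\<Prod>i\<in>UNIV. (v $ i) ^ \<alpha> i)))"

definition cutoff_function ::
    "('a::topological_space, 'n::finite) chart set \<Rightarrow> 'a \<Rightarrow> 'a set \<Rightarrow> ('a \<Rightarrow> real) \<Rightarrow> bool" where
  "cutoff_function \<A> p V \<Theta> \<longleftrightarrow>
     smooth_fun \<A> \<Theta> \<and> compact (closure {x. \<Theta> x \<noteq> 0}) \<and> closure {x. \<Theta> x \<noteq> 0} \<subseteq> V \<and>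
     (\<forall>\<^sub>F x in nhds p. \<Theta> x = 1)"

definition I_s ::
    "'a measure \<Rightarrow> ('a \<Rightarrow> real) \<Rightarrow> (real \<Rightarrow> 'a \<Rightarrow> real) \<Rightarrow> ('a \<Rightarrow> real) \<Rightarrow> real \<Rightarrow> real" where
  "I_s \<mu> f g \<Theta> z = (LINT x|\<mu>. g (z * f x) x * \<Theta> x)"

text \<open>Surface measure of the unit sphere: \<open>\<sigma>(A) = n \<lambda>{r \<theta> | 0 < r \<le> 1, \<theta> \<in> A}\<close>.\<close>

definition sphere_measure :: "(real ^ 'n::finite) measure" where
  "sphere_measure =
     density (distr (restrict_space lborel (cball 0 1 - {0})) (restrict_space borel (sphere 0 1)) sgn)
       (\<lambda>_. of_nat CARD('n))"

definition has_asymp_expansion :: "(real \<Rightarrow> real) \<Rightarrow> nat \<Rightarrow> (nat \<Rightarrow> real) \<Rightarrow> bool" where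
  "has_asymp_expansion I k c \<longleftrightarrow>
     (\<forall>N. (\<lambda>z. I z - (\<Sum>j\<le>N. c j * z powr (- real j / real k))) \<in> o(\<lambda>z. z powr (- real N / real k)))"

text \<open>The leading term; since \<open>0 powr \<alpha> = 0\<close> also for \<open>\<alpha> = 0\<close>, \<open>t\<^sub>e powr \<alpha>\<close> vanishes off the
  half-line \<open>t\<^sub>e > 0\<close>, so the \<open>t\<close>-integral is the integral over that half-line.\<close>

definition leading_term ::
    "(real \<Rightarrow> real) \<Rightarrow> nat \<Rightarrow> (real ^ 'n::finite \<Rightarrow> real) \<Rightarrow> (real \<Rightarrow> real) \<Rightarrow> real \<Rightarrow> real" where
  "leading_term t\<^sub>e k fk h z =
     z powr (- real CARD('n) / real k) *
     (LINT t|lborel. t\<^sub>e t powr ((real CARD('n) - real k) / real k) * h t) *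
     (1 / real k) *
     (LINT \<theta>|sphere_measure. \<bar>fk \<theta>\<bar> powr (- real CARD('n) / real k))"

end

theory Submission
  imports Defs
begin

text \<open>In the chart put \<open>y = y\<^sub>0 + r \<theta>\<close> with \<open>\<bar>\<theta>\<bar> = 1\<close> and write \<open>f = s \<phi>\<close>, where the sign \<open>s\<close> is \<open>1\<close> at a
  minimum and \<open>-1\<close> at a maximum; then \<open>\<phi> = r\<^sup>k q(r, \<theta>)\<close> with \<open>q(0, \<theta>) = \<bar>f\<^sub>k(\<theta>)\<bar>\<close> bounded below.  Nothing is
  known about the decay of the \<open>t\<close>-derivatives of \<open>g\<close>, so \<open>g(z f, y)\<close> cannot be expanded after rescaling
  \<open>r\<close>.  Instead \<open>r ^ (n - 1) * g(t, y\<^sub>0 + r \<theta>)\<close> is expanded in \<open>r\<close> for fixed \<open>t\<close>, not in powers of \<open>r\<close> but in the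
  functions \<open>\<phi> powr (\<alpha>\<^sub>j - 1) * \<partial>\<^sub>r \<phi>\<close> with \<open>\<alpha>\<^sub>j = (n + j) / k\<close>; their leading behaviour is \<open>r ^ (n + j - 1)\<close>, so
  the coefficients solve a triangular system.  After setting \<open>t = z f\<close>, the substitution \<open>\<tau> = \<phi>(r)\<close> turns each
  term into an integral depending on \<open>z\<close> only through \<open>z \<tau>\<close>, hence into a constant times \<open>z powr (-\<alpha>\<^sub>j)\<close> up to a
  negligible tail.  All estimates are uniform in \<open>\<theta>\<close>, and integrating over the sphere gives the theorem.\<close>

subsection \<open>Taylor expansion along rays\<close>

text \<open>A Taylor expansion in plain powers of r would leave integrals of
  \<open>a\<^sub>j(z \<phi>(r))\<close> against r^(n+j-1) dr; the terms of \<phi> beyond r^k could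
  then be removed only by differentiating \<open>a\<^sub>j\<close> in its time argument. With the
  functions built from \<phi> and its radial derivative the substitution is exact, at the price of
  needing \<phi> monotone on each ray. The coefficients depend on t as well as on \<theta>, so every
  expansion must be uniform over the noncompact set of all pairs (t, \<theta>). This is achieved by
  expanding (1 + |t|^m) g instead of g, which rapid decrease keeps bounded, and by dividing the
  weight out afterwards; m is taken so large that all t-integrals and remainders converge. The
  coefficients must also be measurable in (t, \<theta>), since they are integrated in both. The
  density |f_k|^(-n/k) on the sphere arises in the first step of the triangular system: \<phi>^(n/k
  - 1) \<partial>_r \<phi> / k behaves like |f_k(\<theta>)|^(n/k) r^(n-1), and g(t, x_0) is divided
  by this leading coefficient. Each order gives its own list of coefficients; uniqueness merges them
  into one sequence.\<close>

definition ray_deriv :: "nat \<Rightarrow> ('a::euclidean_space \<Rightarrow> real) \<Rightarrow> 'a \<Rightarrow> 'a \<Rightarrow> real" where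
  "ray_deriv j H \<theta> y =
     (\<Sum>vs | set vs \<subseteq> Basis \<and> length vs = j. (\<Prod>v\<leftarrow>vs. \<theta> \<bullet> v) * iter_deriv vs H y)"

lemma ray_deriv_0 [simp]: "ray_deriv 0 H \<theta> y = H y"
proof -
  have "{vs :: 'a list. set vs \<subseteq> Basis \<and> length vs = 0} = {[]}" by auto
  then show ?thesis by (simp add: ray_deriv_def)
qed

text \<open>Split off the head of each list. The head is the derivative applied last, so the inner
  sum is the derivative in direction \<theta> of a coordinate derivative of order j.\<close>

lemma ray_deriv_Suc:
  "ray_deriv (Suc j) H \<theta> y =
     (\<Sum>vs | set vs \<subseteq> Basis \<and> length vs = j. (\<Prod>v\<leftarrow>vs. \<theta> \<bullet> v) *
        (\<Sum>b\<in>Basis. (\<theta> \<bullet> b) * iter_deriv (b # vs) H y))"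
proof -
  have inj: "inj_on (\<lambda>(xs, n). n # xs) ({xs :: 'a list. set xs \<subseteq> Basis \<and> length xs = j} \<times> Basis)"
    by (auto simp: inj_on_def)
  show ?thesis
    unfolding ray_deriv_def lists_length_Suc_eq sum.reindex[OF inj]
    by (simp add: sum.cartesian_product sum_distrib_left mult_ac case_prod_beta
        del: iter_deriv.simps)
qed

lemma has_derivative_smooth_iter:
  assumes "smooth_on W H" "y \<in> W"
  shows "(iter_deriv vs H has_derivative frechet_derivative (iter_deriv vs H) (at y)) (at y)"
  using assms by (simp add: smooth_on_def frechet_derivative_works[symmetric])

lemma smooth_on_continuous_iter:
  assumes "smooth_on W H"
  shows "continuous_on W (iter_deriv vs H)"
  using assms unfolding smooth_on_def
  by (metis continuous_at_imp_continuous_on differentiable_imp_continuous_within)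

lemma has_real_derivative_ray_deriv:
  fixes H :: "'a::euclidean_space \<Rightarrow> real"
  assumes H: "smooth_on W H" and W: "y0 + r *\<^sub>R \<theta> \<in> W"
  shows "((\<lambda>r. ray_deriv j H \<theta> (y0 + r *\<^sub>R \<theta>)) has_real_derivative
           ray_deriv (Suc j) H \<theta> (y0 + r *\<^sub>R \<theta>)) (at r)"
proof -
  let ?y = "y0 + r *\<^sub>R \<theta>"
  have *: "((\<lambda>r. iter_deriv vs H (y0 + r *\<^sub>R \<theta>)) has_real_derivative
      (\<Sum>b\<in>Basis. (\<theta> \<bullet> b) * iter_deriv (b # vs) H ?y)) (at r)" for vs
  proof -
    let ?D = "frechet_derivative (iter_deriv vs H) (at ?y)"
    have D: "(iter_deriv vs H has_derivative ?D) (at ?y)"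
      by (rule has_derivative_smooth_iter[OF H W])
    then have lin: "linear ?D" by (rule has_derivative_linear)
    have "?D \<theta> = ?D (\<Sum>b\<in>Basis. (\<theta> \<bullet> b) *\<^sub>R b)" by (simp add: euclidean_representation)
    also have "\<dots> = (\<Sum>b\<in>Basis. (\<theta> \<bullet> b) * ?D b)"
      by (simp add: linear_sum[OF lin] linear_scale[OF lin])
    finally have eq: "?D \<theta> = (\<Sum>b\<in>Basis. (\<theta> \<bullet> b) * iter_deriv (b # vs) H ?y)" by simp
    have "((\<lambda>r. y0 + r *\<^sub>R \<theta>) has_derivative (\<lambda>h. h *\<^sub>R \<theta>)) (at r)"
      by (auto intro!: derivative_eq_intros)
    then have "((\<lambda>r. iter_deriv vs H (y0 + r *\<^sub>R \<theta>)) has_derivative (\<lambda>h. ?D (h *\<^sub>R \<theta>))) (at r)"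
      using D by (rule has_derivative_compose)
    then show ?thesis
      unfolding eq[symmetric] has_field_derivative_def
      by (rule has_derivative_eq_rhs) (simp add: linear_scale[OF lin] fun_eq_iff)
  qed
  show ?thesis
    unfolding ray_deriv_Suc unfolding ray_deriv_def
    by (intro DERIV_sum DERIV_cmult *)
qed

text \<open>The coordinates of a unit vector are at most 1 in absolute value, so their products drop
  out and a bound free of \<theta> remains.\<close>

lemma ray_deriv_bound:
  assumes "norm \<theta> = 1"
  shows "\<bar>ray_deriv j H \<theta> y\<bar> \<le> (\<Sum>vs | set vs \<subseteq> Basis \<and> length vs = j. \<bar>iter_deriv vs H y\<bar>)"
proof -
  have pr: "\<bar>\<Prod>v\<leftarrow>vs. \<theta> \<bullet> v\<bar> \<le> 1" if "set vs \<subseteq> Basis" for vs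
    using that
  proof (induction vs)
    case (Cons a vs)
    have "\<bar>\<theta> \<bullet> a\<bar> \<le> 1" using Basis_le_norm[of a \<theta>] Cons.prems assms by simp
    then show ?case using Cons by (simp add: abs_mult mult_le_one)
  qed simp
  have "\<bar>ray_deriv j H \<theta> y\<bar>
      \<le> (\<Sum>vs | set vs \<subseteq> Basis \<and> length vs = j. \<bar>(\<Prod>v\<leftarrow>vs. \<theta> \<bullet> v) * iter_deriv vs H y\<bar>)"
    unfolding ray_deriv_def by (rule sum_abs)
  also have "\<dots> \<le> (\<Sum>vs | set vs \<subseteq> Basis \<and> length vs = j. \<bar>iter_deriv vs H y\<bar>)"
    by (rule sum_mono) (auto simp: abs_mult intro!: mult_left_le_one_le pr)
  finally show ?thesis .
qed

text \<open>Lagrange's remainder on the ray, with the factor 1/J! discarded. The starting order i is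
  free because both a function (i = 0) and its radial derivative (i = 1) are expanded; the bound is
  asked on the whole ball since the intermediate point is unknown.\<close>

lemma ray_taylor:
  fixes H :: "'a::euclidean_space \<Rightarrow> real"
  assumes H: "smooth_on W H" and W: "cball y0 d \<subseteq> W" and \<theta>: "norm \<theta> = 1"
    and r: "0 < r" "r \<le> d"
    and B: "\<And>y. y \<in> cball y0 d \<Longrightarrow> \<bar>ray_deriv (i + J) H \<theta> y\<bar> \<le> B"
  shows "\<bar>ray_deriv i H \<theta> (y0 + r *\<^sub>R \<theta>) - (\<Sum>j<J. ray_deriv (i + j) H \<theta> y0 / fact j * r ^ j)\<bar>
          \<le> B * r ^ J"
proof (cases "J = 0")
  \<comment> \<open>\<open>Maclaurin\<close> demands a positive order; here the sum is empty and the
    claim is the bound itself.\<close>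
  case True
  then show ?thesis using B[of "y0 + r *\<^sub>R \<theta>"] r \<theta> by (simp add: dist_norm)
next
  case False
  have mem: "y0 + t *\<^sub>R \<theta> \<in> cball y0 d" if "0 \<le> t" "t \<le> r" for t
    using that r \<theta> by (simp add: dist_norm)
  have "\<exists>t. 0 < t \<and> t < r \<and> ray_deriv i H \<theta> (y0 + r *\<^sub>R \<theta>) =
      (\<Sum>m<J. ray_deriv (i + m) H \<theta> (y0 + 0 *\<^sub>R \<theta>) / fact m * r ^ m) +
      ray_deriv (i + J) H \<theta> (y0 + t *\<^sub>R \<theta>) / fact J * r ^ J"
  proof (rule Maclaurin[where diff = "\<lambda>m t. ray_deriv (i + m) H \<theta> (y0 + t *\<^sub>R \<theta>)"])
    show "\<forall>m t. m < J \<and> 0 \<le> t \<and> t \<le> r \<longrightarrow>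
        ((\<lambda>t. ray_deriv (i + m) H \<theta> (y0 + t *\<^sub>R \<theta>)) has_real_derivative
          ray_deriv (i + Suc m) H \<theta> (y0 + t *\<^sub>R \<theta>)) (at t)"
      using has_real_derivative_ray_deriv[OF H] mem W by (metis add_Suc_right subsetD)
  qed (use False r in auto)
  then obtain t where t: "0 < t" "t < r" and
    eq: "ray_deriv i H \<theta> (y0 + r *\<^sub>R \<theta>) - (\<Sum>m<J. ray_deriv (i + m) H \<theta> y0 / fact m * r ^ m) =
      ray_deriv (i + J) H \<theta> (y0 + t *\<^sub>R \<theta>) / fact J * r ^ J"
    by auto
  have "\<bar>ray_deriv (i + J) H \<theta> (y0 + t *\<^sub>R \<theta>)\<bar> / fact J \<le> \<bar>ray_deriv (i + J) H \<theta> (y0 + t *\<^sub>R \<theta>)\<bar>"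
    by (simp add: divide_le_eq mult_le_cancel_left1 del: of_nat_fact)
  also have "\<dots> \<le> B" using B mem t by simp
  finally have "\<bar>ray_deriv (i + J) H \<theta> (y0 + t *\<^sub>R \<theta>)\<bar> / fact J * r ^ J \<le> B * r ^ J"
    using r by (intro mult_right_mono) auto
  then show ?thesis unfolding eq using r by (simp add: abs_mult)
qed

text \<open>Written through coordinate derivatives, the directional derivative is a polynomial in
  \<theta>. The same form also matches the decay hypothesis, which speaks of lists of basis
  vectors.\<close>

lemma ray_deriv_borel_measurable:
  "(\<lambda>\<theta>. ray_deriv j H \<theta> y) \<in> borel_measurable borel"
proof -
  have "(\<lambda>\<theta>. \<Prod>v\<leftarrow>vs. \<theta> \<bullet> v) \<in> borel_measurable borel" for vs :: "'a list"
    by (induction vs) simp_all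
  then show ?thesis unfolding ray_deriv_def by measurable
qed

text \<open>Differentiating a slice in direction v is differentiating the joint function in
  direction (0, v). This makes every slice smooth and, through joint continuity, the derivatives of
  the slices measurable in t.\<close>

lemma iter_deriv_slice:
  fixes G :: "real \<Rightarrow> 'a::euclidean_space \<Rightarrow> real"
  assumes G: "smooth_on (UNIV \<times> W) (\<lambda>(t, y). G t y)" and W: "open W" and y: "y \<in> W"
  shows "iter_deriv vs (G t) y = iter_deriv (map (Pair 0) vs) (\<lambda>(t, y). G t y) (t, y)"
    and "iter_deriv vs (G t) differentiable (at y)"
  using y
proof (induction vs arbitrary: y)
  have diff: "(\<lambda>y. iter_deriv (map (Pair 0) vs) (\<lambda>(t, y). G t y) (t, y)) differentiable (at y)" 
    and der: "frechet_derivative (\<lambda>y. iter_deriv (map (Pair 0) vs) (\<lambda>(t, y). G t y) (t, y)) (at y) v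
      = frechet_derivative (iter_deriv (map (Pair 0) vs) (\<lambda>(t, y). G t y)) (at (t, y)) (0, v)"
    if y: "y \<in> W" for y v vs
  proof -
    let ?I = "iter_deriv (map (Pair 0) vs) (\<lambda>(t, y). G t y)"
    have D: "(?I has_derivative frechet_derivative ?I (at (t, y))) (at (t, y))"
      by (rule has_derivative_smooth_iter[OF G]) (simp add: y)
    have "((\<lambda>y. (t, y)) has_derivative (\<lambda>v. (0, v))) (at y)"
      by (auto intro!: derivative_eq_intros)
    then have *: "((\<lambda>y. ?I (t, y)) has_derivative (\<lambda>v. frechet_derivative ?I (at (t, y)) (0, v))) (at y)"
      using D by (rule has_derivative_compose)
    then show "(\<lambda>y. ?I (t, y)) differentiable (at y)" by (auto simp: differentiable_def)
    show "frechet_derivative (\<lambda>y. ?I (t, y)) (at y) v = frechet_derivative ?I (at (t, y)) (0, v)"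
      using frechet_derivative_at[OF *] by metis
  qed
  {
    \<comment> \<open>The equality is assumed on all of the open set W, not at one point, so it
      survives differentiation.\<close>
    fix vs y assume eq: "\<And>y. y \<in> W \<Longrightarrow>
        iter_deriv vs (G t) y = iter_deriv (map (Pair 0) vs) (\<lambda>(t, y). G t y) (t, y)"
      and y: "y \<in> W"
    let ?I = "\<lambda>y. iter_deriv (map (Pair 0) vs) (\<lambda>(t, y). G t y) (t, y)"
    have "(?I has_derivative frechet_derivative ?I (at y)) (at y)"
      using diff[OF y] by (simp add: frechet_derivative_works[symmetric])
    then have "(iter_deriv vs (G t) has_derivative frechet_derivative ?I (at y)) (at y)"
      by (rule has_derivative_transform_within_open[OF _ W y]) (simp add: eq)
    then have "iter_deriv vs (G t) differentiable (at y) \<and>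
        frechet_derivative (iter_deriv vs (G t)) (at y) = frechet_derivative ?I (at y)"
      using frechet_derivative_at by (metis differentiable_def)
  } note tr = this
  case Nil
  {
    case 1 show ?case by simp
  next
    case 2 show ?case using tr[of "[]" y] 2 by simp
  next
    case (Cons v vs)
    {
      case 1
      have "frechet_derivative (iter_deriv vs (G t)) (at y) = 
        frechet_derivative (\<lambda>y. iter_deriv (map (Pair 0) vs) (\<lambda>(t, y). G t y) (t, y)) (at y)"
        using tr[of vs y] Cons.IH(1) 1 by blast
      then show ?case using der[OF 1] by simp
    next
      case 2
      have "iter_deriv (v # vs) (G t) y' = iter_deriv (map (Pair 0) (v # vs)) (\<lambda>(t, y). G t y) (t, y')"
        if y': "y' \<in> W" for y'
      proof -
        have "frechet_derivative (iter_deriv vs (G t)) (at y') = 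
          frechet_derivative (\<lambda>y. iter_deriv (map (Pair 0) vs) (\<lambda>(t, y). G t y) (t, y)) (at y')"
          using tr[of vs y'] Cons.IH(1) y' by blast
        then show ?thesis using der[OF y'] by simp
      qed
      then show ?case using tr[of "v # vs" y] 2 by blast
    }
  }
qed

subsection \<open>Uniform expansions with bounded measurable coefficients\<close>

lemma abs_mult_le:
  fixes a b :: real
  shows "\<bar>a\<bar> \<le> A \<Longrightarrow> \<bar>b\<bar> \<le> B \<Longrightarrow> \<bar>a * b\<bar> \<le> A * B"
  by (simp add: abs_mult mult_mono')

definition bdd_meas :: "'p measure \<Rightarrow> ('p \<Rightarrow> real) \<Rightarrow> bool" where
  "bdd_meas M b \<longleftrightarrow> b \<in> borel_measurable M \<and> (\<exists>C. \<forall>p\<in>space M. \<bar>b p\<bar> \<le> C)"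

text \<open>\<open>u r p = u\<^sub>0 p + u\<^sub>1 p r + \<dots> + O(r\<^sup>J)\<close> as \<open>r\<close> tends to \<open>0\<close> from the right, uniformly in \<open>p\<close>.\<close>

primrec unif_expansion :: "nat \<Rightarrow> 'p measure \<Rightarrow> (real \<Rightarrow> 'p \<Rightarrow> real) \<Rightarrow> bool" where
  "unif_expansion 0 M u \<longleftrightarrow> (\<exists>\<epsilon>>0. \<exists>C. \<forall>p\<in>space M. \<forall>r\<in>{0<..<\<epsilon>}. \<bar>u r p\<bar> \<le> C)"
| "unif_expansion (Suc J) M u \<longleftrightarrow>
     (\<exists>u0. bdd_meas M u0 \<and> unif_expansion J M (\<lambda>r p. (u r p - u0 p) / r))"

text \<open>An expansion of order \<open>Suc J\<close> whose leading coefficient is named. Leading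
  coefficients enter divisions, lower bounds and the leading term of the theorem, while the higher
  ones need only exist.\<close>

definition expansion_with :: "nat \<Rightarrow> 'p measure \<Rightarrow> (real \<Rightarrow> 'p \<Rightarrow> real) \<Rightarrow> ('p \<Rightarrow> real) \<Rightarrow> bool" where
  "expansion_with J M u u0 \<longleftrightarrow>
     bdd_meas M u0 \<and> unif_expansion J M (\<lambda>r p. (u r p - u0 p) / r)"

lemma unif_expansion_Suc: "unif_expansion (Suc J) M u \<longleftrightarrow> (\<exists>u0. expansion_with J M u u0)"
  by (simp add: expansion_with_def)

lemma bdd_measI:
  "b \<in> borel_measurable M \<Longrightarrow> (\<And>p. p \<in> space M \<Longrightarrow> \<bar>b p\<bar> \<le> C) \<Longrightarrow> bdd_meas M b"
  by (auto simp: bdd_meas_def)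

lemma unif_expansion_0_intro:
  assumes "0 < \<epsilon>" "\<And>r p. p \<in> space M \<Longrightarrow> 0 < r \<Longrightarrow> r < \<epsilon> \<Longrightarrow> \<bar>u r p\<bar> \<le> C"
  shows "unif_expansion 0 M u"
  unfolding unif_expansion.simps using assms by (metis greaterThanLessThan_iff)

lemma bdd_meas_const [simp]: "bdd_meas M (\<lambda>p. c)"
  by (auto simp: bdd_meas_def)

lemma bdd_meas_add:
  assumes "bdd_meas M a" "bdd_meas M b"
  shows "bdd_meas M (\<lambda>p. a p + b p)"
proof -
  obtain A B where "\<forall>p\<in>space M. \<bar>a p\<bar> \<le> A" "\<forall>p\<in>space M. \<bar>b p\<bar> \<le> B"
    using assms by (auto simp: bdd_meas_def)
  then have "\<forall>p\<in>space M. \<bar>a p + b p\<bar> \<le> A + B" by (meson abs_triangle_ineq add_mono order_trans)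
  then show ?thesis using assms by (auto simp: bdd_meas_def)
qed

lemma bdd_meas_mult:
  assumes "bdd_meas M a" "bdd_meas M b"
  shows "bdd_meas M (\<lambda>p. a p * b p)"
proof -
  obtain A B where AB: "\<forall>p\<in>space M. \<bar>a p\<bar> \<le> A" "\<forall>p\<in>space M. \<bar>b p\<bar> \<le> B"
    using assms by (auto simp: bdd_meas_def)
  then have "\<forall>p\<in>space M. \<bar>a p * b p\<bar> \<le> A * B" by (auto intro: abs_mult_le)
  then show ?thesis using assms by (auto simp: bdd_meas_def)
qed

text \<open>The upper bound of \<open>a\<close> serves exponents s \<ge> 0, the positive lower bound
  \<open>c\<close> serves s < 0.\<close>

lemma bdd_meas_powr:
  assumes "bdd_meas M a" "0 < c" "\<And>p. p \<in> space M \<Longrightarrow> c \<le> a p"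
  shows "bdd_meas M (\<lambda>p. a p powr s)"
proof -
  obtain A where A: "\<forall>p\<in>space M. \<bar>a p\<bar> \<le> A" using assms by (auto simp: bdd_meas_def)
  have "\<bar>a p powr s\<bar> \<le> max (A powr s) (c powr s)" if p: "p \<in> space M" for p
  proof (cases "s \<ge> 0")
    case True
    then have "a p powr s \<le> A powr s" using A assms(2) assms(3)[OF p] p
      by (intro powr_mono2) (force dest: order_trans[OF abs_ge_self])+
    then show ?thesis by simp
  next
    case False
    then have "a p powr s \<le> c powr s" using assms(2) assms(3)[OF p] by (intro powr_mono2') auto
    then show ?thesis by simp
  qed
  then show ?thesis using assms by (auto simp: bdd_meas_def)
qed

lemma bdd_meas_divide:
  assumes "bdd_meas M a" "bdd_meas M b" "0 < c" "\<And>p. p \<in> space M \<Longrightarrow> c \<le> b p"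
  shows "bdd_meas M (\<lambda>p. a p / b p)"
proof -
  have "bdd_meas M (\<lambda>p. a p * b p powr (-1))"
    using assms by (intro bdd_meas_mult bdd_meas_powr)
  moreover have eq: "a p * b p powr (-1) = a p / b p" if "p \<in> space M" for p
    using assms(3) assms(4)[OF that] by (simp add: powr_minus divide_inverse)
  ultimately have "\<exists>C. \<forall>p\<in>space M. \<bar>a p / b p\<bar> \<le> C" unfolding bdd_meas_def by (metis eq)
  then show ?thesis using assms by (auto simp: bdd_meas_def)
qed

lemma unif_expansion_cong:
  assumes "unif_expansion J M u" "0 < \<epsilon>"
    and "\<And>r p. p \<in> space M \<Longrightarrow> 0 < r \<Longrightarrow> r < \<epsilon> \<Longrightarrow> u r p = v r p"
  shows "unif_expansion J M v"
  using assms(1,3)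
proof (induction J arbitrary: u v)
  case 0
  then obtain e C where "e > 0" "\<And>p r. p \<in> space M \<Longrightarrow> r \<in> {0<..<e} \<Longrightarrow> \<bar>u r p\<bar> \<le> C"
    unfolding unif_expansion.simps by blast
  then show ?case using 0(2) assms(2)
    by (intro unif_expansion_0_intro[of "min e \<epsilon>" _ _ C]) (force simp: 0(2)[symmetric])+
next
  case (Suc J)
  then obtain u0 where u0: "bdd_meas M u0" "unif_expansion J M (\<lambda>r p. (u r p - u0 p) / r)" by auto
  have "unif_expansion J M (\<lambda>r p. (v r p - u0 p) / r)"
    by (rule Suc.IH[OF u0(2)]) (simp add: Suc.prems)
  then show ?case using u0 by auto
qed

lemma unif_expansion_add:
  assumes "unif_expansion J M u" "unif_expansion J M v"
  shows "unif_expansion J M (\<lambda>r p. u r p + v r p)"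
  using assms
proof (induction J arbitrary: u v)
  case 0
  then obtain e C e' C' where e: "e > 0" "e' > 0"
    "\<And>p r. p \<in> space M \<Longrightarrow> r \<in> {0<..<e} \<Longrightarrow> \<bar>u r p\<bar> \<le> C"
    "\<And>p r. p \<in> space M \<Longrightarrow> r \<in> {0<..<e'} \<Longrightarrow> \<bar>v r p\<bar> \<le> C'"
    unfolding unif_expansion.simps by blast
  then have "\<forall>p\<in>space M. \<forall>r\<in>{0<..<min e e'}. \<bar>u r p + v r p\<bar> \<le> C + C'"
    by (force intro: order_trans[OF abs_triangle_ineq] add_mono)
  then show ?case using e by (intro unif_expansion_0_intro[of "min e e'" _ _ "C + C'"]) auto
next
  case (Suc J)
  then obtain u0 v0 where u0: "bdd_meas M u0" "unif_expansion J M (\<lambda>r p. (u r p - u0 p) / r)"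
    and v0: "bdd_meas M v0" "unif_expansion J M (\<lambda>r p. (v r p - v0 p) / r)" by auto
  have "unif_expansion J M (\<lambda>r p. (u r p - u0 p) / r + (v r p - v0 p) / r)"
    by (rule Suc.IH[OF u0(2) v0(2)])
  then have "unif_expansion J M (\<lambda>r p. (u r p + v r p - (u0 p + v0 p)) / r)"
    by (rule unif_expansion_cong[OF _ zero_less_one]) (simp add: field_simps)
  then show ?case using bdd_meas_add[OF u0(1) v0(1)] by auto
qed

lemma unif_expansion_cmult:
  assumes "bdd_meas M b" "unif_expansion J M u"
  shows "unif_expansion J M (\<lambda>r p. b p * u r p)"
  using assms(2)
proof (induction J arbitrary: u)
  case 0
  then obtain e C where e: "e > 0" "\<And>p r. p \<in> space M \<Longrightarrow> r \<in> {0<..<e} \<Longrightarrow> \<bar>u r p\<bar> \<le> C"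
    unfolding unif_expansion.simps by blast
  obtain B where B: "\<forall>p\<in>space M. \<bar>b p\<bar> \<le> B" using assms by (auto simp: bdd_meas_def)
  have "\<bar>b p * u r p\<bar> \<le> B * C" if "p \<in> space M" "0 < r" "r < e" for p r
    using that e B by (intro abs_mult_le) auto
  then show ?case using e(1) by (intro unif_expansion_0_intro)
next
  case (Suc J)
  then obtain u0 where u0: "bdd_meas M u0" "unif_expansion J M (\<lambda>r p. (u r p - u0 p) / r)" by auto
  have "unif_expansion J M (\<lambda>r p. b p * ((u r p - u0 p) / r))" by (rule Suc.IH[OF u0(2)])
  then have "unif_expansion J M (\<lambda>r p. (b p * u r p - b p * u0 p) / r)"
    by (rule unif_expansion_cong[OF _ zero_less_one]) (simp add: field_simps)
  then show ?case using bdd_meas_mult[OF assms(1) u0(1)] by auto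
qed

text \<open>For r < 1 the function u = u0 + r * ((u - u0) / r) is bounded; at higher orders the
  induction acts on the quotient.\<close>

lemma unif_expansion_SucD: "unif_expansion (Suc J) M u \<Longrightarrow> unif_expansion J M u"
proof (induction J arbitrary: u)
  case 0
  then obtain u0 C e B where e: "e > 0" "\<forall>p\<in>space M. \<bar>u0 p\<bar> \<le> C"
    "\<And>p r. p \<in> space M \<Longrightarrow> r \<in> {0<..<e} \<Longrightarrow> \<bar>(u r p - u0 p) / r\<bar> \<le> B"
    unfolding unif_expansion.simps bdd_meas_def by blast
  have "\<bar>u r p\<bar> \<le> C + B" if p: "p \<in> space M" and r: "r \<in> {0<..<min e 1}" for p r
  proof -
    have "\<bar>u r p\<bar> \<le> \<bar>u0 p\<bar> + r * \<bar>(u r p - u0 p) / r\<bar>" using r by (simp add: abs_divide)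
    also have "\<dots> \<le> C + 1 * B" using e(2,3) p r by (intro add_mono mult_mono) auto
    finally show ?thesis by simp
  qed
  then show ?case using e(1) by (intro unif_expansion_0_intro[of "min e 1" _ _ "C + B"]) auto
next
  case (Suc J)
  then show ?case by (meson unif_expansion.simps(2))
qed

lemma unif_expansion_0I: "unif_expansion J M u \<Longrightarrow> unif_expansion 0 M u"
  by (induction J) (auto dest: unif_expansion_SucD simp del: unif_expansion.simps)

lemma unif_expansion_shift:
  assumes "unif_expansion J M u"
  shows "unif_expansion (Suc J) M (\<lambda>r p. r * u r p)"
proof -
  have "unif_expansion J M (\<lambda>r p. (r * u r p - 0) / r)"
    by (rule unif_expansion_cong[OF assms zero_less_one]) simp
  then show ?thesis unfolding unif_expansion.simps using bdd_meas_const[of M 0] by blast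
qed

lemma unif_expansion_const: "bdd_meas M b \<Longrightarrow> unif_expansion J M (\<lambda>r p. b p)"
proof (induction J arbitrary: b)
  case 0
  then show ?case by (auto simp: bdd_meas_def intro!: exI[of _ 1])
next
  case (Suc J)
  have "unif_expansion J M (\<lambda>r p. (b p - b p) / r)"
    using Suc.IH[OF bdd_meas_const[of M 0]] by simp
  then show ?case using Suc.prems by auto
qed

lemma unif_expansion_minus:
  assumes "unif_expansion J M u" "unif_expansion J M v"
  shows "unif_expansion J M (\<lambda>r p. u r p - v r p)"
  using unif_expansion_add[OF assms(1) unif_expansion_cmult[OF bdd_meas_const[of M "-1"] assms(2)]]
  by simp

lemma unif_expansion_mult:
  assumes "unif_expansion J M u" "unif_expansion J M v"
  shows "unif_expansion J M (\<lambda>r p. u r p * v r p)"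
  using assms
proof (induction J arbitrary: u v)
  case 0
  then obtain e C e' C' where e: "e > 0" "e' > 0"
    "\<And>p r. p \<in> space M \<Longrightarrow> r \<in> {0<..<e} \<Longrightarrow> \<bar>u r p\<bar> \<le> C"
    "\<And>p r. p \<in> space M \<Longrightarrow> r \<in> {0<..<e'} \<Longrightarrow> \<bar>v r p\<bar> \<le> C'"
    unfolding unif_expansion.simps by blast
  then have "\<bar>u r p * v r p\<bar> \<le> C * C'" if "p \<in> space M" "0 < r" "r < min e e'" for p r
    using that by (intro abs_mult_le) auto
  then show ?case using e by (intro unif_expansion_0_intro[of "min e e'" _ _ "C * C'"]) auto
next
  case (Suc J)
  then obtain u0 v0 where u0: "bdd_meas M u0" "unif_expansion J M (\<lambda>r p. (u r p - u0 p) / r)"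
    (is "unif_expansion J M ?u")
    and v0: "bdd_meas M v0" "unif_expansion J M (\<lambda>r p. (v r p - v0 p) / r)"
    (is "unif_expansion J M ?v") by auto
  \<comment> \<open>With u = u0 + r U and v = v0 + r V, the quotient (u v - u0 v0) / r equals u0 V +
    v0 U + r U V, and U V is covered by the induction hypothesis.\<close>
  have "unif_expansion J M (\<lambda>r p. r * (?u r p * ?v r p))"
    by (rule unif_expansion_SucD[OF unif_expansion_shift[OF Suc.IH[OF u0(2) v0(2)]]])
  then have "unif_expansion J M (\<lambda>r p. u0 p * ?v r p + v0 p * ?u r p + r * (?u r p * ?v r p))"
    by (intro unif_expansion_add unif_expansion_cmult u0 v0)
  then have "unif_expansion J M (\<lambda>r p. (u r p * v r p - u0 p * v0 p) / r)"
    by (rule unif_expansion_cong[OF _ zero_less_one]) (simp add: field_simps)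
  then show ?case using bdd_meas_mult[OF u0(1) v0(1)] by auto
qed

lemma unif_expansion_power:
  "unif_expansion J M u \<Longrightarrow> unif_expansion J M (\<lambda>r p. u r p ^ i)"
  by (induction i) (auto intro: unif_expansion_mult unif_expansion_const)

lemma unif_expansion_id: "unif_expansion J M (\<lambda>r p. r)"
proof -
  have "unif_expansion (Suc J) M (\<lambda>r p. r * 1)"
    by (intro unif_expansion_shift unif_expansion_const bdd_meas_const)
  then show ?thesis using unif_expansion_SucD by fastforce
qed

lemma unif_expansion_sum:
  assumes "\<And>i. i < N \<Longrightarrow> unif_expansion J M (u i)"
  shows "unif_expansion J M (\<lambda>r p. \<Sum>i<(N::nat). u i r p)"
  using assms
  by (induction N) (auto intro: unif_expansion_add unif_expansion_const)

text \<open>All coefficients can be taken to be 0: each division by r lowers the exponent of the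
  bound by one.\<close>

lemma unif_expansion_small:
  assumes "0 < \<epsilon>" "\<And>r p. p \<in> space M \<Longrightarrow> 0 < r \<Longrightarrow> r < \<epsilon> \<Longrightarrow> \<bar>u r p\<bar> \<le> C * r ^ J"
  shows "unif_expansion J M u"
  using assms(2)
proof (induction J arbitrary: u)
  case 0
  then show ?case using assms(1) by (intro unif_expansion_0_intro[of \<epsilon> _ _ C]) auto
next
  case (Suc J)
  have "unif_expansion J M (\<lambda>r p. u r p / r)"
    by (rule Suc.IH) (use Suc.prems in \<open>simp add: abs_divide divide_le_eq mult_ac\<close>)
  then show ?case using bdd_meas_const[of M 0] by (auto intro!: exI[of _ "\<lambda>_. 0"])
qed

lemma unif_expansion_taylor:
  assumes "0 < \<epsilon>" "\<And>j. j < J \<Longrightarrow> bdd_meas M (a j)"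
    and "\<And>r p. p \<in> space M \<Longrightarrow> 0 < r \<Longrightarrow> r < \<epsilon> \<Longrightarrow> \<bar>u r p - (\<Sum>j<J. a j p * r ^ j)\<bar> \<le> C * r ^ J"
  shows "unif_expansion J M u"
proof -
  have 1: "unif_expansion J M (\<lambda>r p. \<Sum>j<J. a j p * r ^ j)"
    using assms(2)
    by (intro unif_expansion_sum unif_expansion_cmult unif_expansion_power unif_expansion_id)
  have 2: "unif_expansion J M (\<lambda>r p. u r p - (\<Sum>j<J. a j p * r ^ j))"
    by (rule unif_expansion_small[OF assms(1,3)])
  show ?thesis using unif_expansion_add[OF 1 2] by simp
qed

lemma expansion_with_taylor:
  assumes "0 < \<epsilon>" "\<And>j. j < Suc J \<Longrightarrow> bdd_meas M (a j)"
    and "\<And>r p. p \<in> space M \<Longrightarrow> 0 < r \<Longrightarrow> r < \<epsilon> \<Longrightarrow>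
           \<bar>u r p - (\<Sum>j<Suc J. a j p * r ^ j)\<bar> \<le> C * r ^ Suc J"
  shows "expansion_with J M u (a 0)"
  unfolding expansion_with_def
proof (intro conjI unif_expansion_taylor[OF assms(1), where a = "\<lambda>j. a (Suc j)" and C = C])
  fix r p assume p: "p \<in> space M" and r: "0 < r" "r < \<epsilon>"
  have "(u r p - a 0 p) / r - (\<Sum>j<J. a (Suc j) p * r ^ j) = (u r p - (\<Sum>j<Suc J. a j p * r ^ j)) / r"
    using r by (simp add: sum.lessThan_Suc_shift field_simps sum_distrib_left del: sum.lessThan_Suc)
  also have "\<bar>\<dots>\<bar> \<le> C * r ^ J"
    using assms(3)[OF p r] r by (simp add: abs_divide divide_le_eq mult_ac del: sum.lessThan_Suc)
  finally show "\<bar>(u r p - a 0 p) / r - (\<Sum>j<J. a (Suc j) p * r ^ j)\<bar> \<le> C * r ^ J" .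
qed (use assms(2) in auto)

lemma expansion_with_const: "bdd_meas M b \<Longrightarrow> expansion_with J M (\<lambda>r p. b p) b"
  using unif_expansion_const[OF bdd_meas_const[of M 0], of J] by (simp add: expansion_with_def)

section \<open>Real powers of expansions, and expansion in a prescribed family\<close>

lemma binomial_series_remainder:
  fixes s :: real
  obtains C where "\<And>x. \<bar>x\<bar> \<le> 1/2 \<Longrightarrow> \<bar>(1 + x) powr s - (\<Sum>i<J. (s gchoose i) * x ^ i)\<bar> \<le> C * \<bar>x\<bar> ^ J"
proof -
  \<comment> \<open>Any point strictly between 1/2 and 1 would serve as well as 3/4: convergence
    there gives absolute convergence at 1/2.\<close>
  have "summable (\<lambda>i. (s gchoose i) * (3/4::real) ^ i)"
    using gen_binomial_real[of "3/4" s] by (auto dest: sums_summable)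
  then have S0: "summable (\<lambda>i. norm ((s gchoose i) * (1/2::real) ^ i))"
    by (rule powser_insidea) simp
  then have "summable (\<lambda>i. norm ((s gchoose (i + J)) * (1/2::real) ^ (i + J)))"
    by (rule summable_ignore_initial_segment)
  then have "summable (\<lambda>i. 2 ^ J * norm ((s gchoose (i + J)) * (1/2::real) ^ (i + J)))"
    by (rule summable_mult)
  then have S: "summable (\<lambda>i. \<bar>s gchoose (i + J)\<bar> * (1/2::real) ^ i)"
    by (simp add: abs_mult power_add power_one_over field_simps)
  show ?thesis
  proof
    fix x :: real assume x: "\<bar>x\<bar> \<le> 1/2"
    have sums: "(\<lambda>i. (s gchoose i) * x ^ i) sums (1 + x) powr s"
      using gen_binomial_real[of x s] x by simp
    have eq: "(1 + x) powr s - (\<Sum>i<J. (s gchoose i) * x ^ i) = (\<Sum>i. (s gchoose (i + J)) * x ^ (i + J))"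
      using suminf_minus_initial_segment[OF sums_summable[OF sums], of J] sums_unique[OF sums] by simp
    have le: "norm ((s gchoose (i + J)) * x ^ (i + J)) \<le> \<bar>x\<bar> ^ J * (\<bar>s gchoose (i + J)\<bar> * (1/2::real) ^ i)" for i
    proof -
      have "\<bar>x\<bar> ^ i \<le> (1/2) ^ i" using x by (intro power_mono) auto
      then have "(\<bar>x\<bar> ^ J * \<bar>s gchoose (i + J)\<bar>) * \<bar>x\<bar> ^ i \<le> (\<bar>x\<bar> ^ J * \<bar>s gchoose (i + J)\<bar>) * (1/2) ^ i"
        by (intro mult_left_mono) auto
      then show ?thesis by (simp add: abs_mult power_abs power_add mult_ac)
    qed
    have "norm (\<Sum>i. (s gchoose (i + J)) * x ^ (i + J)) \<le> (\<Sum>i. \<bar>x\<bar> ^ J * (\<bar>s gchoose (i + J)\<bar> * (1/2::real) ^ i))"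
      by (rule norm_suminf_le[OF le summable_mult[OF S]])
    also have "\<dots> = (\<Sum>i. \<bar>s gchoose (i + J)\<bar> * (1/2::real) ^ i) * \<bar>x\<bar> ^ J"
      by (subst suminf_mult[OF S]) simp
    finally show "\<bar>(1 + x) powr s - (\<Sum>i<J. (s gchoose i) * x ^ i)\<bar>
        \<le> (\<Sum>i. \<bar>s gchoose (i + J)\<bar> * (1/2::real) ^ i) * \<bar>x\<bar> ^ J"
      by (simp add: eq)
  qed
qed

lemma expansion_with_mult:
  assumes "expansion_with J M u u0" "expansion_with J M v v0"
  shows "expansion_with J M (\<lambda>r p. u r p * v r p) (\<lambda>p. u0 p * v0 p)"
proof -
  let ?u = "\<lambda>r p. (u r p - u0 p) / r" and ?v = "\<lambda>r p. (v r p - v0 p) / r"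
  have u: "bdd_meas M u0" "unif_expansion J M ?u" and v: "bdd_meas M v0" "unif_expansion J M ?v"
    using assms by (auto simp: expansion_with_def)
  have "unif_expansion J M (\<lambda>r p. r * (?u r p * ?v r p))"
    by (rule unif_expansion_SucD[OF unif_expansion_shift[OF unif_expansion_mult[OF u(2) v(2)]]])
  then have "unif_expansion J M (\<lambda>r p. u0 p * ?v r p + v0 p * ?u r p + r * (?u r p * ?v r p))"
    by (intro unif_expansion_add unif_expansion_cmult u v)
  then have "unif_expansion J M (\<lambda>r p. (u r p * v r p - u0 p * v0 p) / r)"
    by (rule unif_expansion_cong[OF _ zero_less_one]) (simp add: field_simps)
  then show ?thesis using bdd_meas_mult[OF u(1) v(1)] by (auto simp: expansion_with_def)
qed

text \<open>Write u = u0 (1 + r x), where x has an expansion of order J because u0 is bounded below.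
  The binomial series in r x, cut after degree J, yields the expansion of (u^s - u0^s) / r, since
  its constant term 1 cancels.\<close>

lemma expansion_with_powr:
  assumes u: "expansion_with J M u u0" and c: "0 < c" "\<And>p. p \<in> space M \<Longrightarrow> c \<le> u0 p"
  shows "expansion_with J M (\<lambda>r p. u r p powr s) (\<lambda>p. u0 p powr s)"
proof -
  have b0: "bdd_meas M u0" and eu: "unif_expansion J M (\<lambda>r p. (u r p - u0 p) / r)"
    using u by (auto simp: expansion_with_def)
  define x where "x r p = (1 / u0 p) * ((u r p - u0 p) / r)" for r p
  have bi: "bdd_meas M (\<lambda>p. 1 / u0 p)" by (rule bdd_meas_divide[OF bdd_meas_const b0 c])
  have ex: "unif_expansion J M x" unfolding x_def by (rule unif_expansion_cmult[OF bi eu])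
  obtain e C where e: "e > 0" and xC: "\<And>p r. p \<in> space M \<Longrightarrow> r \<in> {0<..<e} \<Longrightarrow> \<bar>x r p\<bar> \<le> C"
    using unif_expansion_0I[OF ex] unfolding unif_expansion.simps by blast
  \<comment> \<open>The bound is raised to at least 1 so that \<open>d\<close> is positive;
    \<open>d\<close> in turn keeps |r x| at most 1/2, the range of the binomial estimate.\<close>
  define C' where "C' = max C 1"
  define d where "d = min e (1 / (2 * C'))"
  have C': "C' \<ge> 1" "C \<le> C'" by (auto simp: C'_def)
  have d: "d > 0" using e C' by (auto simp: d_def)
  obtain K where K: "\<And>x. \<bar>x\<bar> \<le> 1/2 \<Longrightarrow> \<bar>(1 + x) powr s - (\<Sum>i<Suc J. (s gchoose i) * x ^ i)\<bar> \<le> K * \<bar>x\<bar> ^ Suc J"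
    using binomial_series_remainder[of s "Suc J"] by blast
  have "0 \<le> K * \<bar>1/2\<bar> ^ Suc J" by (rule order_trans[OF abs_ge_zero K]) simp
  then have K0: "K \<ge> 0" using mult_neg_pos[of K "\<bar>1/2\<bar> ^ Suc J"] by force
  define R where "R r p = ((1 + r * x r p) powr s - (\<Sum>i<Suc J. (s gchoose i) * (r * x r p) ^ i)) / r" for r p
  have small: "\<bar>r * x r p\<bar> \<le> 1/2 \<and> \<bar>r * x r p\<bar> \<le> C' * r" if p: "p \<in> space M" and r: "0 < r" "r < d" for r p
  proof -
    have "\<bar>x r p\<bar> \<le> C'" using xC[OF p, of r] r C' by (auto simp: d_def)
    then have 1: "\<bar>r * x r p\<bar> \<le> C' * r" using r by (simp add: abs_mult mult.commute)
    have "C' * r \<le> C' * (1 / (2 * C'))" using r C' by (intro mult_left_mono) (auto simp: d_def)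
    also have "\<dots> = 1/2" using C' by simp
    finally show ?thesis using 1 by linarith
  qed
  have eR: "unif_expansion J M R"
  proof (rule unif_expansion_small[OF d, where C = "K * C' ^ Suc J"])
    fix r p assume p: "p \<in> space M" and r: "0 < r" "r < d"
    have "\<bar>R r p\<bar> * r \<le> K * \<bar>r * x r p\<bar> ^ Suc J"
      using K[of "r * x r p"] small[OF p r] r unfolding R_def by (simp add: abs_divide del: sum.lessThan_Suc)
    also have "\<dots> \<le> K * (C' * r) ^ Suc J"
      using small[OF p r] K0 by (intro mult_left_mono power_mono) auto
    finally show "\<bar>R r p\<bar> \<le> K * C' ^ Suc J * r ^ J" using r by (simp add: power_mult_distrib)
  qed
  have "unif_expansion J M (\<lambda>r p. u0 p powr s * ((\<Sum>i<J. (s gchoose Suc i) * (r ^ i * x r p ^ Suc i)) + R r p))"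
    by (intro unif_expansion_cmult bdd_meas_powr[OF b0 c] unif_expansion_add eR unif_expansion_sum
        unif_expansion_const bdd_meas_const unif_expansion_mult unif_expansion_power
        unif_expansion_id ex)
  then have "unif_expansion J M (\<lambda>r p. (u r p powr s - u0 p powr s) / r)"
  proof (rule unif_expansion_cong[OF _ d])
    fix r p assume p: "p \<in> space M" and r: "0 < r" "r < d"
    have u0: "u0 p > 0" using c(1) c(2)[OF p] by simp
    have eq: "u r p = u0 p * (1 + r * x r p)" using r u0 by (simp add: x_def field_simps)
    have pow: "u r p powr s = u0 p powr s * (1 + r * x r p) powr s"
      unfolding eq using u0 small[OF p r] by (intro powr_mult)
    have "(\<Sum>i<Suc J. (s gchoose i) * (r * x r p) ^ i) = 1 + r * (\<Sum>i<J. (s gchoose Suc i) * (r ^ i * x r p ^ Suc i))"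
      by (simp add: sum.lessThan_Suc_shift sum_distrib_left power_mult_distrib mult_ac del: sum.lessThan_Suc)
    then have "(1 + r * x r p) powr s = 1 + r * ((\<Sum>i<J. (s gchoose Suc i) * (r ^ i * x r p ^ Suc i)) + R r p)"
      using r by (simp add: R_def field_simps del: sum.lessThan_Suc)
    then show "u0 p powr s * ((\<Sum>i<J. (s gchoose Suc i) * (r ^ i * x r p ^ Suc i)) + R r p) =
        (u r p powr s - u0 p powr s) / r"
      unfolding pow using r by (simp add: field_simps)
  qed
  then show ?thesis using bdd_meas_powr[OF b0 c] by (simp add: expansion_with_def)
qed

text \<open>Matching leading coefficients forces b 0 = u0 / w0 0, which is bounded because w0 0 is
  bounded below. Then (u - b 0 * w 0) / r has one order less and is expanded, by induction, in the
  family w (Suc j). The formula for b 0 is recorded because it produces the leading term.\<close>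

lemma expansion_triangular:
  assumes "expansion_with J M u u0"
    and "\<And>j. expansion_with J M (w j) (w0 j)"
    and "\<And>j p. p \<in> space M \<Longrightarrow> c j \<le> w0 j p" "\<And>j. 0 < c j"
  shows "\<exists>b. (\<forall>j. bdd_meas M (b j)) \<and> (\<forall>p. b 0 p = u0 p / w0 0 p) \<and>
     (\<exists>\<epsilon>>0. \<exists>C. \<forall>p\<in>space M. \<forall>r\<in>{0<..<\<epsilon>}.
        \<bar>u r p - (\<Sum>j<Suc J. b j p * r ^ j * w j r p)\<bar> \<le> C * r ^ Suc J)"
  using assms
proof (induction J arbitrary: u u0 w w0 c)
  case 0
  let ?b = "\<lambda>j p. if j = (0::nat) then u0 p / w0 0 p else 0"
  have b0: "bdd_meas M (\<lambda>p. u0 p / w0 0 p)"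
    using 0 by (intro bdd_meas_divide[where c = "c 0"]) (auto simp: expansion_with_def)
  have "unif_expansion 0 M (\<lambda>r p. (u r p - u0 p) / r - u0 p / w0 0 p * ((w 0 r p - w0 0 p) / r))"
    by (intro unif_expansion_minus unif_expansion_cmult b0) (use 0 in \<open>auto simp: expansion_with_def\<close>)
  then obtain e C where e: "e > 0" "\<And>p r. p \<in> space M \<Longrightarrow> r \<in> {0<..<e} \<Longrightarrow>
      \<bar>(u r p - u0 p) / r - u0 p / w0 0 p * ((w 0 r p - w0 0 p) / r)\<bar> \<le> C"
    unfolding unif_expansion.simps by blast
  have "\<bar>u r p - u0 p / w0 0 p * w 0 r p\<bar> \<le> C * r" if p: "p \<in> space M" and r: "r \<in> {0<..<e}" for p r
  proof -
    have "w0 0 p > 0" using 0(3)[OF p, of 0] 0(4)[of 0] by simp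
    then have "u r p - u0 p / w0 0 p * w 0 r p =
        r * ((u r p - u0 p) / r - u0 p / w0 0 p * ((w 0 r p - w0 0 p) / r))"
      using r by (simp add: field_simps)
    then show ?thesis using e(2)[OF p r] r by (simp add: abs_mult mult.commute)
  qed
  then have "\<exists>\<epsilon>>0. \<exists>C. \<forall>p\<in>space M. \<forall>r\<in>{0<..<\<epsilon>}.
        \<bar>u r p - (\<Sum>j<Suc 0. ?b j p * r ^ j * w j r p)\<bar> \<le> C * r ^ Suc 0"
    using e(1) by (intro exI[of _ e] conjI exI[of _ C]) auto
  moreover have "bdd_meas M (?b j)" for j using b0 by (cases j) auto
  ultimately show ?case by (intro exI[of _ ?b]) auto
next
  case (Suc J)
  have b0: "bdd_meas M (\<lambda>p. u0 p / w0 0 p)"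
    using Suc by (intro bdd_meas_divide[where c = "c 0"]) (auto simp: expansion_with_def)
  define v where "v r p = (u r p - u0 p) / r - u0 p / w0 0 p * ((w 0 r p - w0 0 p) / r)" for r p
  have "unif_expansion (Suc J) M v" unfolding v_def
    by (intro unif_expansion_minus unif_expansion_cmult b0)
       (use Suc.prems in \<open>auto simp: expansion_with_def simp del: unif_expansion.simps\<close>)
  then obtain v0 where v0: "expansion_with J M v v0" by (auto simp only: unif_expansion_Suc)
  \<comment> \<open>The family is lowered by one order to match that of v.\<close>
  have w: "expansion_with J M (w (Suc j)) (w0 (Suc j))" for j
    using Suc.prems(2)[of "Suc j"] unif_expansion_SucD by (auto simp only: expansion_with_def)
  have "\<exists>b. (\<forall>j. bdd_meas M (b j)) \<and> (\<forall>p. b 0 p = v0 p / w0 (Suc 0) p) \<and>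
     (\<exists>\<epsilon>>0. \<exists>C. \<forall>p\<in>space M. \<forall>r\<in>{0<..<\<epsilon>}.
        \<bar>v r p - (\<Sum>j<Suc J. b j p * r ^ j * w (Suc j) r p)\<bar> \<le> C * r ^ Suc J)"
    by (rule Suc.IH[OF v0 w, where c = "\<lambda>j. c (Suc j)"])
       (use Suc.prems in auto)
  then obtain b e C where b: "\<And>j. bdd_meas M (b j)" and e: "e > 0" "\<And>p r. p \<in> space M \<Longrightarrow> r \<in> {0<..<e} \<Longrightarrow>
      \<bar>v r p - (\<Sum>j<Suc J. b j p * r ^ j * w (Suc j) r p)\<bar> \<le> C * r ^ Suc J" by blast
  let ?b = "\<lambda>j p. case j of 0 \<Rightarrow> u0 p / w0 0 p | Suc i \<Rightarrow> b i p"
  have "\<bar>u r p - (\<Sum>j<Suc (Suc J). ?b j p * r ^ j * w j r p)\<bar> \<le> C * r ^ Suc (Suc J)"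
    if p: "p \<in> space M" and r: "r \<in> {0<..<e}" for p r
  proof -
    have w0: "w0 0 p > 0" using Suc.prems(3)[OF p, of 0] Suc.prems(4)[of 0] by simp
    have "u r p - u0 p / w0 0 p * w 0 r p = r * v r p"
      using r w0 by (simp add: field_simps v_def)
    moreover have "(\<Sum>j<Suc (Suc J). ?b j p * r ^ j * w j r p) =
       u0 p / w0 0 p * w 0 r p + r * (\<Sum>j<Suc J. b j p * r ^ j * w (Suc j) r p)"
      by (subst sum.lessThan_Suc_shift) (simp add: sum_distrib_left mult_ac del: sum.lessThan_Suc)
    ultimately have "u r p - (\<Sum>j<Suc (Suc J). ?b j p * r ^ j * w j r p) =
        r * (v r p - (\<Sum>j<Suc J. b j p * r ^ j * w (Suc j) r p))"
      by (simp add: right_diff_distrib del: sum.lessThan_Suc)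
    also have "\<bar>\<dots>\<bar> \<le> r * (C * r ^ Suc J)"
      using e(2)[OF p r] r by (simp add: abs_mult del: sum.lessThan_Suc)
    finally show ?thesis by (simp add: mult_ac del: sum.lessThan_Suc)
  qed
  then have "\<exists>\<epsilon>>0. \<exists>C. \<forall>p\<in>space M. \<forall>r\<in>{0<..<\<epsilon>}.
        \<bar>u r p - (\<Sum>j<Suc (Suc J). ?b j p * r ^ j * w j r p)\<bar> \<le> C * r ^ Suc (Suc J)"
    using e(1) by blast
  moreover have "bdd_meas M (?b j)" for j using b0 b by (cases j) auto
  ultimately show ?case by (intro exI[of _ ?b]) (simp del: sum.lessThan_Suc)
qed

subsection \<open>Polar coordinates\<close>

text \<open>The radial factor r^(n-1) dr of Lebesgue measure. It is a measure on the whole line,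
  without mass on the negative side, so that its values on the sets {..a} determine it.\<close>

definition radial_measure :: "nat \<Rightarrow> real measure" where
  "radial_measure n = density lborel (\<lambda>r. ennreal (indicator {0<..} r * r ^ (n - 1)))"

lemma sets_radial_measure [measurable_cong, simp]: "sets (radial_measure n) = sets borel"
  by (simp add: radial_measure_def)

lemma sets_sphere_measure [measurable_cong, simp]:
  "sets (sphere_measure :: (real ^ 'n::finite) measure) = sets (restrict_space borel (sphere 0 1))"
  by (simp add: sphere_measure_def)

lemma space_sphere_measure [simp]: "space (sphere_measure :: (real ^ 'n::finite) measure) = sphere 0 1"
  by (simp add: sphere_measure_def space_restrict_space)

text \<open>The origin is excluded because \<open>sgn 0 = 0\<close> does not lie on the
  sphere.\<close>

lemma sgn_measurable_sphere:
  assumes "0 \<notin> A" 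
  shows "sgn \<in> measurable (restrict_space borel A) (restrict_space borel (sphere (0 :: 'a::euclidean_space) 1))"
proof (rule measurable_restrict_space2)
  show "sgn \<in> space (restrict_space borel A) \<rightarrow> sphere (0::'a) 1"
    using assms by (auto simp: space_restrict_space norm_sgn)
  have "(\<lambda>x::'a. inverse (norm x) *\<^sub>R x) \<in> borel_measurable borel" by measurable
  then show "sgn \<in> borel_measurable (restrict_space borel A)"
    by (intro measurable_restrict_space1) (simp add: sgn_div_norm[abs_def])
qed

lemma cone_measurable:
  fixes B :: "'a::euclidean_space set"
  assumes "B \<in> sets (restrict_space borel (sphere 0 1))" "A \<in> sets borel"
  shows "{w. w \<noteq> 0 \<and> norm w \<in> A \<and> sgn w \<in> B} \<in> sets borel"
proof -
  have "sgn -` B \<inter> space (restrict_space borel (- {0})) \<in> sets (restrict_space borel (- {0::'a}))"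
    by (rule measurable_sets[OF sgn_measurable_sphere assms(1)]) simp
  then have 1: "sgn -` B \<inter> - {0} \<in> sets borel"
    by (simp add: sets_restrict_space_iff space_restrict_space)
  have 2: "norm -` A \<in> sets (borel :: 'a measure)"
    using measurable_sets[OF borel_measurable_norm assms(2)] by simp
  have "{w. w \<noteq> 0 \<and> norm w \<in> A \<and> sgn w \<in> B} = (sgn -` B \<inter> - {0}) \<inter> norm -` A" by auto
  then show ?thesis using 1 2 by auto
qed

text \<open>Dilation by r carries the unit truncated cone over B to the one of radius r and
  multiplies Lebesgue measure by r to the power of the dimension.\<close>

lemma emeasure_cone_scale:
  fixes B :: "'a::euclidean_space set"
  assumes B: "B \<in> sets (restrict_space borel (sphere 0 1))" and r: "0 < r"
  shows "emeasure lborel {w. w \<noteq> 0 \<and> norm w \<in> {..r} \<and> sgn w \<in> B} =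
    ennreal (r ^ DIM('a)) * emeasure lborel {w. w \<noteq> 0 \<and> norm w \<in> {..1} \<and> sgn w \<in> B}"
    (is "emeasure _ ?A = _ * emeasure _ ?A1")
proof -
  have A: "?A \<in> sets borel" by (rule cone_measurable[OF B]) simp
  have T: "(\<lambda>x::'a. 0 + r *\<^sub>R x) \<in> borel_measurable borel" by measurable
  have vim: "(\<lambda>x. 0 + r *\<^sub>R x) -` ?A = ?A1" using r by (auto simp: sgn_scaleR)
  have "emeasure lborel ?A = emeasure (density (distr lborel borel (\<lambda>x. 0 + r *\<^sub>R x)) (\<lambda>_. \<bar>r\<bar>^DIM('a))) ?A"
    using lborel_affine[of r "0::'a"] r by simp
  also have "\<dots> = ennreal (r ^ DIM('a)) * emeasure (distr lborel borel (\<lambda>x. 0 + r *\<^sub>R x)) ?A"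
    using A r by (subst emeasure_density_const) auto
  also have "emeasure (distr lborel borel (\<lambda>x. 0 + r *\<^sub>R x)) ?A =
      emeasure lborel ((\<lambda>x. 0 + r *\<^sub>R x) -` ?A \<inter> space lborel)"
    by (rule emeasure_distr[OF _ A]) (use T in simp)
  also have "\<dots> = emeasure lborel ?A1" by (simp only: vim space_lborel space_borel Int_UNIV_right)
  finally show ?thesis .
qed

lemma emeasure_sphere_measure:
  fixes B :: "(real ^ 'n::finite) set"
  assumes B: "B \<in> sets (restrict_space borel (sphere 0 1))"
  shows "emeasure sphere_measure B =
    of_nat CARD('n) * emeasure lborel {w. w \<noteq> 0 \<and> norm w \<in> {..1} \<and> sgn w \<in> B}"
proof -
  let ?C = "cball 0 1 - {0} :: (real ^ 'n) set"
  have m: "sgn \<in> measurable (restrict_space lborel ?C) (restrict_space borel (sphere 0 1))"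
    using sgn_measurable_sphere[of ?C] by (simp cong: measurable_cong_sets)
  have eq: "sgn -` B \<inter> space (restrict_space lborel ?C) = {w. w \<noteq> 0 \<and> norm w \<in> {..1} \<and> sgn w \<in> B}"
    by (auto simp: space_restrict_space)
  have "emeasure sphere_measure B = of_nat CARD('n) *
      emeasure (distr (restrict_space lborel ?C) (restrict_space borel (sphere 0 1)) sgn) B"
    unfolding sphere_measure_def using B by (subst emeasure_density_const) auto
  also have "emeasure (distr (restrict_space lborel ?C) (restrict_space borel (sphere 0 1)) sgn) B
      = emeasure (restrict_space lborel ?C) {w. w \<noteq> 0 \<and> norm w \<in> {..1} \<and> sgn w \<in> B}"
    using emeasure_distr[OF m, of B] B by (simp only: eq)
  also have "\<dots> = emeasure lborel {w. w \<noteq> 0 \<and> norm w \<in> {..1} \<and> sgn w \<in> B}"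
    by (rule emeasure_restrict_space) auto
  finally show ?thesis .
qed

text \<open>The cone over the whole sphere is the punctured unit ball, which has finite
  volume.\<close>

lemma finite_sphere_measure: "finite_measure (sphere_measure :: (real ^ 'n::finite) measure)"
proof
  let ?C = "{w :: real ^ 'n. w \<noteq> 0 \<and> norm w \<in> {..1} \<and> sgn w \<in> sphere 0 1}"
  have "emeasure lborel ?C \<le> emeasure lborel (cball 0 1 :: (real ^ 'n) set)"
    by (rule emeasure_mono) auto
  also have "\<dots> < \<infinity>" by (rule emeasure_bounded_finite) simp
  finally have "emeasure lborel ?C \<noteq> \<infinity>" by simp
  then show "emeasure sphere_measure (space (sphere_measure :: (real ^ 'n) measure)) \<noteq> \<infinity>"
    by (subst emeasure_sphere_measure) (auto simp: ennreal_mult_eq_top_iff sets_restrict_space_iff)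
qed

lemma emeasure_radial_atMost:
  assumes "0 < n"
  shows "emeasure (radial_measure n) {..a} = ennreal (if 0 < a then a ^ n / n else 0)"
proof -
  have "emeasure (radial_measure n) {..a} =
      (\<integral>\<^sup>+r. ennreal (indicator {0<..} r * r ^ (n - 1)) * indicator {..a} r \<partial>lborel)"
    unfolding radial_measure_def by (rule emeasure_density) auto
  also have "\<dots> = (\<integral>\<^sup>+r. ennreal (r ^ (n - 1)) * indicator {0..a} r \<partial>lborel)"
  proof (rule nn_integral_cong_AE)
    show "AE r in lborel. ennreal (indicator {0<..} r * r ^ (n - 1)) * indicator {..a} r =
        ennreal (r ^ (n - 1)) * indicator {0..a} r"
      using AE_lborel_singleton[of "0::real"] by eventually_elim (auto split: split_indicator)
  qed
  also have "\<dots> = ennreal (if 0 < a then a ^ n / n else 0)"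
  proof (cases "0 < a")
    case True
    have "(\<integral>\<^sup>+r. ennreal (r ^ (n - 1)) * indicator {0..a} r \<partial>lborel) = ennreal (a ^ n / n - 0 ^ n / n)"
      using True assms
      by (intro nn_integral_FTC_Icc) (auto intro!: derivative_eq_intros)
    then show ?thesis using True assms by (simp add: zero_power)
  next
    case False
    have "(\<integral>\<^sup>+r. ennreal (r ^ (n - 1)) * indicator {0..a} r \<partial>lborel) = (\<integral>\<^sup>+r. 0 \<partial>(lborel :: real measure))"
      by (rule nn_integral_cong_AE, use AE_lborel_singleton[of "0::real"] in eventually_elim)
         (use False in \<open>auto split: split_indicator\<close>)
    then show ?thesis using False by simp
  qed
  finally show ?thesis .
qed

text \<open>For fixed B both sides are measures in A. On {..a} with a > 0 the radial mass is a^n /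
  n, the factor n cancels against the normalization of the surface measure, and the cone scales like
  a^n. The half-lines generate the Borel sets, so agreement on them is enough.\<close>

lemma emeasure_polar_rectangle:
  fixes B :: "(real ^ 'n::finite) set"
  assumes B: "B \<in> sets (restrict_space borel (sphere 0 1))" and A: "A \<in> sets borel"
  shows "emeasure (radial_measure CARD('n)) A * emeasure sphere_measure B =
    emeasure lborel {w. w \<noteq> 0 \<and> norm w \<in> A \<and> sgn w \<in> B}"
proof -
  let ?X = "\<lambda>A. {w. w \<noteq> 0 \<and> norm w \<in> A \<and> sgn w \<in> B}"
  let ?M = "density (radial_measure CARD('n)) (\<lambda>_. emeasure sphere_measure B)"
  let ?N = "distr (restrict_space lborel (?X UNIV)) borel norm"
  have M: "emeasure ?M A = emeasure sphere_measure B * emeasure (radial_measure CARD('n)) A"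
    if "A \<in> sets borel" for A
    using that by (intro emeasure_density_const) simp
  have N: "emeasure ?N A = emeasure lborel (?X A)" if A: "A \<in> sets borel" for A
  proof -
    have "emeasure ?N A = emeasure (restrict_space lborel (?X UNIV)) (norm -` A \<inter> space (restrict_space lborel (?X UNIV)))"
      by (intro emeasure_distr A measurable_restrict_space1) simp
    also have "norm -` A \<inter> space (restrict_space lborel (?X UNIV)) = ?X A"
      by (auto simp: space_restrict_space)
    also have "emeasure (restrict_space lborel (?X UNIV)) (?X A) = emeasure lborel (?X A)"
      using cone_measurable[OF B, of UNIV] by (intro emeasure_restrict_space) auto
    finally show ?thesis .
  qed
  have fin: "emeasure sphere_measure B \<noteq> \<infinity>"
    using finite_measure.emeasure_finite[OF finite_sphere_measure] by simp
  have "?M = ?N"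
  proof (rule measure_eqI_generator_eq[where E = "range atMost" and \<Omega> = UNIV and A = "\<lambda>i::nat. {..real i}"])
    show "Int_stable (range atMost :: real set set)"
      by (auto simp: Int_stable_def)
    fix X :: "real set" assume "X \<in> range atMost"
    then obtain a where X: "X = {..a}" by auto
    show "emeasure ?M X = emeasure ?N X"
    proof (cases "0 < a")
      case True
      have "emeasure ?M X = of_nat CARD('n) * emeasure lborel (?X {..1}) * ennreal (a ^ CARD('n) / CARD('n))"
        using True M[of X] by (simp add: X emeasure_radial_atMost emeasure_sphere_measure[OF B])
      also have "\<dots> = (of_nat CARD('n) * ennreal (a ^ CARD('n) / CARD('n))) * emeasure lborel (?X {..1})"
        by (simp add: mult_ac)
      also have "of_nat CARD('n) * ennreal (a ^ CARD('n) / CARD('n)) = ennreal (a ^ CARD('n))"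
        using True by (simp add: ennreal_of_nat_eq_real_of_nat ennreal_mult[symmetric])
      also have "ennreal (a ^ CARD('n)) * emeasure lborel (?X {..1}) = emeasure ?N X"
        using N[of X] emeasure_cone_scale[OF B True] by (simp add: X)
      finally show ?thesis .
    next
      case False
      then have "?X X = {}"
        by (auto simp: X) (meson dual_order.trans norm_le_zero_iff not_le)
      moreover have "emeasure ?N X = emeasure lborel (?X X)" by (rule N) (simp add: X)
      ultimately have "emeasure ?N X = 0" by (simp only: emeasure_empty)
      then show ?thesis using False by (simp add: M X emeasure_radial_atMost)
    qed
  next
    show "sets ?M = sigma_sets UNIV (range atMost)" "sets ?N = sigma_sets UNIV (range atMost)"
      by (simp_all add: borel_eq_atMost)
    show "(\<Union>i. {..real i}) = UNIV" by (auto intro: real_arch_simple)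
    show "emeasure ?M {..real i} \<noteq> \<infinity>" for i
      using fin by (simp add: M emeasure_radial_atMost ennreal_mult_eq_top_iff)
  qed auto
  then show ?thesis using M[OF A] N[OF A] by (simp add: mult.commute)
qed

lemma sigma_finite_radial_measure: "sigma_finite_measure (radial_measure n)"
  unfolding radial_measure_def
  by (subst sigma_finite_measure.sigma_finite_iff_density_finite) (auto simp: sigma_finite_lborel)

text \<open>By uniqueness of the product measure only rectangles need checking, and their preimages
  are the cones just measured.\<close>

lemma polar_coordinates_measure:
  "radial_measure CARD('n) \<Otimes>\<^sub>M (sphere_measure :: (real ^ 'n::finite) measure) =
    distr (restrict_space lborel (- {0})) (borel \<Otimes>\<^sub>M restrict_space borel (sphere 0 1)) (\<lambda>w. (norm w, sgn w))"
proof (rule pair_measure_eqI)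
  show "sigma_finite_measure (sphere_measure :: (real ^ 'n) measure)"
    using finite_sphere_measure by (rule finite_measure.axioms)
  show "sets (radial_measure CARD('n) \<Otimes>\<^sub>M (sphere_measure :: (real ^ 'n) measure)) =
    sets (distr (restrict_space lborel (- {0})) (borel \<Otimes>\<^sub>M restrict_space borel (sphere 0 1)) (\<lambda>w. (norm w, sgn w)))"
    by (simp cong: sets_pair_measure_cong)
  fix A :: "real set" and B :: "(real ^ 'n) set"
  assume A: "A \<in> sets (radial_measure CARD('n))" and B: "B \<in> sets sphere_measure"
  have s: "sgn \<in> measurable (restrict_space lborel (- {0})) (restrict_space borel (sphere (0::real^'n) 1))"
    using sgn_measurable_sphere[of "- {0::real^'n}"] by (simp cong: measurable_cong_sets)
  have m: "(\<lambda>w. (norm w, sgn w)) \<in> measurable (restrict_space lborel (- {0::real^'n})) (borel \<Otimes>\<^sub>M restrict_space borel (sphere 0 1))"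
    by (intro measurable_Pair s measurable_restrict_space1) simp
  have "emeasure (distr (restrict_space lborel (- {0})) (borel \<Otimes>\<^sub>M restrict_space borel (sphere 0 1)) (\<lambda>w. (norm w, sgn w))) (A \<times> B)
     = emeasure (restrict_space lborel (- {0})) ((\<lambda>w. (norm w, sgn w)) -` (A \<times> B) \<inter> space (restrict_space lborel (- {0})))"
    using A B by (intro emeasure_distr m) simp
  also have "(\<lambda>w. (norm w, sgn w)) -` (A \<times> B) \<inter> space (restrict_space lborel (- {0})) = {w. w \<noteq> 0 \<and> norm w \<in> A \<and> sgn w \<in> B}"
    by (auto simp: space_restrict_space)
  also have "emeasure (restrict_space lborel (- {0})) \<dots> = emeasure lborel {w. w \<noteq> 0 \<and> norm w \<in> A \<and> sgn w \<in> B}"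
    by (rule emeasure_restrict_space) auto
  finally show "emeasure (radial_measure CARD('n)) A * emeasure sphere_measure B = emeasure
     (distr (restrict_space lborel (- {0})) (borel \<Otimes>\<^sub>M restrict_space borel (sphere 0 1)) (\<lambda>w. (norm w, sgn w))) (A \<times> B)"
    using emeasure_polar_rectangle[of B A] A B by simp
qed (rule sigma_finite_radial_measure)

text \<open>The inner integral runs along the ray and the outer one over the sphere, the order in
  which estimates uniform in \<theta> can be inserted. The origin, absent from polar coordinates, is
  a null set.\<close>

lemma polar_integral:
  fixes f :: "real ^ 'n::finite \<Rightarrow> real"
  assumes f: "integrable lborel f"
  shows "integrable sphere_measure
      (\<lambda>\<theta>. LINT r|lborel. indicator {0<..} r * r ^ (CARD('n) - 1) * f (r *\<^sub>R \<theta>))" (is ?int)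
    and "(LINT w|lborel. f w) = (LINT \<theta>|sphere_measure. LINT r|lborel.
           indicator {0<..} r * r ^ (CARD('n) - 1) * f (r *\<^sub>R \<theta>))" (is ?eq)
proof -
  let ?R = "radial_measure CARD('n)" and ?S = "sphere_measure :: (real ^ 'n) measure"
  let ?N = "borel \<Otimes>\<^sub>M restrict_space borel (sphere (0 :: real ^ 'n) 1)"
  interpret S: finite_measure ?S by (rule finite_sphere_measure)
  interpret R: sigma_finite_measure ?R by (rule sigma_finite_radial_measure)
  interpret pair_sigma_finite ?R ?S ..
  have fm [measurable]: "f \<in> borel_measurable borel" using f by simp
  have s: "sgn \<in> measurable (restrict_space lborel (- {0})) (restrict_space borel (sphere (0::real^'n) 1))"
    using sgn_measurable_sphere[of "- {0::real^'n}"] by (simp cong: measurable_cong_sets)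
  have m: "(\<lambda>w. (norm w, sgn w)) \<in> measurable (restrict_space lborel (- {0::real^'n})) ?N"
    by (intro measurable_Pair s measurable_restrict_space1) simp
  have [measurable]: "(\<lambda>\<theta>. \<theta>) \<in> measurable (restrict_space borel (sphere (0 :: real ^ 'n) 1)) borel"
    by (rule measurable_restrict_space1) simp
  have g: "(\<lambda>(r, \<theta>). f (r *\<^sub>R \<theta>)) \<in> borel_measurable ?N"
    by measurable
  have id: "(case (norm w, sgn w) of (r, \<theta>) \<Rightarrow> f (r *\<^sub>R \<theta>)) = f w" for w
    by (cases "w = 0") (simp_all add: sgn_div_norm)
  have ae: "AE w in lborel. indicator (- {0}) w *\<^sub>R f w = f w"
    using AE_lborel_singleton[of "0 :: real ^ 'n"] by eventually_elim simp
  have fi: "integrable (restrict_space lborel (- {0})) f"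
    by (subst integrable_restrict_space, simp, rule integrable_mult_indicator[OF _ f]) simp
  have i: "integrable (?R \<Otimes>\<^sub>M ?S) (\<lambda>(r, \<theta>). f (r *\<^sub>R \<theta>))"
    unfolding polar_coordinates_measure
    by (subst integrable_distr_eq[OF m g]) (simp only: id fi)
  have "(LINT w|lborel. f w) = integral\<^sup>L (restrict_space lborel (- {0})) f"
    by (subst integral_restrict_space) (use ae in \<open>auto intro!: integral_cong_AE\<close>)
  also have "\<dots> = integral\<^sup>L (?R \<Otimes>\<^sub>M ?S) (\<lambda>(r, \<theta>). f (r *\<^sub>R \<theta>))"
    unfolding polar_coordinates_measure
    by (subst integral_distr[OF m g]) (simp only: id)
  also have "\<dots> = (LINT \<theta>|?S. LINT r|?R. f (r *\<^sub>R \<theta>))"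
    using integral_snd[OF i] by simp
  finally have eq: "(LINT w|lborel. f w) = (LINT \<theta>|?S. LINT r|?R. f (r *\<^sub>R \<theta>))" .
  have inner: "(LINT r|?R. f (r *\<^sub>R \<theta>)) = (LINT r|lborel. indicator {0<..} r * r ^ (CARD('n) - 1) * f (r *\<^sub>R \<theta>))" for \<theta>
    unfolding radial_measure_def
    by (subst integral_density) (auto split: split_indicator)
  show ?eq using eq by (simp only: inner)
  show ?int using integrable_snd[OF i] by (simp only: inner prod.case)
qed

subsection \<open>Integrals along a ray\<close>

text \<open>Near 0 the integrand is dominated by t^(\<alpha>-1), integrable since \<alpha> > 0;
  beyond 1 by t^(\<alpha>-1-m), integrable since \<alpha> < m.\<close>

lemma powr_decay_integrable:
  assumes \<alpha>: "0 < \<alpha>" and m: "\<alpha> < real m"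
  shows "integrable lborel (\<lambda>t. indicator {0<..} t * (t powr (\<alpha> - 1) * (1 / (1 + t ^ m))))"
proof -
  have "(\<lambda>t. t powr (\<alpha> - 1)) absolutely_integrable_on {0..1}"
    by (rule nonnegative_absolutely_integrable_1) (use \<alpha> in \<open>auto intro!: integrable_on_powr_from_0\<close>)
  then have 1: "integrable lborel (\<lambda>t. indicator {0..1} t *\<^sub>R t powr (\<alpha> - 1))"
    unfolding set_integrable_def by (subst (asm) integrable_completion) auto
  have "(\<lambda>t. t powr (\<alpha> - 1 - m)) integrable_on {1..}"
    using has_integral_powr_to_inf[of "\<alpha> - 1 - m" 1] m by (auto simp: integrable_on_def)
  then have "(\<lambda>t. t powr (\<alpha> - 1 - m)) absolutely_integrable_on {1..}"
    by (intro nonnegative_absolutely_integrable_1) auto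
  then have 2: "integrable lborel (\<lambda>t. indicator {1..} t *\<^sub>R t powr (\<alpha> - 1 - m))"
    unfolding set_integrable_def by (subst (asm) integrable_completion) auto
  show ?thesis
  proof (rule Bochner_Integration.integrable_bound[OF Bochner_Integration.integrable_add[OF 1 2]])
    show "AE t in lborel. norm (indicator {0<..} t * (t powr (\<alpha> - 1) * (1 / (1 + t ^ m))))
        \<le> norm (indicator {0..1} t *\<^sub>R t powr (\<alpha> - 1) + indicator {1..} t *\<^sub>R t powr (\<alpha> - 1 - m))"
    proof (rule AE_I2)
      fix t :: real
      consider "t \<le> 0" | "0 < t" "t \<le> 1" | "1 < t" by linarith
      then show "norm (indicator {0<..} t * (t powr (\<alpha> - 1) * (1 / (1 + t ^ m))))
        \<le> norm (indicator {0..1} t *\<^sub>R t powr (\<alpha> - 1) + indicator {1..} t *\<^sub>R t powr (\<alpha> - 1 - m))"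
      proof cases
        case 2
        have "t powr (\<alpha> - 1) * (1 / (1 + t ^ m)) \<le> t powr (\<alpha> - 1) * 1"
          using 2 by (intro mult_left_mono) (auto simp: divide_le_eq)
        then show ?thesis using 2 by (auto split: split_indicator)
      next
        case 3
        have "t powr (\<alpha> - 1) * (1 / (1 + t ^ m)) \<le> t powr (\<alpha> - 1) * (1 / t ^ m)"
          using 3 by (intro mult_left_mono divide_left_mono) (auto simp: add_pos_pos)
        also have "\<dots> = t powr (\<alpha> - 1 - m)" using 3 by (simp add: powr_diff powr_realpow)
        finally show ?thesis using 3 by (auto split: split_indicator)
      qed auto
    qed
  qed measurable
qed

text \<open>Substitution t = z s. This homogeneity is the source of every power of z in the
  expansion.\<close>

lemma integral_powr_scale:
  fixes h :: "real \<Rightarrow> real"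
  assumes z: "0 < z"
  shows "(LINT s|lborel. indicator {0<..} s * (s powr (\<alpha> - 1) * h (z * s))) =
    z powr (- \<alpha>) * (LINT t|lborel. indicator {0<..} t * (t powr (\<alpha> - 1) * h t))" (is ?eq)
    and "integrable lborel (\<lambda>t. indicator {0<..} t * (t powr (\<alpha> - 1) * h t)) \<Longrightarrow>
      integrable lborel (\<lambda>s. indicator {0<..} s * (s powr (\<alpha> - 1) * h (z * s)))" (is "_ \<Longrightarrow> ?int")
proof -
  have eq: "indicator {0<..} (0 + z * s) * ((0 + z * s) powr (\<alpha> - 1) * h (0 + z * s)) =
      z powr (\<alpha> - 1) * (indicator {0<..} s * (s powr (\<alpha> - 1) * h (z * s)))" for s
    using z by (auto split: split_indicator simp: powr_mult zero_less_mult_iff)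
  have "(LINT t|lborel. indicator {0<..} t * (t powr (\<alpha> - 1) * h t)) =
      z powr \<alpha> * (LINT s|lborel. indicator {0<..} s * (s powr (\<alpha> - 1) * h (z * s)))"
    using lborel_integral_real_affine[of z "\<lambda>t. indicator {0<..} t * (t powr (\<alpha> - 1) * h t)" 0] z
    unfolding eq integral_mult_right_zero using powr_mult_base[of z "\<alpha> - 1"] z by (simp add: mult.assoc[symmetric])
  then show ?eq using z by (simp add: powr_minus)
  assume "integrable lborel (\<lambda>t. indicator {0<..} t * (t powr (\<alpha> - 1) * h t))"
  from lborel_integrable_real_affine[OF this, of z 0]
  show ?int unfolding eq using z by simp
qed

text \<open>Controls the remainder of the expansion on a ray: with P = n - 1 + J it gives the error
  exponent (n + J) / k.\<close>

lemma ray_integral_bound: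
  fixes c z :: real
  assumes "0 < c" "0 < z" "0 < k" "P + 1 < k * m"
  shows "integrable lborel (\<lambda>r. indicator {0<..} r * (r ^ P * (1 / (1 + (z * (c * r ^ k)) ^ m))))" (is ?int)
    and "(LINT r|lborel. indicator {0<..} r * (r ^ P * (1 / (1 + (z * (c * r ^ k)) ^ m)))) =
      c powr (- (real P + 1) / k) * (LINT t|lborel. indicator {0<..} t * (t powr real P * (1 / (1 + t ^ (k * m)))))
        * z powr (- (real P + 1) / k)" (is ?eq)
proof -
  \<comment> \<open>The k-th power of \<open>?y * r\<close> is z * c * r^k, so rescaling by
    \<open>?y\<close> clears z and c from the integrand.\<close>
  let ?y = "(z * c) powr (1 / k)"
  have y: "?y > 0" "?y ^ k = z * c" using assms by (auto simp: powr_realpow[symmetric] powr_powr)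
  have eq: "indicator {0<..} r * (r ^ P * (1 / (1 + (z * (c * r ^ k)) ^ m))) =
      indicator {0<..} r * (r powr ((real P + 1) - 1) * (1 / (1 + (?y * r) ^ (k * m))))" for r :: real
    by (auto split: split_indicator simp: powr_realpow power_mult power_mult_distrib y)
  have i: "integrable lborel (\<lambda>t. indicator {0<..} t * (t powr ((real P + 1) - 1) * (1 / (1 + t ^ (k * m)))))"
    by (rule powr_decay_integrable) (use assms(4) in \<open>auto simp flip: of_nat_mult of_nat_Suc\<close>)
  show ?int unfolding eq by (rule integral_powr_scale(2)[OF y(1) i])
  have "?y powr (- (real P + 1)) = c powr (- (real P + 1) / k) * z powr (- (real P + 1) / k)"
    using assms by (simp add: powr_powr powr_mult)
  then show ?eq unfolding eq
    by (subst integral_powr_scale(1)[OF y(1), where h = "\<lambda>t. 1 / (1 + t ^ (k * m))"]) simp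
qed

text \<open>Beyond s = c the exponent \<alpha> can be traded for the larger \<beta> at the price c
  powr (\<alpha> - \<beta>), and scaling then yields z powr (-\<beta>). Cutting an integral off at a
  fixed positive point thus costs only an error of the order set by \<beta>.\<close>

lemma tail_integral_bound:
  fixes c z :: real
  assumes "0 < c" "0 < z" "0 < \<alpha>" "\<alpha> \<le> \<beta>" "\<beta> < real m"
  shows "integrable lborel (\<lambda>s. indicator {c<..} s * (s powr (\<alpha> - 1) * (1 / (1 + (z * s) ^ m))))" (is ?int)
    and "(LINT s|lborel. indicator {c<..} s * (s powr (\<alpha> - 1) * (1 / (1 + (z * s) ^ m)))) \<le>
      c powr (\<alpha> - \<beta>) * (LINT t|lborel. indicator {0<..} t * (t powr (\<beta> - 1) * (1 / (1 + t ^ m))))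
        * z powr (- \<beta>)" (is ?le)
proof -
  have i: "integrable lborel (\<lambda>s. indicator {0<..} s * (s powr (\<beta> - 1) * (1 / (1 + (z * s) ^ m))))"
    using integral_powr_scale(2)[OF assms(2) powr_decay_integrable, of \<beta> m] assms by simp
  then have i': "integrable lborel (\<lambda>s. c powr (\<alpha> - \<beta>) * (indicator {0<..} s * (s powr (\<beta> - 1) * (1 / (1 + (z * s) ^ m)))))"
    by (rule integrable_mult_right)
  have le: "indicator {c<..} s * (s powr (\<alpha> - 1) * (1 / (1 + (z * s) ^ m))) \<le>
      c powr (\<alpha> - \<beta>) * (indicator {0<..} s * (s powr (\<beta> - 1) * (1 / (1 + (z * s) ^ m))))" for s
  proof (cases "c < s")
    case True
    have "s powr (\<alpha> - 1) = s powr (\<alpha> - \<beta>) * s powr (\<beta> - 1)" using True assms by (simp add: powr_add[symmetric])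
    also have "\<dots> \<le> c powr (\<alpha> - \<beta>) * s powr (\<beta> - 1)"
      using True assms by (intro mult_right_mono powr_mono2') auto
    finally have "s powr (\<alpha> - 1) * (1 / (1 + (z * s) ^ m)) \<le> c powr (\<alpha> - \<beta>) * s powr (\<beta> - 1) * (1 / (1 + (z * s) ^ m))"
      using True assms by (intro mult_right_mono) (auto intro!: add_nonneg_nonneg)
    then show ?thesis using True assms by simp
  next
    case False
    then show ?thesis using assms by (auto split: split_indicator intro!: mult_nonneg_nonneg add_nonneg_nonneg)
  qed
  show ?int
  proof (rule Bochner_Integration.integrable_bound[OF i'])
    show "AE s in lborel. norm (indicator {c<..} s * (s powr (\<alpha> - 1) * (1 / (1 + (z * s) ^ m)))) \<le>
      norm (c powr (\<alpha> - \<beta>) * (indicator {0<..} s * (s powr (\<beta> - 1) * (1 / (1 + (z * s) ^ m)))))"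
    proof (rule AE_I2)
      fix s :: real
      have "0 \<le> indicator {c<..} s * (s powr (\<alpha> - 1) * (1 / (1 + (z * s) ^ m)))"
        using assms by (auto split: split_indicator intro!: mult_nonneg_nonneg add_nonneg_nonneg)
      then show "norm (indicator {c<..} s * (s powr (\<alpha> - 1) * (1 / (1 + (z * s) ^ m)))) \<le>
        norm (c powr (\<alpha> - \<beta>) * (indicator {0<..} s * (s powr (\<beta> - 1) * (1 / (1 + (z * s) ^ m)))))"
        using le[of s] by (smt (verit) real_norm_def)
    qed
  qed measurable
  then have "(LINT s|lborel. indicator {c<..} s * (s powr (\<alpha> - 1) * (1 / (1 + (z * s) ^ m)))) \<le>
      (LINT s|lborel. c powr (\<alpha> - \<beta>) * (indicator {0<..} s * (s powr (\<beta> - 1) * (1 / (1 + (z * s) ^ m)))))"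
    by (rule integral_mono[OF _ i' le])
  also have "\<dots> = c powr (\<alpha> - \<beta>) * (LINT t|lborel. indicator {0<..} t * (t powr (\<beta> - 1) * (1 / (1 + t ^ m))))
        * z powr (- \<beta>)"
    by (subst integral_mult_right_zero,
        subst integral_powr_scale(1)[OF assms(2), where h = "\<lambda>t. 1 / (1 + t ^ m)"]) simp
  finally show ?le .
qed


text \<open>The terms of the expansion of \<open>H\<close> are arranged so that the substitution \<open>s = \<phi> p r\<close> turns each
  of them into an integral over an interval in which \<open>z\<close> occurs only through \<open>z * s\<close>.\<close>

lemma ray_integral_expansion:
  fixes \<phi> \<phi>' :: "'p \<Rightarrow> real \<Rightarrow> real" and H :: "'p \<Rightarrow> real \<Rightarrow> real \<Rightarrow> real"
    and a :: "nat \<Rightarrow> 'p \<Rightarrow> real \<Rightarrow> real" and w :: "nat \<Rightarrow> 'p \<Rightarrow> real \<Rightarrow> real"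
  assumes \<epsilon>: "0 < \<epsilon>" and c: "0 < c" and n: "0 < n" and k: "0 < k" and m: "n + J < k * m"
    and \<phi>0: "\<And>p. p \<in> P \<Longrightarrow> \<phi> p 0 = 0"
    and deriv: "\<And>p r. p \<in> P \<Longrightarrow> r \<in> {0..\<epsilon>} \<Longrightarrow> (\<phi> p has_real_derivative \<phi>' p r) (at r)"
    and cont: "\<And>p. p \<in> P \<Longrightarrow> continuous_on {0..\<epsilon>} (\<phi>' p)"
    and nonneg: "\<And>p r. p \<in> P \<Longrightarrow> r \<in> {0..\<epsilon>} \<Longrightarrow> 0 \<le> \<phi>' p r"
    and lower: "\<And>p r. p \<in> P \<Longrightarrow> r \<in> {0..\<epsilon>} \<Longrightarrow> c * r ^ k \<le> \<phi> p r"
    and a_meas: "\<And>j p. p \<in> P \<Longrightarrow> a j p \<in> borel_measurable borel"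
    and a_bound: "\<And>j p t. j < J \<Longrightarrow> p \<in> P \<Longrightarrow> \<bar>a j p t\<bar> \<le> A * (1 / (1 + \<bar>t\<bar> ^ m))"
    and H_exp: "\<And>p t r. p \<in> P \<Longrightarrow> 0 < r \<Longrightarrow> r < \<epsilon> \<Longrightarrow>
       \<bar>H p t r - (\<Sum>j<J. a j p t * r ^ j * w j p r)\<bar> \<le> C * r ^ J * (1 / (1 + \<bar>t\<bar> ^ m))"
    and w_eq: "\<And>j p r. p \<in> P \<Longrightarrow> 0 < r \<Longrightarrow> r < \<epsilon> \<Longrightarrow>
       r ^ (n - 1 + j) * w j p r = \<phi> p r powr (real (n + j) / k - 1) * \<phi>' p r / k"
    and H_meas: "\<And>p z. p \<in> P \<Longrightarrow> (\<lambda>r. indicator {0<..<\<epsilon>} r * H p (z * \<phi> p r) r) \<in> borel_measurable borel"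
  shows "\<exists>B. \<forall>p\<in>P. \<forall>z\<ge>1. \<bar>(LINT r|lborel. indicator {0<..<\<epsilon>} r * (r ^ (n - 1) * H p (z * \<phi> p r) r)) -
      (\<Sum>j<J. (1 / k) * (LINT t|lborel. indicator {0<..} t * (t powr (real (n + j) / k - 1) * a j p t)) *
         z powr (- real (n + j) / k))\<bar> \<le> B * z powr (- real (n + J) / k)"
proof -
  \<comment> \<open>Error constants, independent of p: \<open>Q\<close> belongs to the remainder in
    the expansion of H, \<open>T j\<close> to the part of the j-th term lost beyond s = c
    \<epsilon>^k.\<close>
  define Q where "Q = c powr (- (real (n - 1 + J) + 1) / k) *
    (LINT t|lborel. indicator {0<..} t * (t powr real (n - 1 + J) * (1 / (1 + t ^ (k * m)))))"
  define T where "T j = (c * \<epsilon> ^ k) powr (real (n + j) / k - real (n + J) / k) *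
    (LINT t|lborel. indicator {0<..} t * (t powr (real (n + J) / k - 1) * (1 / (1 + t ^ m))))" for j :: nat
  have nJ: "real (n - 1 + J) + 1 = real (n + J)" using n by simp
  have mk: "real (n + J) / k < real m"
    using m k by (simp add: divide_less_eq mult.commute del: of_nat_add flip: of_nat_mult)
  have ce: "0 < c * \<epsilon> ^ k" using c \<epsilon> by simp
  have main: "\<bar>(LINT r|lborel. indicator {0<..<\<epsilon>} r * (r ^ (n - 1) * H p (z * \<phi> p r) r)) -
      (\<Sum>j<J. (1 / k) * (LINT t|lborel. indicator {0<..} t * (t powr (real (n + j) / k - 1) * a j p t)) *
         z powr (- real (n + j) / k))\<bar> \<le> (C * Q + (\<Sum>j<J. (1 / k) * (A * T j))) * z powr (- real (n + J) / k)"
    if p: "p \<in> P" and z: "z \<ge> 1" for p z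
  proof -
    let ?\<alpha> = "\<lambda>j. real (n + j) / k"
    define F where "F j s = s powr (?\<alpha> j - 1) * a j p (z * s)" for j s
    have \<alpha>: "0 < ?\<alpha> j" for j using n k by simp
    have z0: "z > 0" using z by simp
    have phi_ge: "0 \<le> \<phi> p r" if "r \<in> {0..\<epsilon>}" for r
      using lower[OF p that] that c by (smt (verit) atLeastAtMost_iff mult_nonneg_nonneg zero_le_power)
    have [measurable]: "a j p \<in> borel_measurable borel" for j using a_meas[OF p] .
    have A0: "0 \<le> A" if "0 < J" using a_bound[OF that p, of 0] by (smt (verit) mult_neg_pos zero_less_divide_1_iff zero_le_power abs_ge_zero)
    \<comment> \<open>The sign of C is read off from the remainder estimate at t = 0, r =
      \<epsilon>/2, where C times a positive number bounds an absolute value.\<close>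
    have "0 \<le> \<bar>H p 0 (\<epsilon>/2) - (\<Sum>j<J. a j p 0 * (\<epsilon>/2) ^ j * w j p (\<epsilon>/2))\<bar>" by simp
    also have "\<dots> \<le> C * (\<epsilon>/2) ^ J * (1 / (1 + \<bar>0\<bar> ^ m))" using \<epsilon> by (intro H_exp[OF p]) auto
    finally have "0 \<le> C * ((\<epsilon>/2) ^ J * (1 / (1 + \<bar>0\<bar> ^ m)))" by (simp add: mult.assoc)
    moreover have "0 < (\<epsilon>/2) ^ J * (1 / (1 + \<bar>0::real\<bar> ^ m))"
      using \<epsilon> by (intro mult_pos_pos divide_pos_pos add_pos_nonneg) auto
    ultimately have C0: "0 \<le> C" using mult_neg_pos not_le by blast
    have F_int: "integrable lborel (\<lambda>s. indicator {0<..} s * F j s)" if j: "j < J" for j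
    proof -
      have "integrable lborel (\<lambda>t. A * (indicator {0<..} t * (t powr (?\<alpha> j - 1) * (1 / (1 + t ^ m)))))"
      proof (intro integrable_mult_right powr_decay_integrable \<alpha>)
        have "?\<alpha> j \<le> real (n + J) / k" using j k by (intro divide_right_mono) auto
        then show "?\<alpha> j < m" using mk by linarith
      qed
      then have "integrable lborel (\<lambda>t. indicator {0<..} t * (t powr (?\<alpha> j - 1) * a j p t))"
      proof (rule Bochner_Integration.integrable_bound)
        show "AE t in lborel. norm (indicator {0<..} t * (t powr (?\<alpha> j - 1) * a j p t))
            \<le> norm (A * (indicator {0<..} t * (t powr (?\<alpha> j - 1) * (1 / (1 + t ^ m)))))"
        proof (rule AE_I2)
          fix t :: real
          have "\<bar>a j p t\<bar> * t powr (?\<alpha> j - 1) \<le> A * (1 / (1 + t ^ m)) * t powr (?\<alpha> j - 1)" if "t > 0"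
            using a_bound[OF j p, of t] that by (intro mult_right_mono) auto
          then show "norm (indicator {0<..} t * (t powr (?\<alpha> j - 1) * a j p t))
            \<le> norm (A * (indicator {0<..} t * (t powr (?\<alpha> j - 1) * (1 / (1 + t ^ m)))))"
            using A0 j by (auto split: split_indicator simp: abs_mult mult_ac)
        qed
      qed measurable
      from integral_powr_scale(2)[OF z0 this] show ?thesis by (simp add: F_def)
    qed
    have F_int': "set_integrable lborel {\<phi> p 0..\<phi> p \<epsilon>} (F j)" if j: "j < J" for j
    proof -
      have "integrable lborel (\<lambda>s. indicator {..\<phi> p \<epsilon>} s *\<^sub>R (indicator {0<..} s * F j s))"
        by (rule integrable_mult_indicator[OF _ F_int[OF j]]) simp
      moreover have "(\<lambda>s. indicator {..\<phi> p \<epsilon>} s *\<^sub>R (indicator {0<..} s * F j s)) =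
          (\<lambda>s. indicator {\<phi> p 0..\<phi> p \<epsilon>} s *\<^sub>R F j s)"
        by (auto simp: fun_eq_iff \<phi>0[OF p] F_def split: split_indicator)
      ultimately show ?thesis by (simp add: set_integrable_def)
    qed
    \<comment> \<open>For \<alpha> < 1 the function \<open>F j\<close> can be unbounded near 0, so
      the substitution rule is used in its form for integrable functions, which asks for \<phi>'
      \<ge> 0.\<close>
    have sub: "set_integrable lborel {0..\<epsilon>} (\<lambda>r. F j (\<phi> p r) * \<phi>' p r)"
      "(LBINT s. F j s * indicator {\<phi> p 0..\<phi> p \<epsilon>} s) = (LBINT r. F j (\<phi> p r) * \<phi>' p r * indicator {0..\<epsilon>} r)"
      if j: "j < J" for j
      using integral_substitution[OF F_int'[OF j] deriv[OF p] cont[OF p] nonneg[OF p]] \<epsilon> by auto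
    \<comment> \<open>The j-th term in the variable r, on the open interval where
      \<open>w_eq\<close> is available; the endpoints form a null set.\<close>
    define W where "W j r = indicator {0<..<\<epsilon>} r * (F j (\<phi> p r) * \<phi>' p r / k)" for j r
    have ae: "AE r in lborel. W j r = (1 / k) * (F j (\<phi> p r) * \<phi>' p r * indicator {0..\<epsilon>} r)" for j
      using AE_lborel_singleton[of "0::real"] AE_lborel_singleton[of \<epsilon>]
      by eventually_elim (auto simp: W_def split: split_indicator)
    have W_int: "integrable lborel (W j)" if j: "j < J" for j
    proof -
      have "integrable lborel (\<lambda>r. indicator {0<..<\<epsilon>} r *\<^sub>R ((1 / k) * (indicator {0..\<epsilon>} r *\<^sub>R (F j (\<phi> p r) * \<phi>' p r))))"
        by (rule integrable_mult_indicator[OF _ integrable_mult_right[OF sub(1)[OF j, unfolded set_integrable_def]]]) simp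
      moreover have "(\<lambda>r. indicator {0<..<\<epsilon>} r *\<^sub>R ((1 / k) * (indicator {0..\<epsilon>} r *\<^sub>R (F j (\<phi> p r) * \<phi>' p r)))) = W j"
        by (auto simp: W_def fun_eq_iff split: split_indicator)
      ultimately show ?thesis by simp
    qed
    have sub_int: "integrable lborel (\<lambda>r. F j (\<phi> p r) * \<phi>' p r * indicator {0..\<epsilon>} r)" if j: "j < J" for j
      using sub(1)[OF j] by (simp add: set_integrable_def mult.commute)
    have W_val: "(LINT r|lborel. W j r) = (1 / k) * (LBINT s. F j s * indicator {\<phi> p 0..\<phi> p \<epsilon>} s)" if j: "j < J" for j
    proof -
      have "(LINT r|lborel. W j r) = (LINT r|lborel. (1 / k) * (F j (\<phi> p r) * \<phi>' p r * indicator {0..\<epsilon>} r))"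
        using W_int[OF j] sub_int[OF j] by (intro integral_cong_AE ae) auto
      then show ?thesis using sub(2)[OF j] by (simp only: integral_mult_right_zero)
    qed
    define R where "R r = indicator {0<..<\<epsilon>} r * (r ^ (n - 1) * H p (z * \<phi> p r) r) - (\<Sum>j<J. W j r)" for r
    have H_meas': "(\<lambda>r. indicator {0<..<\<epsilon>} r * (r ^ (n - 1) * H p (z * \<phi> p r) r)) \<in> borel_measurable borel"
    proof -
      have "(\<lambda>r. r ^ (n - 1) * (indicator {0<..<\<epsilon>} r * H p (z * \<phi> p r) r)) \<in> borel_measurable borel"
        using H_meas[OF p] by measurable
      then show ?thesis by (simp add: mult_ac)
    qed
    have R_meas: "R \<in> borel_measurable lborel"
      unfolding R_def using H_meas' W_int by (intro borel_measurable_diff borel_measurable_sum) auto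
    have m': "(n - 1 + J) + 1 < k * m" using m n by simp
    note Qb = ray_integral_bound[OF c z0 k m']
    \<comment> \<open>The decay in t is evaluated at t = z \<phi>; the lower bound \<phi> \<ge> c
      r^k replaces it by a majorant common to all p.\<close>
    have R_le: "norm (R r) \<le> norm (C * (indicator {0<..} r * (r ^ (n - 1 + J) * (1 / (1 + (z * (c * r ^ k)) ^ m)))))" for r
    proof (cases "r \<in> {0<..<\<epsilon>}")
      case True
      then have r: "0 < r" "r < \<epsilon>" by auto
      have "r ^ (n - 1) * (a j p (z * \<phi> p r) * r ^ j * w j p r) = W j r" for j
      proof -
        have "r ^ (n - 1) * (a j p (z * \<phi> p r) * r ^ j * w j p r) = a j p (z * \<phi> p r) * (r ^ (n - 1 + j) * w j p r)"
          by (simp add: power_add mult_ac)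
        then show ?thesis unfolding w_eq[OF p r] using True by (simp add: W_def F_def)
      qed
      then have eq: "R r = r ^ (n - 1) * (H p (z * \<phi> p r) r - (\<Sum>j<J. a j p (z * \<phi> p r) * r ^ j * w j p r))"
        using True by (simp add: R_def right_diff_distrib sum_distrib_left)
      have "\<bar>R r\<bar> = r ^ (n - 1) * \<bar>H p (z * \<phi> p r) r - (\<Sum>j<J. a j p (z * \<phi> p r) * r ^ j * w j p r)\<bar>"
        unfolding eq abs_mult using r by simp
      also have "\<dots> \<le> r ^ (n - 1) * (C * r ^ J * (1 / (1 + \<bar>z * \<phi> p r\<bar> ^ m)))"
        using r by (intro mult_left_mono H_exp[OF p r]) auto
      also have "\<dots> \<le> r ^ (n - 1) * (C * r ^ J * (1 / (1 + (z * (c * r ^ k)) ^ m)))"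
      proof (intro mult_left_mono divide_left_mono add_left_mono power_mono)
        have "z * (c * r ^ k) \<le> z * \<phi> p r" using lower[OF p, of r] r z by (intro mult_left_mono) auto
        then show "z * (c * r ^ k) \<le> \<bar>z * \<phi> p r\<bar>" by simp
      qed (use r z c C0 in \<open>auto intro!: mult_pos_pos add_pos_nonneg\<close>)
      also have "\<dots> = C * (indicator {0<..} r * (r ^ (n - 1 + J) * (1 / (1 + (z * (c * r ^ k)) ^ m))))"
        using r by (simp add: power_add)
      finally show ?thesis unfolding real_norm_def using abs_ge_self order_trans by blast
    qed (simp add: R_def W_def)
    have R_int: "integrable lborel R"
      by (rule Bochner_Integration.integrable_bound[OF integrable_mult_right[OF Qb(1)] R_meas AE_I2[OF R_le]])
    have "\<bar>LINT r|lborel. R r\<bar> \<le> (LINT r|lborel. C * (indicator {0<..} r * (r ^ (n - 1 + J) * (1 / (1 + (z * (c * r ^ k)) ^ m)))))"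
    proof -
      have "norm (LINT r|lborel. R r) \<le> (LINT r|lborel. norm (R r))" by (rule integral_norm_bound)
      also have "\<dots> \<le> (LINT r|lborel. C * (indicator {0<..} r * (r ^ (n - 1 + J) * (1 / (1 + (z * (c * r ^ k)) ^ m)))))"
      proof (rule integral_mono[OF integrable_norm[OF R_int] integrable_mult_right[OF Qb(1)]])
        fix r
        have "0 \<le> C * (indicator {0<..} r * (r ^ (n - 1 + J) * (1 / (1 + (z * (c * r ^ k)) ^ m))))"
          using C0 z c by (auto split: split_indicator intro!: mult_nonneg_nonneg add_nonneg_nonneg)
        then show "norm (R r) \<le> C * (indicator {0<..} r * (r ^ (n - 1 + J) * (1 / (1 + (z * (c * r ^ k)) ^ m))))"
          using R_le[of r] by (simp only: real_norm_def abs_of_nonneg)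
      qed
      finally show ?thesis by simp
    qed
    also have "\<dots> = C * Q * z powr (- real (n + J) / k)"
      unfolding integral_mult_right_zero Qb(2) Q_def nJ by simp
    finally have R_bd: "\<bar>LINT r|lborel. R r\<bar> \<le> C * Q * z powr (- real (n + J) / k)" .
    \<comment> \<open>The two integrands differ only for s > \<phi> p \<epsilon>, and \<phi> p
      \<epsilon> \<ge> c \<epsilon>^k places this range inside a tail independent of p.\<close>
    have tail: "\<bar>(LBINT s. F j s * indicator {\<phi> p 0..\<phi> p \<epsilon>} s) - (LBINT s. indicator {0<..} s * F j s)\<bar>
        \<le> A * T j * z powr (- real (n + J) / k)" if j: "j < J" for j
    proof -
      have le: "?\<alpha> j \<le> real (n + J) / k" using j k by (intro divide_right_mono) auto
      note Tb = tail_integral_bound[OF ce z0 \<alpha> le mk]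
      have i1: "integrable lborel (\<lambda>s. F j s * indicator {\<phi> p 0..\<phi> p \<epsilon>} s)"
        using F_int'[OF j] by (simp add: set_integrable_def mult.commute)
      have diff: "(LBINT s. F j s * indicator {\<phi> p 0..\<phi> p \<epsilon>} s) - (LBINT s. indicator {0<..} s * F j s) =
         (LBINT s. F j s * indicator {\<phi> p 0..\<phi> p \<epsilon>} s - indicator {0<..} s * F j s)"
        by (rule Bochner_Integration.integral_diff[OF i1 F_int[OF j], symmetric])
      have "\<bar>LBINT s. F j s * indicator {\<phi> p 0..\<phi> p \<epsilon>} s - indicator {0<..} s * F j s\<bar>
          \<le> (LINT s|lborel. A * (indicator {c * \<epsilon> ^ k<..} s * (s powr (?\<alpha> j - 1) * (1 / (1 + (z * s) ^ m)))))"
      proof (rule order_trans[OF integral_abs_bound])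
        show "(LBINT s. \<bar>F j s * indicator {\<phi> p 0..\<phi> p \<epsilon>} s - indicator {0<..} s * F j s\<bar>) \<le>
          (LINT s|lborel. A * (indicator {c * \<epsilon> ^ k<..} s * (s powr (?\<alpha> j - 1) * (1 / (1 + (z * s) ^ m)))))"
        proof (rule integral_mono)
          show "integrable lborel (\<lambda>s. \<bar>F j s * indicator {\<phi> p 0..\<phi> p \<epsilon>} s - indicator {0<..} s * F j s\<bar>)"
            by (intro integrable_abs Bochner_Integration.integrable_diff i1 F_int[OF j])
          show "integrable lborel (\<lambda>s. A * (indicator {c * \<epsilon> ^ k<..} s * (s powr (?\<alpha> j - 1) * (1 / (1 + (z * s) ^ m)))))"
            by (rule integrable_mult_right[OF Tb(1)])
          fix s :: real
          have low: "c * \<epsilon> ^ k \<le> \<phi> p \<epsilon>" using lower[OF p, of \<epsilon>] \<epsilon> by simp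
          have n1: "0 \<le> A * (indicator {c * \<epsilon> ^ k<..} s * (s powr (?\<alpha> j - 1) * (1 / (1 + (z * s) ^ m))))"
            using A0 j z ce by (auto split: split_indicator intro!: mult_nonneg_nonneg add_nonneg_nonneg)
          show "\<bar>F j s * indicator {\<phi> p 0..\<phi> p \<epsilon>} s - indicator {0<..} s * F j s\<bar> \<le>
            A * (indicator {c * \<epsilon> ^ k<..} s * (s powr (?\<alpha> j - 1) * (1 / (1 + (z * s) ^ m))))"
          proof (cases "\<phi> p \<epsilon> < s")
            case True
            then have s: "s > 0" "s > c * \<epsilon> ^ k" using low ce by auto
            have "\<bar>F j s * indicator {\<phi> p 0..\<phi> p \<epsilon>} s - indicator {0<..} s * F j s\<bar> = s powr (?\<alpha> j - 1) * \<bar>a j p (z * s)\<bar>"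
              using True s by (simp add: F_def abs_mult)
            also have "\<dots> \<le> s powr (?\<alpha> j - 1) * (A * (1 / (1 + \<bar>z * s\<bar> ^ m)))"
              by (intro mult_left_mono a_bound[OF j p]) simp
            finally show ?thesis using s z by (simp add: mult_ac)
          next
            case False
            then have "F j s * indicator {\<phi> p 0..\<phi> p \<epsilon>} s - indicator {0<..} s * F j s = 0"
              by (auto simp: \<phi>0[OF p] F_def split: split_indicator)
            then show ?thesis using n1 by (simp only: abs_zero)
          qed
        qed
      qed
      also have "\<dots> = A * (LINT s|lborel. (indicator {c * \<epsilon> ^ k<..} s * (s powr (?\<alpha> j - 1) * (1 / (1 + (z * s) ^ m)))))"
        by (rule integral_mult_right_zero)
      also have "\<dots> \<le> A * (T j * z powr (- (real (n + J) / k)))"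
      proof (rule mult_left_mono)
        show "0 \<le> A" using A0 j by simp
      qed (unfold T_def, rule Tb(2))
      finally show ?thesis unfolding diff by (simp only: mult.assoc minus_divide_left)
    qed
    have scale: "(LBINT s. indicator {0<..} s * F j s) = 
       (LINT t|lborel. indicator {0<..} t * (t powr (?\<alpha> j - 1) * a j p t)) * z powr (- real (n + j) / k)" for j
      unfolding F_def using integral_powr_scale(1)[OF z0, of "?\<alpha> j" "a j p"]
      by (simp only: mult.commute[of "z powr _"] minus_divide_left)
    have "(LINT r|lborel. indicator {0<..<\<epsilon>} r * (r ^ (n - 1) * H p (z * \<phi> p r) r)) =
        (LINT r|lborel. R r + (\<Sum>j<J. W j r))" by (simp add: R_def)
    also have "\<dots> = (LINT r|lborel. R r) + (\<Sum>j<J. LINT r|lborel. W j r)"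
      using R_int W_int by (subst Bochner_Integration.integral_add) auto
    finally have eq: "(LINT r|lborel. indicator {0<..<\<epsilon>} r * (r ^ (n - 1) * H p (z * \<phi> p r) r)) -
      (\<Sum>j<J. (1 / k) * (LINT t|lborel. indicator {0<..} t * (t powr (?\<alpha> j - 1) * a j p t)) * z powr (- real (n + j) / k))
      = (LINT r|lborel. R r) + (\<Sum>j<J. (1 / k) * ((LBINT s. F j s * indicator {\<phi> p 0..\<phi> p \<epsilon>} s) - (LBINT s. indicator {0<..} s * F j s)))"
      unfolding scale by (simp add: W_val sum_subtractf right_diff_distrib mult.assoc)
    have "\<bar>(LINT r|lborel. R r) + (\<Sum>j<J. (1 / k) * ((LBINT s. F j s * indicator {\<phi> p 0..\<phi> p \<epsilon>} s) - (LBINT s. indicator {0<..} s * F j s)))\<bar>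
       \<le> C * Q * z powr (- real (n + J) / k) + (\<Sum>j<J. (1 / k) * (A * T j * z powr (- real (n + J) / k)))"
    proof (rule order_trans[OF abs_triangle_ineq add_mono[OF R_bd order_trans[OF sum_abs sum_mono]]])
      fix j assume "j \<in> {..<J}"
      then have j: "j < J" by simp
      show "\<bar>(1 / k) * ((LBINT s. F j s * indicator {\<phi> p 0..\<phi> p \<epsilon>} s) - (LBINT s. indicator {0<..} s * F j s))\<bar> \<le>
         (1 / k) * (A * T j * z powr (- real (n + J) / k))"
        unfolding abs_mult using tail[OF j] by (simp add: divide_right_mono)
    qed
    also have "\<dots> = (C * Q + (\<Sum>j<J. (1 / k) * (A * T j))) * z powr (- real (n + J) / k)"
      by (simp only: distrib_right sum_distrib_right mult.assoc)
    finally show ?thesis by (simp only: eq)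
  qed
  then show ?thesis by blast
qed

subsection \<open>Expansions at the extremum\<close>

lemma bigo_power_imp_smallo:
  fixes X :: "'b \<Rightarrow> real"
  assumes X: "(X \<longlongrightarrow> 0) Fl" and pos: "\<forall>\<^sub>F z in Fl. 0 < X z"
    and le: "\<forall>\<^sub>F z in Fl. \<bar>S z\<bar> \<le> C * X z ^ Suc N"
  shows "S \<in> o[Fl](\<lambda>z. X z ^ N)"
proof (rule landau_o.smallI)
  fix c :: real assume c: "c > 0"
  have "((\<lambda>z. C * X z) \<longlongrightarrow> C * 0) Fl" by (intro tendsto_intros X)
  then have "\<forall>\<^sub>F z in Fl. C * X z < c" using c by (auto intro: order_tendstoD)
  with pos le show "\<forall>\<^sub>F z in Fl. norm (S z) \<le> c * norm (X z ^ N)"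
  proof eventually_elim
    case (elim z)
    have "\<bar>S z\<bar> \<le> (C * X z) * X z ^ N" using elim by simp
    also have "\<dots> \<le> c * X z ^ N" using elim by (intro mult_right_mono) auto
    finally show ?case using elim by simp
  qed
qed

text \<open>Once the coefficients below j vanish, division by X^j leaves a sum that tends to d j and
  is also o(X^(N-j)), hence tends to 0. The filter is arbitrary because uniqueness is used both for
  r -> 0 on a ray and for z -> infinity.\<close>

lemma expansion_coeffs_zero:
  fixes X :: "'b \<Rightarrow> real"
  assumes nb: "Fl \<noteq> bot" and X: "(X \<longlongrightarrow> 0) Fl" and pos: "\<forall>\<^sub>F z in Fl. 0 < X z"
    and o: "(\<lambda>z. \<Sum>j\<le>N. d j * X z ^ j) \<in> o[Fl](\<lambda>z. X z ^ N)"
  shows "j \<le> N \<Longrightarrow> d j = 0"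
proof (induction j rule: less_induct)
  case (less j)
  define T where "T z = (\<Sum>i\<le>N - j. d (j + i) * X z ^ i)" for z
  have split: "(\<Sum>i\<le>N. d i * x ^ i) = x ^ j * (\<Sum>i\<le>N - j. d (j + i) * x ^ i)" for x :: real
  proof -
    have "(\<Sum>i\<le>N. d i * x ^ i) = (\<Sum>i\<in>{j..N}. d i * x ^ i)"
      by (rule sum.mono_neutral_right) (use less.IH less.prems in auto)
    also have "\<dots> = (\<Sum>i\<in>{0..N - j}. d (j + i) * x ^ (j + i))"
      using less.prems by (intro sum.reindex_bij_witness[of _ "\<lambda>i. j + i" "\<lambda>i. i - j"]) auto
    finally show ?thesis by (simp add: sum_distrib_left power_add mult_ac atMost_atLeast0)
  qed
  have "(T \<longlongrightarrow> (\<Sum>i\<le>N - j. d (j + i) * 0 ^ i)) Fl"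
    unfolding T_def by (intro tendsto_intros X)
  moreover have "(\<Sum>i\<le>N - j. d (j + i) * 0 ^ i) = d j"
    by (subst sum.atMost_shift) simp
  ultimately have T: "(T \<longlongrightarrow> d j) Fl" by simp
  have "(T \<longlongrightarrow> 0) Fl"
  proof (rule tendstoI)
    fix e :: real assume e: "e > 0"
    have "\<forall>\<^sub>F z in Fl. norm (\<Sum>j\<le>N. d j * X z ^ j) \<le> e / 2 * norm (X z ^ N)"
      using landau_o.smallD[OF o, of "e / 2"] e by simp
    moreover have "\<forall>\<^sub>F z in Fl. X z < 1" using X by (auto intro: order_tendstoD)
    ultimately show "\<forall>\<^sub>F z in Fl. dist (T z) 0 < e"
      using pos
    proof eventually_elim
      case (elim z)
      have "X z ^ j * \<bar>T z\<bar> \<le> e / 2 * X z ^ N"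
        using elim unfolding split T_def by (simp add: abs_mult)
      also have "X z ^ N = X z ^ j * X z ^ (N - j)" using less.prems by (simp flip: power_add)
      finally have "X z ^ j * \<bar>T z\<bar> \<le> X z ^ j * (e / 2 * X z ^ (N - j))" by (simp add: mult_ac)
      then have "\<bar>T z\<bar> \<le> e / 2 * X z ^ (N - j)" using elim by simp
      also have "\<dots> \<le> e / 2 * 1" using elim e by (intro mult_left_mono power_le_one) auto
      finally show ?case using e by simp
    qed
  qed
  then show ?case using tendsto_unique[OF nb T] by simp
qed

section \<open>Taylor data at the extremum, with time and direction as parameters\<close>

lemma homogeneous_poly_scale:
  assumes "homogeneous_poly k p"
  shows "p (r *\<^sub>R v) = r ^ k * p v"
proof -
  obtain a where a: "\<And>v. p v = (\<Sum>\<alpha> | (\<Sum>i\<in>UNIV. \<alpha> i) = k. a \<alpha> * (\<Prod>i\<in>UNIV. (v $ i) ^ \<alpha> i))"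
    using assms by (auto simp: homogeneous_poly_def)
  have "(\<Prod>i\<in>UNIV. ((r *\<^sub>R v) $ i) ^ \<alpha> i) = r ^ (\<Sum>i\<in>UNIV. \<alpha> i) * (\<Prod>i\<in>UNIV. (v $ i) ^ \<alpha> i)" for \<alpha>
    by (simp add: power_mult_distrib prod.distrib power_sum)
  then show ?thesis unfolding a by (auto simp: sum_distrib_left mult_ac intro!: sum.cong)
qed

lemma homogeneous_poly_continuous:
  assumes "homogeneous_poly k p"
  shows "continuous_on S p"
proof -
  obtain a where a: "\<And>v. p v = (\<Sum>\<alpha> | (\<Sum>i\<in>UNIV. \<alpha> i) = k. a \<alpha> * (\<Prod>i\<in>UNIV. (v $ i) ^ \<alpha> i))"
    using assms by (auto simp: homogeneous_poly_def)
  show ?thesis unfolding a[abs_def] by (intro continuous_intros)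
qed

text \<open>The parameter of the expansions is a pair (t, \<theta>): the time t stays a free
  variable, and is set to z \<phi> only inside the integral over the ray.\<close>

abbreviation ray_params :: "(real \<times> (real ^ 'n::finite)) measure" where
  "ray_params \<equiv> borel \<Otimes>\<^sub>M restrict_space borel (sphere 0 1)"

lemma space_ray_params: "p \<in> space ray_params \<longleftrightarrow> norm (snd p) = 1"
  by (cases p) (auto simp: space_pair_measure space_restrict_space)

lemma ray_deriv_measurable_params:
  "(\<lambda>p. ray_deriv j H (snd p) y) \<in> borel_measurable (ray_params :: (real \<times> (real ^ 'n::finite)) measure)"
proof -
  have [measurable]: "(\<lambda>\<theta>. ray_deriv j H \<theta> y) \<in> borel_measurable (restrict_space borel (sphere 0 1))"
    by (rule measurable_restrict_space1) (rule ray_deriv_borel_measurable)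
  show ?thesis by measurable
qed

lemma ray_deriv_bounded_cball:
  fixes H :: "real ^ 'n::finite \<Rightarrow> real"
  assumes H: "smooth_on W H" and W: "cball y0 d \<subseteq> W"
  obtains B where "\<And>\<theta> y. norm \<theta> = 1 \<Longrightarrow> y \<in> cball y0 d \<Longrightarrow> \<bar>ray_deriv j H \<theta> y\<bar> \<le> B"
proof -
  have "\<exists>B. \<forall>y\<in>cball y0 d. \<bar>iter_deriv vs H y\<bar> \<le> B" for vs
  proof -
    have "compact (iter_deriv vs H ` cball y0 d)"
      by (intro compact_continuous_image continuous_on_subset[OF smooth_on_continuous_iter[OF H] W]) auto
    then show ?thesis using compact_imp_bounded bounded_iff by (metis image_eqI real_norm_def)
  qed
  then obtain B where B: "\<And>vs y. y \<in> cball y0 d \<Longrightarrow> \<bar>iter_deriv vs H y\<bar> \<le> B vs" by metis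
  show ?thesis
  proof
    fix \<theta> y :: "real ^ 'n" assume "norm \<theta> = 1" "y \<in> cball y0 d"
    then show "\<bar>ray_deriv j H \<theta> y\<bar> \<le> (\<Sum>vs | set vs \<subseteq> Basis \<and> length vs = j. B vs)"
      by (intro order_trans[OF ray_deriv_bound sum_mono] B)
  qed
qed

text \<open>The ray derivatives of order below k vanish at y0, so the Taylor sum of the i-th one
  starts with r^(k-i) and may be divided by that power. The cases i = 0 and i = 1 serve \<phi> / r^k
  and \<partial>_r \<phi> / r^(k-1).\<close>

lemma ray_quotient_expansion:
  fixes F :: "real ^ 'n::finite \<Rightarrow> real"
  assumes F: "smooth_on W F" and W: "cball y0 d \<subseteq> W" and d: "0 < d" and i: "i \<le> k"
    and zero: "\<And>\<theta> j. norm \<theta> = 1 \<Longrightarrow> j < k \<Longrightarrow> ray_deriv j F \<theta> y0 = 0"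
  shows "expansion_with J ray_params (\<lambda>r p. ray_deriv i F (snd p) (y0 + r *\<^sub>R snd p) / r ^ (k - i))
           (\<lambda>p. ray_deriv k F (snd p) y0 / fact (k - i))"
proof -
  let ?a = "\<lambda>j p. ray_deriv (k + j) F (snd p) y0 / fact (k - i + j) :: real"
  obtain B where B: "\<And>\<theta> y. norm \<theta> = 1 \<Longrightarrow> y \<in> cball y0 d \<Longrightarrow> \<bar>ray_deriv (i + (k - i + Suc J)) F \<theta> y\<bar> \<le> B"
    using ray_deriv_bounded_cball[OF F W] by metis
  have "expansion_with J ray_params (\<lambda>r p. ray_deriv i F (snd p) (y0 + r *\<^sub>R snd p) / r ^ (k - i)) (?a 0)"
  proof (rule expansion_with_taylor[OF d])
    fix j
    obtain B' where B': "\<And>\<theta> y. norm \<theta> = 1 \<Longrightarrow> y \<in> cball y0 d \<Longrightarrow> \<bar>ray_deriv (k + j) F \<theta> y\<bar> \<le> B'"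
      using ray_deriv_bounded_cball[OF F W] by metis
    have "\<bar>ray_deriv (k + j) F (snd p) y0 / fact (k - i + j)\<bar> \<le> B' / fact (k - i + j)"
      if "p \<in> space ray_params" for p :: "real \<times> (real ^ 'n)"
      using B'[of "snd p" y0] that d by (simp add: space_ray_params abs_divide divide_right_mono)
    then show "bdd_meas ray_params (?a j)"
      using ray_deriv_measurable_params[of "k + j" F y0] by (intro bdd_measI) auto
  next
    fix r and p :: "real \<times> (real ^ 'n)"
    assume "p \<in> space ray_params" and r: "0 < r" "r < d"
    then have p: "norm (snd p) = 1" by (simp add: space_ray_params)
    let ?x = "ray_deriv i F (snd p) (y0 + r *\<^sub>R snd p)"
    have T: "\<bar>?x - (\<Sum>j<k - i + Suc J. ray_deriv (i + j) F (snd p) y0 / fact j * r ^ j)\<bar> \<le> B * r ^ (k - i + Suc J)"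
      by (rule ray_taylor[OF F W p]) (use r B p in auto)
    \<comment> \<open>For j < k - i the order i + j is below k, so these terms drop out.\<close>
    have "(\<Sum>j<k - i + Suc J. ray_deriv (i + j) F (snd p) y0 / fact j * r ^ j) =
        (\<Sum>j\<in>{k - i..<k - i + Suc J}. ray_deriv (i + j) F (snd p) y0 / fact j * r ^ j)"
      by (rule sum.mono_neutral_right) (use zero[OF p] in auto)
    also have "\<dots> = (\<Sum>j<Suc J. ray_deriv (i + (k - i + j)) F (snd p) y0 / fact (k - i + j) * r ^ (k - i + j))"
      by (rule sum.reindex_bij_witness[of _ "\<lambda>j. k - i + j" "\<lambda>j. j - (k - i)"]) auto
    also have "\<dots> = r ^ (k - i) * (\<Sum>j<Suc J. ?a j p * r ^ j)"
    proof -
      have "i + (k - i + j) = k + j" for j using i by simp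
      then show ?thesis by (simp only: sum_distrib_left power_add mult_ac)
    qed
    finally have "?x / r ^ (k - i) - (\<Sum>j<Suc J. ?a j p * r ^ j) =
       (?x - (\<Sum>j<k - i + Suc J. ray_deriv (i + j) F (snd p) y0 / fact j * r ^ j)) / r ^ (k - i)"
      using r by (simp add: field_simps del: sum.lessThan_Suc)
    also have "\<bar>\<dots>\<bar> \<le> B * r ^ Suc J"
      using T r unfolding abs_divide by (simp add: divide_le_eq power_add mult_ac del: sum.lessThan_Suc)
    finally show "\<bar>?x / r ^ (k - i) - (\<Sum>j<Suc J. ?a j p * r ^ j)\<bar> \<le> B * r ^ Suc J" .
  qed
  then show ?thesis by simp
qed

text \<open>Rapid decrease absorbs the weight 1 + |t|^m in every coordinate derivative, so the
  Taylor expansion at fixed t is uniform over the whole line. The factor s allows the time variable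
  to be z \<phi> \<ge> 0 at a maximum as well.\<close>

lemma weighted_ray_expansion:
  fixes G :: "real \<Rightarrow> real ^ 'n::finite \<Rightarrow> real"
  assumes G: "smooth_on (UNIV \<times> W) (\<lambda>(t, y). G t y)" and W: "open W" "cball y0 d \<subseteq> W" and d: "0 < d"
    and decay: "\<And>m vs. set vs \<subseteq> Basis \<Longrightarrow> \<exists>C. \<forall>t. \<forall>y\<in>cball y0 d. \<bar>t\<bar> ^ m * \<bar>iter_deriv vs (G t) y\<bar> \<le> C"
    and s: "\<bar>s\<bar> = 1"
  shows "expansion_with J ray_params (\<lambda>r p. (1 + \<bar>fst p\<bar> ^ m) * G (s * fst p) (y0 + r *\<^sub>R snd p))
           (\<lambda>p. (1 + \<bar>fst p\<bar> ^ m) * G (s * fst p) y0)"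
proof -
  let ?W = "\<lambda>t::real. 1 + \<bar>t\<bar> ^ m"
  have "\<exists>C. \<forall>t. \<forall>y\<in>cball y0 d. ?W t * \<bar>iter_deriv vs (G (s * t)) y\<bar> \<le> C" if vs: "set vs \<subseteq> Basis" for vs
  proof -
    \<comment> \<open>The decay bounds for the powers 0 and m add up to one for the weight.\<close>
    obtain C0 Cm where C: "\<And>t y. y \<in> cball y0 d \<Longrightarrow> \<bar>t\<bar> ^ 0 * \<bar>iter_deriv vs (G t) y\<bar> \<le> C0"
      "\<And>t y. y \<in> cball y0 d \<Longrightarrow> \<bar>t\<bar> ^ m * \<bar>iter_deriv vs (G t) y\<bar> \<le> Cm"
      using decay[OF vs] by meson
    have "?W t * \<bar>iter_deriv vs (G (s * t)) y\<bar> \<le> C0 + Cm" if "y \<in> cball y0 d" for t y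
      using C(1)[OF that, of "s * t"] C(2)[OF that, of "s * t"] s by (simp add: abs_mult distrib_right)
    then show ?thesis by blast
  qed
  then obtain C where C: "\<And>vs t y. set vs \<subseteq> Basis \<Longrightarrow> y \<in> cball y0 d \<Longrightarrow> ?W t * \<bar>iter_deriv vs (G (s * t)) y\<bar> \<le> C vs"
    by metis
  define D where "D j = (\<Sum>vs | set vs \<subseteq> Basis \<and> length vs = j. C vs)" for j
  have D: "?W t * \<bar>ray_deriv j (G (s * t)) \<theta> y\<bar> \<le> D j" if "norm \<theta> = 1" "y \<in> cball y0 d" for j t \<theta> y
  proof -
    have "?W t * \<bar>ray_deriv j (G (s * t)) \<theta> y\<bar> \<le> ?W t * (\<Sum>vs | set vs \<subseteq> Basis \<and> length vs = j. \<bar>iter_deriv vs (G (s * t)) y\<bar>)"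
      by (intro mult_left_mono ray_deriv_bound that) auto
    also have "\<dots> \<le> D j" unfolding D_def sum_distrib_left by (intro sum_mono C that) auto
    finally show ?thesis .
  qed
  have y0: "y0 \<in> cball y0 d" "y0 \<in> W" using d W by auto
  have sm: "smooth_on W (G t)" for t
    unfolding smooth_on_def using iter_deriv_slice(2)[OF G W(1)] by blast
  let ?a = "\<lambda>j p. ?W (fst p) * ray_deriv j (G (s * fst p)) (snd p) y0 / fact j"
  have meas: "?a j \<in> borel_measurable ray_params" for j
  proof -
    have "continuous_on UNIV (\<lambda>t. iter_deriv vs (G (s * t)) y0)" for vs
    proof -
      have "continuous_on UNIV (\<lambda>t. iter_deriv (map (Pair 0) vs) (\<lambda>(t, y). G t y) (s * t, y0))"
        by (rule continuous_on_compose2[OF smooth_on_continuous_iter[OF G]])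
           (use y0 in \<open>auto intro!: continuous_intros\<close>)
      then show ?thesis by (simp add: iter_deriv_slice(1)[OF G W(1) y0(2)])
    qed
    then have [measurable]: "(\<lambda>t. iter_deriv vs (G (s * t)) y0) \<in> borel_measurable borel" for vs
      by (rule borel_measurable_continuous_onI)
    have "(\<lambda>\<theta> :: real ^ 'n. \<Prod>v\<leftarrow>vs. \<theta> \<bullet> v) \<in> borel_measurable borel" for vs
      by (induction vs) simp_all
    then have [measurable]: "(\<lambda>\<theta> :: real ^ 'n. \<Prod>v\<leftarrow>vs. \<theta> \<bullet> v) \<in> borel_measurable (restrict_space borel (sphere 0 1))" for vs
      by (rule measurable_restrict_space1)
    show ?thesis unfolding ray_deriv_def by measurable
  qed
  have "expansion_with J ray_params (\<lambda>r p. ?W (fst p) * G (s * fst p) (y0 + r *\<^sub>R snd p)) (?a 0)"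
  proof (rule expansion_with_taylor[OF d])
    fix j
    have "\<bar>?a j p\<bar> \<le> D j / fact j" if "p \<in> space ray_params" for p :: "real \<times> (real ^ 'n)"
      using D[where \<theta> = "snd p" and y = y0 and t = "fst p" and j = j] y0(1) that
      by (simp add: space_ray_params abs_mult abs_divide divide_right_mono)
    then show "bdd_meas ray_params (?a j)" by (rule bdd_measI[OF meas])
  next
    fix r and p :: "real \<times> (real ^ 'n)"
    assume "p \<in> space ray_params" and r: "0 < r" "r < d"
    then have p: "norm (snd p) = 1" by (simp add: space_ray_params)
    let ?t = "fst p"
    have W0: "0 < ?W ?t" by (simp add: add_pos_nonneg)
    have "\<bar>ray_deriv 0 (G (s * ?t)) (snd p) (y0 + r *\<^sub>R snd p) -
        (\<Sum>j<Suc J. ray_deriv (0 + j) (G (s * ?t)) (snd p) y0 / fact j * r ^ j)\<bar> \<le> D (Suc J) / ?W ?t * r ^ Suc J"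
    proof (rule ray_taylor[OF sm W(2) p])
      fix y assume "y \<in> cball y0 d"
      then show "\<bar>ray_deriv (0 + Suc J) (G (s * ?t)) (snd p) y\<bar> \<le> D (Suc J) / ?W ?t"
        using D[OF p, where y = y and t = ?t and j = "Suc J"] W0 by (simp add: le_divide_eq mult.commute)
    qed (use r in auto)
    then have "?W ?t * \<bar>G (s * ?t) (y0 + r *\<^sub>R snd p) -
        (\<Sum>j<Suc J. ray_deriv j (G (s * ?t)) (snd p) y0 / fact j * r ^ j)\<bar> \<le> ?W ?t * (D (Suc J) / ?W ?t * r ^ Suc J)"
      using W0 by (intro mult_left_mono) (auto simp del: sum.lessThan_Suc)
    also have "\<dots> = D (Suc J) * r ^ Suc J" using W0 by simp
    also have "?W ?t * \<bar>G (s * ?t) (y0 + r *\<^sub>R snd p) -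
        (\<Sum>j<Suc J. ray_deriv j (G (s * ?t)) (snd p) y0 / fact j * r ^ j)\<bar>
      = \<bar>?W ?t * G (s * ?t) (y0 + r *\<^sub>R snd p) - (\<Sum>j<Suc J. ?a j p * r ^ j)\<bar>"
    proof -
      have "?W ?t * G (s * ?t) (y0 + r *\<^sub>R snd p) - (\<Sum>j<Suc J. ?a j p * r ^ j) = ?W ?t * (G (s * ?t) (y0 + r *\<^sub>R snd p) -
        (\<Sum>j<Suc J. ray_deriv j (G (s * ?t)) (snd p) y0 / fact j * r ^ j))"
        by (simp add: right_diff_distrib sum_distrib_left mult_ac del: sum.lessThan_Suc)
      then show ?thesis using W0 by (simp add: abs_mult del: sum.lessThan_Suc)
    qed
    finally show "\<bar>?W ?t * G (s * ?t) (y0 + r *\<^sub>R snd p) - (\<Sum>j<Suc J. ?a j p * r ^ j)\<bar> \<le> D (Suc J) * r ^ Suc J" .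
  qed
  then show ?thesis by simp
qed

text \<open>On a ray the Taylor polynomial of degree k minus r^k f_k(\<theta>) is O(r^(k+1)), hence
  zero coefficient by coefficient. This turns the O-condition on the jet into exact values of
  derivatives.\<close>

lemma ray_deriv_at_extremum:
  fixes F :: "real ^ 'n::finite \<Rightarrow> real"
  assumes F: "smooth_on W F" and W: "cball y0 d \<subseteq> W" and d: "0 < d"
    and fk: "homogeneous_poly k fk"
    and jet: "\<And>w. 0 < norm w \<Longrightarrow> norm w < d \<Longrightarrow> \<bar>F (y0 + w) - fk w\<bar> \<le> C * norm w ^ (k + 1)"
    and \<theta>: "norm \<theta> = 1"
  shows "j < k \<Longrightarrow> ray_deriv j F \<theta> y0 = 0" and "ray_deriv k F \<theta> y0 / fact k = fk \<theta>"
proof -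
  obtain B where B: "\<And>\<theta> y. norm \<theta> = 1 \<Longrightarrow> y \<in> cball y0 d \<Longrightarrow> \<bar>ray_deriv (0 + Suc k) F \<theta> y\<bar> \<le> B"
    using ray_deriv_bounded_cball[OF F W] by metis
  let ?d = "\<lambda>j. ray_deriv j F \<theta> y0 / fact j - (if j = k then fk \<theta> else 0)"
  have "(\<lambda>r. \<Sum>j\<le>k. ?d j * r ^ j) \<in> o[at_right 0](\<lambda>r. r ^ k)"
  proof (rule bigo_power_imp_smallo)
    have "\<bar>\<Sum>j\<le>k. ?d j * r ^ j\<bar> \<le> (B + C) * r ^ Suc k" if r: "0 < r" "r < d" for r
    proof -
      have 1: "\<bar>ray_deriv 0 F \<theta> (y0 + r *\<^sub>R \<theta>) - (\<Sum>j<Suc k. ray_deriv (0 + j) F \<theta> y0 / fact j * r ^ j)\<bar> \<le> B * r ^ Suc k"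
        by (rule ray_taylor[OF F W \<theta>]) (use r B \<theta> in auto)
      have 2: "\<bar>F (y0 + r *\<^sub>R \<theta>) - r ^ k * fk \<theta>\<bar> \<le> C * r ^ Suc k"
        using jet[of "r *\<^sub>R \<theta>"] r \<theta> by (simp add: homogeneous_poly_scale[OF fk])
      have "(\<Sum>j\<le>k. ?d j * r ^ j) = (\<Sum>j<Suc k. ray_deriv j F \<theta> y0 / fact j * r ^ j) - (\<Sum>j\<le>k. (if j = k then fk \<theta> else 0) * r ^ j)"
        by (simp add: left_diff_distrib sum_subtractf lessThan_Suc_atMost)
      also have "(\<Sum>j\<le>k. (if j = k then fk \<theta> else 0) * r ^ j) = (\<Sum>j\<le>k. (if j = k then fk \<theta> * r ^ k else 0))"
        by (rule sum.cong) auto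
      also have "\<dots> = r ^ k * fk \<theta>" by simp
      finally show ?thesis using 1 2 by (simp add: distrib_right del: sum.lessThan_Suc)
    qed
    then show "\<forall>\<^sub>F r in at_right 0. \<bar>\<Sum>j\<le>k. ?d j * r ^ j\<bar> \<le> (B + C) * r ^ Suc k"
      using d by (auto simp: eventually_at_right_field intro!: exI[of _ d])
    show "\<forall>\<^sub>F r in at_right 0. 0 < (r::real)" by (rule eventually_at_right_less)
  qed (rule tendsto_ident_at)
  then have z: "?d j = 0" if "j \<le> k" for j
    using expansion_coeffs_zero[where Fl = "at_right 0" and X = "\<lambda>r. r" and N = k and d = ?d and j = j] that
    by (auto simp: eventually_at_right_less tendsto_ident_at)
  show "j < k \<Longrightarrow> ray_deriv j F \<theta> y0 = 0" using z[of j] by simp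
  show "ray_deriv k F \<theta> y0 / fact k = fk \<theta>" using z[of k] by simp
qed

text \<open>The situation in one chart, for both signs at once. A single constant c bounds s * f_k
  on the sphere and s * F against |w|^k on a ball: the first makes division by leading coefficients
  harmless, the second converts decay in t into decay in z.\<close>

locale chart_extremum =
  fixes W :: "(real ^ 'n::finite) set" and F :: "real ^ 'n \<Rightarrow> real" and G :: "real \<Rightarrow> real ^ 'n \<Rightarrow> real"
    and y0 :: "real ^ 'n" and d :: real and k :: nat and fk :: "real ^ 'n \<Rightarrow> real" and s c :: real
  assumes W: "open W" "cball y0 d \<subseteq> W" and d: "0 < d"
    and F: "smooth_on W F" and G: "smooth_on (UNIV \<times> W) (\<lambda>(t, y). G t y)"
    and decay: "\<And>m vs. set vs \<subseteq> Basis \<Longrightarrow>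
      \<exists>C. \<forall>t. \<forall>y\<in>cball y0 d. \<bar>t\<bar> ^ m * \<bar>iter_deriv vs (G t) y\<bar> \<le> C"
    and fk: "homogeneous_poly k fk" and k: "2 \<le> k" and s: "s = 1 \<or> s = - 1"
    and c: "0 < c" and fk_lower: "\<And>\<theta>. norm \<theta> = 1 \<Longrightarrow> c \<le> s * fk \<theta>"
    and F_lower: "\<And>w. norm w \<le> d \<Longrightarrow> c * norm w ^ k \<le> s * F (y0 + w)"
    and jet: "\<exists>C. \<forall>w. 0 < norm w \<longrightarrow> norm w < d \<longrightarrow> \<bar>F (y0 + w) - fk w\<bar> \<le> C * norm w ^ (k + 1)"
begin

lemma ray_deriv_F:
  assumes "norm \<theta> = 1"
  shows "j < k \<Longrightarrow> ray_deriv j F \<theta> y0 = 0" and "ray_deriv k F \<theta> y0 / fact k = fk \<theta>"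
    and "ray_deriv k F \<theta> y0 / fact (k - 1) = k * fk \<theta>"
proof -
  obtain C where C: "\<And>w. 0 < norm w \<Longrightarrow> norm w < d \<Longrightarrow> \<bar>F (y0 + w) - fk w\<bar> \<le> C * norm w ^ (k + 1)"
    using jet by blast
  note * = ray_deriv_at_extremum[OF F W(2) d fk C assms]
  show "j < k \<Longrightarrow> ray_deriv j F \<theta> y0 = 0" and 2: "ray_deriv k F \<theta> y0 / fact k = fk \<theta>"
    using * by auto
  have "fact k = real k * fact (k - 1)" using k by (simp add: fact_reduce)
  then show "ray_deriv k F \<theta> y0 / fact (k - 1) = k * fk \<theta>"
    using 2 k by (simp add: field_simps)
qed

definition q :: "real \<Rightarrow> real ^ 'n \<Rightarrow> real" where "q r \<theta> = s * F (y0 + r *\<^sub>R \<theta>) / r ^ k"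

text \<open>Not the derivative of \<open>q\<close>, but the radial derivative of \<phi> divided by
  r^(k-1). It stays bounded, and by Euler's relation its limit at r = 0 is k * s *
  f_k(\<theta>).\<close>

definition q' :: "real \<Rightarrow> real ^ 'n \<Rightarrow> real" where
  "q' r \<theta> = s * ray_deriv 1 F \<theta> (y0 + r *\<^sub>R \<theta>) / r ^ (k - 1)"

lemma q_expansion:
  "expansion_with J ray_params (\<lambda>r p. q r (snd p)) (\<lambda>p. s * (ray_deriv k F (snd p) y0 / fact k))"
proof -
  have "expansion_with J ray_params (\<lambda>r p. ray_deriv 0 F (snd p) (y0 + r *\<^sub>R snd p) / r ^ (k - 0))
           (\<lambda>p. ray_deriv k F (snd p) y0 / fact (k - 0))"
    by (rule ray_quotient_expansion[OF F W(2) d]) (auto simp: ray_deriv_F)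
  from expansion_with_mult[OF expansion_with_const[OF bdd_meas_const[of _ s]] this]
  show ?thesis by (simp add: q_def)
qed

lemma q'_expansion:
  "expansion_with J ray_params (\<lambda>r p. q' r (snd p)) (\<lambda>p. s * (ray_deriv k F (snd p) y0 / fact (k - 1)))"
proof -
  have "expansion_with J ray_params (\<lambda>r p. ray_deriv 1 F (snd p) (y0 + r *\<^sub>R snd p) / r ^ (k - 1))
           (\<lambda>p. ray_deriv k F (snd p) y0 / fact (k - 1))"
    by (rule ray_quotient_expansion[OF F W(2) d]) (use k in \<open>auto simp: ray_deriv_F\<close>)
  from expansion_with_mult[OF expansion_with_const[OF bdd_meas_const[of _ s]] this]
  show ?thesis by (simp add: q'_def)
qed

text \<open>This makes \<phi> nondecreasing along all rays up to a common radius, as the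
  substitution requires. The limit k * s * f_k(\<theta>) is at least c, and r < c / (|C| + 1) keeps
  the deviation C * r below c.\<close>

lemma q'_nonneg: "\<exists>\<epsilon>>0. \<forall>r \<theta>. 0 < r \<longrightarrow> r < \<epsilon> \<longrightarrow> norm \<theta> = 1 \<longrightarrow> 0 \<le> q' r \<theta>"
proof -
  have "unif_expansion 0 ray_params (\<lambda>r p. (q' r (snd p) - s * (ray_deriv k F (snd p) y0 / fact (k - 1))) / r)"
    using q'_expansion[of 0] unfolding expansion_with_def by blast
  then obtain e C where e: "e > 0" and C: "\<And>p r. p \<in> space ray_params \<Longrightarrow> r \<in> {0<..<e} \<Longrightarrow>
      \<bar>(q' r (snd p) - s * (ray_deriv k F (snd p) y0 / fact (k - 1))) / r\<bar> \<le> C"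
    unfolding unif_expansion.simps by blast
  show ?thesis
  proof (intro exI[of _ "min e (c / (\<bar>C\<bar> + 1))"] conjI allI impI)
    fix r and \<theta> :: "real ^ 'n"
    assume r: "0 < r" "r < min e (c / (\<bar>C\<bar> + 1))" and \<theta>: "norm \<theta> = 1"
    have L: "s * (ray_deriv k F \<theta> y0 / fact (k - 1)) = k * (s * fk \<theta>)"
      by (simp only: ray_deriv_F(3)[OF \<theta>] mult_ac)
    have "\<bar>(q' r \<theta> - k * (s * fk \<theta>)) / r\<bar> \<le> C"
      using C[of "(0, \<theta>)" r] r \<theta> unfolding snd_conv L by (simp add: space_ray_params)
    then have "\<bar>q' r \<theta> - k * (s * fk \<theta>)\<bar> \<le> C * r" using r by (simp add: abs_divide divide_le_eq)
    moreover have "C * r \<le> (\<bar>C\<bar> + 1) * r" using r by (intro mult_right_mono) auto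
    moreover have "(\<bar>C\<bar> + 1) * r < c" using r by (simp add: less_divide_eq mult.commute)
    moreover have "1 * c \<le> k * (s * fk \<theta>)" using k c fk_lower[OF \<theta>] by (intro mult_mono) auto
    ultimately show "0 \<le> q' r \<theta>" by linarith
  qed (use e c in auto)
qed

text \<open>The coefficients A are independent of \<epsilon>, while B may vary with it: the radius
  can later be shrunk to the region where the cut-off is 1 without changing the expansion.\<close>

lemma ray_expansion:
  fixes J :: nat
  defines "n \<equiv> CARD('n)"
  shows "\<exists>A \<epsilon>0. (\<forall>j<Suc J. bdd_meas sphere_measure (A j)) \<and>
    (\<forall>\<theta>. norm \<theta> = 1 \<longrightarrow> A 0 \<theta> = (1 / k) *
       (LINT t|lborel. indicator {0<..} t * (t powr (real n / k - 1) * G (s * t) y0)) * (s * fk \<theta>) powr (- real n / k)) \<and>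
    0 < \<epsilon>0 \<and> (\<forall>\<epsilon>. 0 < \<epsilon> \<longrightarrow> \<epsilon> \<le> \<epsilon>0 \<longrightarrow> (\<exists>B. \<forall>\<theta>\<in>sphere 0 1. \<forall>z\<ge>1.
      \<bar>(LINT r|lborel. indicator {0<..<\<epsilon>} r * (r ^ (n - 1) * G (z * F (y0 + r *\<^sub>R \<theta>)) (y0 + r *\<^sub>R \<theta>))) -
       (\<Sum>j<Suc J. A j \<theta> * z powr (- real (n + j) / k))\<bar> \<le> B * z powr (- real (n + Suc J) / k)))"
proof -
  have n: "0 < n" by (simp add: n_def)
  \<comment> \<open>What matters is n + Suc J < k * m, the condition for convergence of the
    remainder integrals.\<close>
  define m where "m = n + J + 2"
  have m: "n + Suc J < k * m"
  proof -
    have "n + Suc J < 1 * m" by (simp add: m_def)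
    also have "\<dots> \<le> k * m" using k by (intro mult_right_mono) auto
    finally show ?thesis .
  qed
  let ?\<alpha> = "\<lambda>j. real (n + j) / k"
  let ?L = "\<lambda>p. s * (ray_deriv k F (snd p) y0 / fact k) :: real"
  let ?L' = "\<lambda>p. s * (ray_deriv k F (snd p) y0 / fact (k - 1)) :: real"
  \<comment> \<open>Chosen so that r^(n-1+j) times it equals \<phi> powr (\<alpha> - 1) * \<phi>' /
    k with \<alpha> = (n + j) / k. The factor 1/k normalizes the leading coefficient to (s *
    f_k(\<theta>)) powr \<alpha>.\<close>
  define w where "w j \<theta> r = q r \<theta> powr (?\<alpha> j - 1) * (q' r \<theta> * (1 / k))" for j \<theta> r
  define w0 where "w0 j p = ?L p powr (?\<alpha> j - 1) * (?L' p * (1 / k))" for j and p :: "real \<times> (real ^ 'n)"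
  have L: "?L p = s * fk (snd p)" "?L' p = k * (s * fk (snd p))" if "p \<in> space ray_params" for p
    using that ray_deriv_F(2,3)[of "snd p"] by (auto simp: space_ray_params)
  have L_ge: "c \<le> ?L p" if "p \<in> space ray_params" for p
    using fk_lower[of "snd p"] that L(1)[OF that] by (simp add: space_ray_params)
  have w0: "w0 j p = (s * fk (snd p)) powr ?\<alpha> j" if p: "p \<in> space ray_params" for j p
  proof -
    have pos: "0 < s * fk (snd p)" using L_ge[OF p] L(1)[OF p] c by simp
    have "w0 j p = (s * fk (snd p)) powr (?\<alpha> j - 1) * (s * fk (snd p))"
      unfolding w0_def L[OF p] using k by simp
    also have "\<dots> = (s * fk (snd p)) powr ?\<alpha> j"
      using powr_mult_base[of "s * fk (snd p)" "?\<alpha> j - 1"] pos by (simp add: mult.commute)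
    finally show ?thesis .
  qed
  have w_exp: "expansion_with J ray_params (\<lambda>r p. w j (snd p) r) (w0 j)" for j
    unfolding w_def w0_def
    by (intro expansion_with_mult expansion_with_powr[OF q_expansion c L_ge] q'_expansion
        expansion_with_const bdd_meas_const)
  have w0_ge: "c powr ?\<alpha> j \<le> w0 j p" if p: "p \<in> space ray_params" for j p
    unfolding w0[OF p] using c L_ge[OF p] L(1)[OF p] by (intro powr_mono2) auto
  have cpos: "0 < c powr ?\<alpha> j" for j using c by simp
  have "\<bar>s\<bar> = 1" using s by auto
  then have u_exp: "expansion_with J ray_params (\<lambda>r p. (1 + \<bar>fst p\<bar> ^ m) * G (s * fst p) (y0 + r *\<^sub>R snd p))
      (\<lambda>p. (1 + \<bar>fst p\<bar> ^ m) * G (s * fst p) y0)"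
    using weighted_ray_expansion[OF G W d decay] by blast
  obtain b e1 C1 where b: "\<And>j. bdd_meas ray_params (b j)"
    and b0: "\<And>p. b 0 p = (1 + \<bar>fst p\<bar> ^ m) * G (s * fst p) y0 / w0 0 p"
    and e1: "e1 > 0" and C1: "\<And>p r. p \<in> space ray_params \<Longrightarrow> r \<in> {0<..<e1} \<Longrightarrow>
      \<bar>(1 + \<bar>fst p\<bar> ^ m) * G (s * fst p) (y0 + r *\<^sub>R snd p) - (\<Sum>j<Suc J. b j p * r ^ j * w j (snd p) r)\<bar> \<le> C1 * r ^ Suc J"
    using expansion_triangular[where w = "\<lambda>j r p. w j (snd p) r" and ?w0.0 = w0 and c = "\<lambda>j. c powr ?\<alpha> j",
        OF u_exp w_exp _ cpos] w0_ge by blast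
  obtain e2 where e2: "e2 > 0" and q'pos: "\<And>r \<theta>. 0 < r \<Longrightarrow> r < e2 \<Longrightarrow> norm \<theta> = 1 \<Longrightarrow> 0 \<le> q' r \<theta>"
    using q'_nonneg by blast
  \<comment> \<open>Dividing the weight out again turns the bounded coefficients \<open>b j\<close>
    into functions of t with decay of order m.\<close>
  define a where "a j \<theta> t = b j (t, \<theta>) * (1 / (1 + \<bar>t\<bar> ^ m))" for j \<theta> t
  have Wpos: "0 < 1 + \<bar>t\<bar> ^ m" for t :: real by (simp add: add_pos_nonneg)
  obtain Bb where Bb: "\<And>j p. p \<in> space ray_params \<Longrightarrow> \<bar>b j p\<bar> \<le> Bb j"
    using b unfolding bdd_meas_def by metis
  define AA where "AA = (\<Sum>j<Suc J. \<bar>Bb j\<bar>)"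
  have a_bound: "\<bar>a j \<theta> t\<bar> \<le> AA * (1 / (1 + \<bar>t\<bar> ^ m))" if "j < Suc J" "\<theta> \<in> sphere 0 1" for j \<theta> t
  proof -
    have "\<bar>b j (t, \<theta>)\<bar> \<le> \<bar>Bb j\<bar>" using Bb[of "(t, \<theta>)" j] that by (simp add: space_ray_params)
    also have "\<dots> \<le> AA" unfolding AA_def using that by (intro member_le_sum) auto
    finally show ?thesis unfolding a_def abs_mult using Wpos[of t] by (intro mult_mono) auto
  qed
  have b_meas [measurable]: "b j \<in> borel_measurable ray_params" for j using b by (simp add: bdd_meas_def)
  have a_meas: "a j \<theta> \<in> borel_measurable borel" if "\<theta> \<in> sphere 0 1" for j \<theta>
  proof -
    have [measurable]: "(\<lambda>t. \<theta>) \<in> measurable borel (restrict_space borel (sphere 0 1))"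
      using that by (intro measurable_const) (auto simp: space_restrict_space)
    show ?thesis unfolding a_def by measurable
  qed
  define A where "A j \<theta> = (1 / k) * (LINT t|lborel. indicator {0<..} t * (t powr (?\<alpha> j - 1) * a j \<theta> t))" for j \<theta>
  have A_bdd: "bdd_meas sphere_measure (A j)" if j: "j < Suc J" for j
  proof (rule bdd_measI)
    have [measurable]: "(\<lambda>x. x) \<in> measurable sphere_measure (restrict_space borel (sphere (0 :: real ^ 'n) 1))"
      by (rule measurable_ident_sets) simp
    show "A j \<in> borel_measurable sphere_measure" unfolding A_def a_def by measurable
    let ?I = "\<lambda>t. indicator {0<..} t * (t powr (?\<alpha> j - 1) * (1 / (1 + t ^ m)))"
    fix \<theta> :: "real ^ 'n" assume "\<theta> \<in> space sphere_measure"
    then have \<theta>: "\<theta> \<in> sphere 0 1" by simp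
    have le: "?\<alpha> j < m"
    proof -
      have "n + j < k * m" using m j by linarith
      then show ?thesis using k by (simp add: divide_less_eq mult.commute del: of_nat_add flip: of_nat_mult)
    qed
    have i: "integrable lborel (\<lambda>t. AA * ?I t)"
      using n k le by (intro integrable_mult_right powr_decay_integrable) auto
    have le: "norm (indicator {0<..} t * (t powr (?\<alpha> j - 1) * a j \<theta> t)) \<le> AA * ?I t" for t :: real
    proof (cases "t > 0")
      case True
      have "t powr (?\<alpha> j - 1) * \<bar>a j \<theta> t\<bar> \<le> t powr (?\<alpha> j - 1) * (AA * (1 / (1 + \<bar>t\<bar> ^ m)))"
        by (intro mult_left_mono a_bound j \<theta>) simp
      then show ?thesis using True by (simp add: abs_mult mult_ac)
    qed simp
    have "norm (LINT t|lborel. indicator {0<..} t * (t powr (?\<alpha> j - 1) * a j \<theta> t)) \<le> (LINT t|lborel. AA * ?I t)"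
    proof (rule order_trans[OF integral_norm_bound integral_mono[OF integrable_norm i le]])
      show "integrable lborel (\<lambda>t. indicator {0<..} t * (t powr (?\<alpha> j - 1) * a j \<theta> t))"
      proof (rule Bochner_Integration.integrable_bound[OF i])
        show "AE t in lborel. norm (indicator {0<..} t * (t powr (?\<alpha> j - 1) * a j \<theta> t)) \<le> norm (AA * ?I t)"
          using le order_trans[OF le abs_ge_self] by (intro AE_I2) (simp only: real_norm_def)
      qed (use a_meas[OF \<theta>] in measurable)
    qed
    then show "\<bar>A j \<theta>\<bar> \<le> (1 / k) * (LINT t|lborel. AA * ?I t)"
      unfolding A_def abs_mult using k by (intro mult_mono) auto
  qed
  have A0: "A 0 \<theta> = (1 / k) * (LINT t|lborel. indicator {0<..} t * (t powr (real n / k - 1) * G (s * t) y0)) *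
      (s * fk \<theta>) powr (- real n / k)" if \<theta>: "norm \<theta> = 1" for \<theta>
  proof -
    have pos: "0 < s * fk \<theta>" using fk_lower[OF \<theta>] c by simp
    \<comment> \<open>The weight cancels, and division by the leading coefficient of
      \<open>w 0\<close> leaves the density of the sphere integral in the leading term.\<close>
    have "a 0 \<theta> t = G (s * t) y0 * (s * fk \<theta>) powr (- real n / k)" for t
      unfolding a_def b0 using w0[of "(t, \<theta>)" 0] \<theta> Wpos[of t] pos
      by (simp add: space_ray_params powr_minus divide_simps)
    then have "indicator {0<..} t * (t powr (?\<alpha> 0 - 1) * a 0 \<theta> t) =
       indicator {0<..} t * (t powr (real n / k - 1) * G (s * t) y0) * (s * fk \<theta>) powr (- real n / k)" for t :: real
      by simp
    then have "A 0 \<theta> = (1 / k) * (LINT t|lborel. indicator {0<..} t * (t powr (real n / k - 1) * G (s * t) y0) *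
        (s * fk \<theta>) powr (- real n / k))"
      unfolding A_def by (simp only:)
    then show ?thesis unfolding integral_mult_left_zero by (simp only: mult.assoc)
  qed
  \<comment> \<open>Half of e2, because \<phi>' \<ge> 0 is required on the closed interval up to
    \<epsilon>, whereas \<open>q'pos\<close> covers only r < e2.\<close>
  define \<epsilon>0 where "\<epsilon>0 = min (min e1 (e2 / 2)) d"
  have \<epsilon>0: "0 < \<epsilon>0" "\<epsilon>0 \<le> e1" "\<epsilon>0 < e2" "\<epsilon>0 \<le> d" using e1 e2 d by (auto simp: \<epsilon>0_def)
  have main: "\<exists>B. \<forall>\<theta>\<in>sphere 0 1. \<forall>z\<ge>1.
      \<bar>(LINT r|lborel. indicator {0<..<\<epsilon>} r * (r ^ (n - 1) * G (z * F (y0 + r *\<^sub>R \<theta>)) (y0 + r *\<^sub>R \<theta>))) -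
       (\<Sum>j<Suc J. A j \<theta> * z powr (- real (n + j) / k))\<bar> \<le> B * z powr (- real (n + Suc J) / k)"
    if \<epsilon>: "0 < \<epsilon>" "\<epsilon> \<le> \<epsilon>0" for \<epsilon>
  proof -
    let ?\<phi> = "\<lambda>\<theta> r. s * F (y0 + r *\<^sub>R \<theta>)" and ?\<phi>' = "\<lambda>\<theta> r. s * ray_deriv 1 F \<theta> (y0 + r *\<^sub>R \<theta>)"
    let ?H = "\<lambda>\<theta> t r. G (s * t) (y0 + r *\<^sub>R \<theta>)"
    have mem: "y0 + r *\<^sub>R \<theta> \<in> W" if "\<theta> \<in> sphere 0 1" "r \<in> {0..\<epsilon>}" for r \<theta>
      using that W \<epsilon> \<epsilon>0 by (intro subsetD[OF W(2)]) (auto simp: dist_norm)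
    have lower: "c * r ^ k \<le> ?\<phi> \<theta> r" if "\<theta> \<in> sphere 0 1" "r \<in> {0..\<epsilon>}" for \<theta> r
      using F_lower[of "r *\<^sub>R \<theta>"] that \<epsilon> \<epsilon>0 by (simp add: power_mult_distrib)
    have "\<exists>B. \<forall>\<theta>\<in>sphere 0 1. \<forall>z\<ge>1.
      \<bar>(LINT r|lborel. indicator {0<..<\<epsilon>} r * (r ^ (n - 1) * ?H \<theta> (z * ?\<phi> \<theta> r) r)) -
       (\<Sum>j<Suc J. (1 / k) * (LINT t|lborel. indicator {0<..} t * (t powr (?\<alpha> j - 1) * a j \<theta> t)) *
         z powr (- real (n + j) / k))\<bar> \<le> B * z powr (- real (n + Suc J) / k)"
    proof (rule ray_integral_expansion[where \<phi>' = ?\<phi>' and w = w and c = c and m = m and A = AA and C = C1])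
      show "0 < \<epsilon>" "0 < c" "0 < n" "0 < k" "n + Suc J < k * m" using \<epsilon> c n k m by auto
      fix \<theta> :: "real ^ 'n" assume \<theta>: "\<theta> \<in> sphere 0 1"
      then have \<theta>1: "norm \<theta> = 1" by simp
      have "F y0 = 0" using ray_deriv_F(1)[OF \<theta>1, of 0] k by simp
      then show "?\<phi> \<theta> 0 = 0" by simp
      show deriv: "(?\<phi> \<theta> has_real_derivative ?\<phi>' \<theta> r) (at r)" if "r \<in> {0..\<epsilon>}" for r
        using has_real_derivative_ray_deriv[OF F mem[OF \<theta> that], of 0] by (auto intro: DERIV_cmult)
      have "continuous_on {0..\<epsilon>} (\<lambda>r. ray_deriv 1 F \<theta> (y0 + r *\<^sub>R \<theta>))"
        using has_real_derivative_ray_deriv[OF F mem[OF \<theta>], of _ 1]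
        by (intro continuous_at_imp_continuous_on ballI) (rule DERIV_isCont)
      then show "continuous_on {0..\<epsilon>} (?\<phi>' \<theta>)" by (intro continuous_intros)
      show "0 \<le> ?\<phi>' \<theta> r" if r: "r \<in> {0..\<epsilon>}" for r
      proof (cases "r = 0")
        case True
        then show ?thesis using ray_deriv_F(1)[OF \<theta>1, of 1] k by simp
      next
        case False
        then have r': "0 < r" "r < e2" using r \<epsilon> \<epsilon>0 by auto
        have "0 \<le> q' r \<theta> * r ^ (k - 1)" using q'pos[OF r' \<theta>1] r' by simp
        then show ?thesis using r' by (simp add: q'_def)
      qed
      show "c * r ^ k \<le> ?\<phi> \<theta> r" if "r \<in> {0..\<epsilon>}" for r by (rule lower[OF \<theta> that])
      show "a j \<theta> \<in> borel_measurable borel" for j by (rule a_meas[OF \<theta>])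
      show "\<bar>a j \<theta> t\<bar> \<le> AA * (1 / (1 + \<bar>t\<bar> ^ m))" if "j < Suc J" for j t by (rule a_bound[OF that \<theta>])
      show "\<bar>?H \<theta> t r - (\<Sum>j<Suc J. a j \<theta> t * r ^ j * w j \<theta> r)\<bar> \<le> C1 * r ^ Suc J * (1 / (1 + \<bar>t\<bar> ^ m))"
        if r: "0 < r" "r < \<epsilon>" for t r
      proof -
        let ?X = "(1 + \<bar>t\<bar> ^ m) * G (s * t) (y0 + r *\<^sub>R \<theta>) - (\<Sum>j<Suc J. b j (t, \<theta>) * r ^ j * w j \<theta> r)"
        have X: "\<bar>?X\<bar> \<le> C1 * r ^ Suc J" using C1[of "(t, \<theta>)" r] r \<epsilon> \<epsilon>0 \<theta>1 by (simp add: space_ray_params del: sum.lessThan_Suc)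
        have "(\<Sum>j<Suc J. a j \<theta> t * r ^ j * w j \<theta> r) = (\<Sum>j<Suc J. b j (t, \<theta>) * r ^ j * w j \<theta> r) * (1 / (1 + \<bar>t\<bar> ^ m))"
          unfolding sum_distrib_right by (intro sum.cong refl) (simp add: a_def)
        then have "?H \<theta> t r - (\<Sum>j<Suc J. a j \<theta> t * r ^ j * w j \<theta> r) = ?X * (1 / (1 + \<bar>t\<bar> ^ m))"
          using Wpos[of t] by (simp only: left_diff_distrib) simp
        then show ?thesis using mult_right_mono[OF X, of "1 / (1 + \<bar>t\<bar> ^ m)"] Wpos[of t]
          by (simp only: abs_mult) simp
      qed
      show "r ^ (n - 1 + j) * w j \<theta> r = ?\<phi> \<theta> r powr (?\<alpha> j - 1) * ?\<phi>' \<theta> r / k" if r: "0 < r" "r < \<epsilon>" for j r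
      proof -
        have pos: "0 < ?\<phi> \<theta> r" using lower[OF \<theta>, of r] r c by (smt (verit) atLeastAtMost_iff mult_pos_pos zero_less_power)
        have q: "0 < q r \<theta>" using pos r by (simp add: q_def)
        have phi: "?\<phi> \<theta> r = r powr k * q r \<theta>" using r by (simp add: q_def powr_realpow)
        have "?\<phi> \<theta> r powr (?\<alpha> j - 1) = r powr (k * (?\<alpha> j - 1)) * q r \<theta> powr (?\<alpha> j - 1)"
          unfolding phi using r q by (simp add: powr_mult powr_powr)
        moreover have "?\<phi>' \<theta> r = r powr (k - 1) * q' r \<theta>"
          using r k powr_realpow[of r "k - 1"] by (simp add: q'_def)
        moreover have "r powr (k * (?\<alpha> j - 1)) * r powr (k - 1) = r ^ (n - 1 + j)"
        proof -
          have "k * (?\<alpha> j - 1) + real (k - 1) = real (n - 1 + j)" using k n by (simp add: field_simps of_nat_diff)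
          then have "r powr (k * (?\<alpha> j - 1)) * r powr (k - 1) = r powr real (n - 1 + j)"
            by (simp only: powr_add[symmetric])
          then show ?thesis using r by (simp only: powr_realpow)
        qed
        ultimately have "?\<phi> \<theta> r powr (?\<alpha> j - 1) * ?\<phi>' \<theta> r / k = r ^ (n - 1 + j) * (q r \<theta> powr (?\<alpha> j - 1) * (q' r \<theta> * (1 / k)))"
          by simp
        then show ?thesis by (simp only: w_def)
      qed
      show "(\<lambda>r. indicator {0<..<\<epsilon>} r * ?H \<theta> (z * ?\<phi> \<theta> r) r) \<in> borel_measurable borel" for z
      proof -
        have cF: "continuous_on {0<..<\<epsilon>} (\<lambda>r. F (y0 + r *\<^sub>R \<theta>))"
          by (rule continuous_on_compose2[OF smooth_on_continuous_iter[OF F, of "[]", simplified]])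
             (auto intro!: continuous_intros mem \<theta>)
        have cG: "continuous_on (UNIV \<times> W) (\<lambda>(t, y). G t y)"
          using smooth_on_continuous_iter[OF G, of "[]"] by simp
        have "continuous_on {0<..<\<epsilon>} (\<lambda>r. case (s * (z * ?\<phi> \<theta> r), y0 + r *\<^sub>R \<theta>) of (t, y) \<Rightarrow> G t y)"
          by (rule continuous_on_compose2[OF cG]) (auto intro!: continuous_intros cF mem \<theta>)
        from borel_measurable_continuous_on_indicator[OF _ this] show ?thesis by simp
      qed
    qed
    \<comment> \<open>As s * s = 1, the time s * (z \<phi>) is z * F again.\<close>
    moreover have "s * (z * (s * x)) = z * x" for z x using s by auto
    ultimately show ?thesis unfolding A_def by (simp only:)
  qed
  show ?thesis
    by (rule exI[of _ A], rule exI[of _ \<epsilon>0]) (use A_bdd A0 \<epsilon>0 main in blast)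
qed

lemma continuous_integrand:
  "continuous_on (cball 0 d) (\<lambda>w. G (z * F (y0 + w)) (y0 + w))"
proof -
  have mem: "y0 + w \<in> W" if "w \<in> cball 0 d" for w
    using that by (intro subsetD[OF W(2)]) (auto simp: dist_norm)
  have cF: "continuous_on (cball 0 d) (\<lambda>w. F (y0 + w))"
    by (rule continuous_on_compose2[OF smooth_on_continuous_iter[OF F, of "[]", simplified]])
       (use W(2) in \<open>auto intro!: continuous_intros\<close>)
  have cG: "continuous_on (UNIV \<times> W) (\<lambda>(t, y). G t y)"
    using smooth_on_continuous_iter[OF G, of "[]"] by simp
  have "continuous_on (cball 0 d) (\<lambda>w. case (z * F (y0 + w), y0 + w) of (t, y) \<Rightarrow> G t y)"
    by (rule continuous_on_compose2[OF cG]) (use mem in \<open>auto intro!: continuous_intros cF\<close>)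
  then show ?thesis by simp
qed

text \<open>On a small ball the cut-off is 1 and polar coordinates apply. On the remaining shell |F|
  \<ge> c \<epsilon>^k, so |z * F| is at least a fixed multiple of z and rapid decrease makes this
  part negligible, given only the bound X on the cut-off.\<close>

lemma localized_integral_expansion:
  fixes J :: nat and \<Theta> :: "real ^ 'n \<Rightarrow> real" and \<rho> X :: real
  defines "n \<equiv> CARD('n)"
  assumes \<Theta>: "\<Theta> \<in> borel_measurable borel" "\<And>y. \<bar>\<Theta> y\<bar> \<le> X" "\<And>y. y \<notin> cball y0 d \<Longrightarrow> \<Theta> y = 0"
    and \<rho>: "0 < \<rho>" "\<And>y. y \<in> ball y0 \<rho> \<Longrightarrow> \<Theta> y = 1"
  shows "\<exists>a B. a 0 = (1 / k) * (LINT t|lborel. indicator {0<..} t * (t powr (real n / k - 1) * G (s * t) y0)) *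
      (LINT \<theta>|sphere_measure. \<bar>fk \<theta>\<bar> powr (- real n / k)) \<and>
    (\<forall>z\<ge>1. \<bar>(LINT y|lborel. G (z * F y) y * \<Theta> y) - (\<Sum>j<Suc J. a j * z powr (- real (n + j) / k))\<bar>
       \<le> B * z powr (- real (n + Suc J) / k))"
proof -
  let ?S = "sphere_measure :: (real ^ 'n) measure"
  interpret S: finite_measure ?S by (rule finite_sphere_measure)
  obtain A \<epsilon>0 where A: "\<And>j. j < Suc J \<Longrightarrow> bdd_meas ?S (A j)"
    and A0: "\<And>\<theta>. norm \<theta> = 1 \<Longrightarrow> A 0 \<theta> = (1 / k) *
       (LINT t|lborel. indicator {0<..} t * (t powr (real n / k - 1) * G (s * t) y0)) * (s * fk \<theta>) powr (- real n / k)"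
    and \<epsilon>0: "0 < \<epsilon>0" and ray: "\<And>\<epsilon>. 0 < \<epsilon> \<Longrightarrow> \<epsilon> \<le> \<epsilon>0 \<Longrightarrow> (\<exists>B. \<forall>\<theta>\<in>sphere 0 1. \<forall>z\<ge>1.
      \<bar>(LINT r|lborel. indicator {0<..<\<epsilon>} r * (r ^ (n - 1) * G (z * F (y0 + r *\<^sub>R \<theta>)) (y0 + r *\<^sub>R \<theta>))) -
       (\<Sum>j<Suc J. A j \<theta> * z powr (- real (n + j) / k))\<bar> \<le> B * z powr (- real (n + Suc J) / k))"
    using ray_expansion[of J] unfolding n_def by blast
  define \<epsilon> where "\<epsilon> = min (min \<epsilon>0 \<rho>) d"
  have \<epsilon>: "0 < \<epsilon>" "\<epsilon> \<le> \<epsilon>0" "\<epsilon> \<le> \<rho>" "\<epsilon> \<le> d" using \<epsilon>0 \<rho> d by (auto simp: \<epsilon>_def)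
  obtain B where B: "\<And>\<theta> z. \<theta> \<in> sphere 0 1 \<Longrightarrow> z \<ge> 1 \<Longrightarrow>
      \<bar>(LINT r|lborel. indicator {0<..<\<epsilon>} r * (r ^ (n - 1) * G (z * F (y0 + r *\<^sub>R \<theta>)) (y0 + r *\<^sub>R \<theta>))) -
       (\<Sum>j<Suc J. A j \<theta> * z powr (- real (n + j) / k))\<bar> \<le> B * z powr (- real (n + Suc J) / k)"
    using ray[OF \<epsilon>(1,2)] by blast
  \<comment> \<open>On the shell a decay z^(-m) is to be absorbed in the error z^(-(n + Suc J) / k)
    for z \<ge> 1; k \<ge> 1 makes this m sufficient.\<close>
  define m where "m = n + Suc J"
  obtain C0 where C0: "\<And>t y. y \<in> cball y0 d \<Longrightarrow> \<bar>t\<bar> ^ 0 * \<bar>iter_deriv [] (G t) y\<bar> \<le> C0"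
    using decay[of "[]" 0] unfolding list.set by blast
  obtain Cm where Cm: "\<And>t y. y \<in> cball y0 d \<Longrightarrow> \<bar>t\<bar> ^ m * \<bar>iter_deriv [] (G t) y\<bar> \<le> Cm"
    using decay[of "[]" m] unfolding list.set by blast
  have A_int: "integrable ?S (A j)" if j: "j < Suc J" for j
  proof -
    obtain C where "\<forall>\<theta>\<in>space ?S. \<bar>A j \<theta>\<bar> \<le> C" and "A j \<in> borel_measurable ?S"
      using A[OF j] unfolding bdd_meas_def by blast
    then show ?thesis by (intro S.integrable_const_bound[where B = C] AE_I2) auto
  qed
  define a where "a j = (LINT \<theta>|?S. A j \<theta>)" for j
  have a0: "a 0 = (1 / k) * (LINT t|lborel. indicator {0<..} t * (t powr (real n / k - 1) * G (s * t) y0)) *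
      (LINT \<theta>|?S. \<bar>fk \<theta>\<bar> powr (- real n / k))"
  proof -
    have "a 0 = (LINT \<theta>|?S. (1 / k) * (LINT t|lborel. indicator {0<..} t * (t powr (real n / k - 1) * G (s * t) y0)) *
        \<bar>fk \<theta>\<bar> powr (- real n / k))"
      unfolding a_def
    proof (rule Bochner_Integration.integral_cong[OF refl])
      fix \<theta> :: "real ^ 'n" assume "\<theta> \<in> space ?S"
      then have \<theta>: "norm \<theta> = 1" by simp
      have "s * fk \<theta> = \<bar>fk \<theta>\<bar>" using s fk_lower[OF \<theta>] c by auto
      then show "A 0 \<theta> = (1 / k) * (LINT t|lborel. indicator {0<..} t * (t powr (real n / k - 1) * G (s * t) y0)) *
        \<bar>fk \<theta>\<bar> powr (- real n / k)" using A0[OF \<theta>] by (simp only:)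
    qed
    then show ?thesis by (simp only: integral_mult_right_zero)
  qed
  let ?V = "measure lborel (cball 0 d :: (real ^ 'n) set)"
  \<comment> \<open>Pointwise bound on the shell: decay of order m at times of size at least z * c *
    \<epsilon>^k, multiplied by the bound X of the cut-off. The volume of the ball enters
    afterwards.\<close>
  define B' where "B' = Cm / (c * \<epsilon> ^ k) ^ m * X"
  have ball_int: "integrable lborel (\<lambda>w :: real ^ 'n. K * indicator (cball 0 d) w)" for K :: real
    using emeasure_bounded_finite[of "cball (0 :: real ^ 'n) d"] by (intro integrable_mult_right integrable_real_indicator) auto
  have X0: "0 \<le> X" using \<Theta>(2)[of y0] by linarith
  have main: "\<bar>(LINT y|lborel. G (z * F y) y * \<Theta> y) - (\<Sum>j<Suc J. a j * z powr (- real (n + j) / k))\<bar>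
       \<le> (B * measure ?S (space ?S) + B' * ?V) * z powr (- real (n + Suc J) / k)" if z: "z \<ge> 1" for z
  proof -
    let ?g = "\<lambda>w. G (z * F (y0 + w)) (y0 + w)"
    have g_meas: "(\<lambda>w. indicator (cball 0 d) w * ?g w) \<in> borel_measurable borel"
      using borel_measurable_continuous_on_indicator[OF _ continuous_integrand[of z]] by simp
    have \<Theta>m: "(\<lambda>w. \<Theta> (y0 + w)) \<in> borel_measurable borel" using \<Theta>(1) by measurable
    define f where "f w = indicator (ball 0 \<epsilon>) w * ?g w" for w
    define p where "p w = indicator (cball 0 d - ball 0 \<epsilon>) w * (?g w * \<Theta> (y0 + w))" for w
    have f_meas: "f \<in> borel_measurable borel"
    proof -
      have "(\<lambda>w. indicator (ball 0 \<epsilon>) w * (indicator (cball 0 d) w * ?g w)) \<in> borel_measurable borel"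
        by (rule borel_measurable_times[OF borel_measurable_indicator g_meas]) simp
      moreover have "(\<lambda>w. indicator (ball 0 \<epsilon>) w * (indicator (cball 0 d) w * ?g w)) = f"
        using \<epsilon> by (auto simp: f_def fun_eq_iff split: split_indicator)
      ultimately show ?thesis by simp
    qed
    have p_meas: "p \<in> borel_measurable borel"
    proof -
      have "(\<lambda>w. indicator (cball 0 d - ball 0 \<epsilon>) w * ((indicator (cball 0 d) w * ?g w) * \<Theta> (y0 + w))) \<in> borel_measurable borel"
        by (rule borel_measurable_times[OF borel_measurable_indicator borel_measurable_times[OF g_meas \<Theta>m]]) simp
      moreover have "(\<lambda>w. indicator (cball 0 d - ball 0 \<epsilon>) w * ((indicator (cball 0 d) w * ?g w) * \<Theta> (y0 + w))) = p"
        by (auto simp: p_def fun_eq_iff split: split_indicator)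
      ultimately show ?thesis by simp
    qed
    have f_int: "integrable lborel f"
    proof (rule Bochner_Integration.integrable_bound[OF ball_int[of C0]])
      show "AE w in lborel. norm (f w) \<le> norm (C0 * indicator (cball 0 d) w)"
      proof (rule AE_I2)
        fix w :: "real ^ 'n"
        show "norm (f w) \<le> norm (C0 * indicator (cball 0 d) w)"
          using C0[of "y0 + w" "z * F (y0 + w)"] \<epsilon> by (auto simp: f_def dist_norm split: split_indicator)
      qed
    qed (use f_meas in simp)
    have p_le: "\<bar>p w\<bar> \<le> (B' * z powr (- real (n + Suc J) / k)) * indicator (cball 0 d) w" for w
    proof (cases "w \<in> cball 0 d - ball 0 \<epsilon>")
      case True
      then have w: "norm w \<le> d" "\<epsilon> \<le> norm w" by auto
      have pos: "0 < z * (c * \<epsilon> ^ k)" using z c \<epsilon> by simp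
      have "c * \<epsilon> ^ k \<le> c * norm w ^ k" using c \<epsilon> w by (intro mult_left_mono power_mono) auto
      also have "\<dots> \<le> s * F (y0 + w)" by (rule F_lower[OF w(1)])
      also have "\<dots> \<le> \<bar>F (y0 + w)\<bar>" using s by auto
      finally have "z * (c * \<epsilon> ^ k) \<le> \<bar>z * F (y0 + w)\<bar>" using z by (simp add: abs_mult)
      then have "(z * (c * \<epsilon> ^ k)) ^ m * \<bar>?g w\<bar> \<le> \<bar>z * F (y0 + w)\<bar> ^ m * \<bar>?g w\<bar>"
        using pos by (intro mult_right_mono power_mono) auto
      also have "\<dots> \<le> Cm" using Cm[of "y0 + w" "z * F (y0 + w)"] w by (simp add: dist_norm)
      finally have "\<bar>?g w\<bar> \<le> Cm / (z * (c * \<epsilon> ^ k)) ^ m"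
        using pos by (simp add: le_divide_eq mult.commute)
      also have "\<dots> = Cm / (c * \<epsilon> ^ k) ^ m * z powr (- real m)"
        using z by (simp add: power_mult_distrib powr_minus powr_realpow field_simps)
      finally have g_le: "\<bar>?g w\<bar> \<le> Cm / (c * \<epsilon> ^ k) ^ m * z powr (- real m)" .
      have Cm0: "0 \<le> Cm" using Cm[of y0 0] d by (smt (verit) centre_in_cball abs_ge_zero mult_nonneg_nonneg zero_le_power)
      have "z powr (- real m) \<le> z powr (- real (n + Suc J) / k)"
      proof (rule powr_mono)
        have "real (n + Suc J) / k \<le> real (n + Suc J) / 1" using k by (intro divide_left_mono) auto
        then show "- real m \<le> - real (n + Suc J) / k"
          unfolding m_def by (simp only: minus_divide_left[symmetric] neg_le_iff_le div_by_1)
      qed (use z in simp)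
      then have "Cm / (c * \<epsilon> ^ k) ^ m * z powr (- real m) \<le> Cm / (c * \<epsilon> ^ k) ^ m * z powr (- real (n + Suc J) / k)"
        using Cm0 c \<epsilon> by (intro mult_left_mono) auto
      with g_le have "\<bar>?g w\<bar> \<le> Cm / (c * \<epsilon> ^ k) ^ m * z powr (- real (n + Suc J) / k)" by linarith
      from abs_mult_le[OF this \<Theta>(2)[of "y0 + w"]] True show ?thesis
        by (simp add: p_def B'_def mult_ac)
    next
      case False
      have "0 \<le> Cm" using Cm[of y0 0] d by (smt (verit) centre_in_cball abs_ge_zero mult_nonneg_nonneg zero_le_power)
      then have "0 \<le> B'" using X0 c \<epsilon> by (simp add: B'_def)
      then show ?thesis using False by (auto simp: p_def split: split_indicator)
    qed
    have p_int: "integrable lborel p"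
    proof (rule Bochner_Integration.integrable_bound[OF ball_int[of "B' * z powr (- real (n + Suc J) / k)"]])
      show "AE w in lborel. norm (p w) \<le> norm (B' * z powr (- real (n + Suc J) / k) * indicator (cball 0 d) w)"
        using order_trans[OF p_le abs_ge_self] by (intro AE_I2) (simp only: real_norm_def)
    qed (use p_meas in simp)
    have "\<bar>LINT w|lborel. p w\<bar> \<le> (LINT w|lborel. (B' * z powr (- real (n + Suc J) / k)) * indicator (cball (0 :: real ^ 'n) d) w)"
      by (rule order_trans[OF integral_abs_bound]) (intro integral_mono integrable_abs p_int ball_int p_le)
    also have "\<dots> = B' * ?V * z powr (- real (n + Suc J) / k)" by simp
    finally have p_bd: "\<bar>LINT w|lborel. p w\<bar> \<le> B' * ?V * z powr (- real (n + Suc J) / k)" .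
    have shift: "(LINT y|lborel. G (z * F y) y * \<Theta> y) = (LINT w|lborel. f w + p w)"
    proof -
      let ?h = "\<lambda>y. G (z * F y) y * \<Theta> y"
      have hs: "?h (y0 + w) = f w + p w" for w
      proof (cases "w \<in> cball 0 d")
        case True
        then show ?thesis using \<rho>(2)[of "y0 + w"] \<epsilon> by (auto simp: f_def p_def dist_norm split: split_indicator)
      next
        case False
        then have "\<Theta> (y0 + w) = 0" by (intro \<Theta>(3)) (auto simp: dist_norm)
        then show ?thesis using False \<epsilon> by (auto simp: f_def p_def split: split_indicator)
      qed
      have hm: "?h \<in> borel_measurable borel"
      proof -
        have "(\<lambda>y. f (y - y0) + p (y - y0)) \<in> borel_measurable borel" using f_meas p_meas by measurable
        moreover have "(\<lambda>y. f (y - y0) + p (y - y0)) = ?h" by (simp add: fun_eq_iff hs[symmetric])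
        ultimately show ?thesis by simp
      qed
      have "(LINT y|lborel. ?h y) = (LINT y|distr lborel borel ((+) y0). ?h y)" by (simp add: lborel_distr_plus)
      also have "\<dots> = (LINT w|lborel. ?h (y0 + w))" by (rule integral_distr[OF _ hm]) simp
      finally show ?thesis by (simp only: hs)
    qed
    define R where "R \<theta> = (LINT r|lborel. indicator {0<..<\<epsilon>} r * (r ^ (n - 1) * G (z * F (y0 + r *\<^sub>R \<theta>)) (y0 + r *\<^sub>R \<theta>)))" for \<theta>
    have R: "(LINT r|lborel. indicator {0<..} r * r ^ (n - 1) * f (r *\<^sub>R \<theta>)) = R \<theta>" if "\<theta> \<in> space ?S" for \<theta>
      unfolding R_def using that
      by (intro Bochner_Integration.integral_cong) (auto simp: f_def split: split_indicator)
    have R_int: "integrable ?S R"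
      by (rule iffD1[OF Bochner_Integration.integrable_cong[OF refl R] polar_integral(1)[OF f_int, folded n_def]])
    have f_eq: "(LINT w|lborel. f w) = (LINT \<theta>|?S. R \<theta>)"
      by (rule trans[OF polar_integral(2)[OF f_int, folded n_def] Bochner_Integration.integral_cong[OF refl R]])
    let ?D = "\<lambda>\<theta>. R \<theta> - (\<Sum>j<Suc J. A j \<theta> * z powr (- real (n + j) / k))"
    have sum_int: "integrable ?S (\<lambda>\<theta>. \<Sum>j<Suc J. A j \<theta> * z powr (- real (n + j) / k))"
      using A_int by (intro Bochner_Integration.integrable_sum integrable_mult_left) auto
    have D_int: "integrable ?S ?D" by (rule Bochner_Integration.integrable_diff[OF R_int sum_int])
    have "(LINT \<theta>|?S. ?D \<theta>) = (LINT \<theta>|?S. R \<theta>) - (LINT \<theta>|?S. (\<Sum>j<Suc J. A j \<theta> * z powr (- real (n + j) / k)))"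
      by (rule Bochner_Integration.integral_diff[OF R_int sum_int])
    also have "(LINT \<theta>|?S. (\<Sum>j<Suc J. A j \<theta> * z powr (- real (n + j) / k))) = (\<Sum>j<Suc J. a j * z powr (- real (n + j) / k))"
      unfolding a_def using A_int by (subst Bochner_Integration.integral_sum) (auto intro: integrable_mult_left)
    finally have D_eq: "(LINT \<theta>|?S. ?D \<theta>) = (LINT \<theta>|?S. R \<theta>) - (\<Sum>j<Suc J. a j * z powr (- real (n + j) / k))" .
    have "\<bar>LINT \<theta>|?S. ?D \<theta>\<bar> \<le> (LINT \<theta>|?S. B * z powr (- real (n + Suc J) / k))"
    proof (rule order_trans[OF integral_abs_bound integral_mono[OF integrable_abs[OF D_int]]])
      fix \<theta> assume "\<theta> \<in> space ?S"
      then have \<theta>: "\<theta> \<in> sphere 0 1" by simp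
      show "\<bar>?D \<theta>\<bar> \<le> B * z powr (- real (n + Suc J) / k)" unfolding R_def by (rule B[OF \<theta> z])
    qed (rule S.integrable_const)
    also have "\<dots> = B * measure ?S (space ?S) * z powr (- real (n + Suc J) / k)"
      by simp
    finally have D_bd: "\<bar>LINT \<theta>|?S. ?D \<theta>\<bar> \<le> B * measure ?S (space ?S) * z powr (- real (n + Suc J) / k)" .
    have "(LINT y|lborel. G (z * F y) y * \<Theta> y) - (\<Sum>j<Suc J. a j * z powr (- real (n + j) / k)) =
        (LINT \<theta>|?S. ?D \<theta>) + (LINT w|lborel. p w)"
      unfolding shift D_eq f_eq[symmetric] Bochner_Integration.integral_add[OF f_int p_int] by (simp del: sum.lessThan_Suc)
    then show ?thesis using D_bd p_bd by (simp only: distrib_right)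
  qed
  show ?thesis by (rule exI[of _ a], rule exI) (use a0 main in blast)
qed

end

subsection \<open>Asymptotic expansions and passage to the chart\<close>

text \<open>The coefficients supplied for different N are a priori unrelated. Comparing consecutive
  orders shows by uniqueness that they agree on common indices, so the diagonal
  \<open>a (Suc j) j\<close> serves every N. Order \<open>Suc N\<close> is used to turn an O-error
  into the required o(z^(-N/k)).\<close>

lemma asymp_expansion_glue:
  fixes I :: "real \<Rightarrow> real" and k :: nat
  assumes k: "0 < k"
    and ex: "\<And>N. \<exists>a B. \<forall>z\<ge>1. \<bar>I z - (\<Sum>j<N. a j * z powr (- real j / k))\<bar> \<le> B * z powr (- real N / k)"
  shows "\<exists>c. has_asymp_expansion I k c"
proof -
  \<comment> \<open>In this variable, which tends to 0 from the right, the expansions are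
    polynomials and uniqueness of coefficients applies.\<close>
  define X where "X z = z powr (- 1 / real k)" for z
  have Xpow: "z powr (- real j / k) = X z ^ j" if "z \<ge> 1" for z j
    using that by (simp add: X_def powr_powr flip: powr_realpow)
  have "\<exists>a B. \<forall>z\<ge>1. \<bar>I z - (\<Sum>j<N. a j * X z ^ j)\<bar> \<le> B * X z ^ N" for N
  proof -
    obtain a B where aB: "\<And>z. z \<ge> 1 \<Longrightarrow> \<bar>I z - (\<Sum>j<N. a j * z powr (- real j / k))\<bar> \<le> B * z powr (- real N / k)"
      using ex[of N] by blast
    have "\<bar>I z - (\<Sum>j<N. a j * X z ^ j)\<bar> \<le> B * X z ^ N" if z: "z \<ge> 1" for z
      using aB[OF z] unfolding Xpow[OF z] .
    then show ?thesis by blast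
  qed
  then obtain a B where aB: "\<And>N z. z \<ge> 1 \<Longrightarrow> \<bar>I z - (\<Sum>j<N. a N j * X z ^ j)\<bar> \<le> B N * X z ^ N"
    by metis
  have lim: "(X \<longlongrightarrow> 0) at_top"
    unfolding X_def using k by (intro tendsto_neg_powr filterlim_ident) auto
  have ge1: "\<forall>\<^sub>F z in at_top. (z::real) \<ge> 1" by (rule eventually_ge_at_top)
  then have pos: "\<forall>\<^sub>F z in at_top. 0 < X z" by eventually_elim (simp add: X_def)
  have step: "a (Suc N) j = a N j" if j: "j < N" for N j
  proof -
    obtain N' where N': "N = Suc N'" using j by (cases N) auto
    have "(\<lambda>z. \<Sum>j\<le>N'. (a (Suc N) j - a N j) * X z ^ j) \<in> o(\<lambda>z. X z ^ N')"
    proof (rule bigo_power_imp_smallo[OF lim pos])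
      from ge1 pos lim[THEN order_tendstoD(2), of 1, simplified]
      show "\<forall>\<^sub>F z in at_top. \<bar>\<Sum>j\<le>N'. (a (Suc N) j - a N j) * X z ^ j\<bar>
          \<le> (\<bar>B (Suc N)\<bar> + B N + \<bar>a (Suc N) N\<bar>) * X z ^ Suc N'"
      proof eventually_elim
        case (elim z)
        have "(\<Sum>j\<le>N'. (a (Suc N) j - a N j) * X z ^ j) = (I z - (\<Sum>j<N. a N j * X z ^ j))
            - (I z - (\<Sum>j<Suc N. a (Suc N) j * X z ^ j)) - a (Suc N) N * X z ^ N"
          by (simp add: N' lessThan_Suc_atMost[symmetric] left_diff_distrib sum_subtractf)
        moreover have "B (Suc N) * X z ^ Suc N \<le> \<bar>B (Suc N)\<bar> * X z ^ N"
          using elim by (intro mult_mono power_decreasing) auto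
        moreover have "\<bar>a (Suc N) N * X z ^ N\<bar> = \<bar>a (Suc N) N\<bar> * X z ^ N" using elim by (simp add: abs_mult)
        moreover note aB[OF elim(1), of N] aB[OF elim(1), of "Suc N"]
        ultimately have "\<bar>\<Sum>j\<le>N'. (a (Suc N) j - a N j) * X z ^ j\<bar>
            \<le> B N * X z ^ N + \<bar>B (Suc N)\<bar> * X z ^ N + \<bar>a (Suc N) N\<bar> * X z ^ N" by linarith
        also have "\<dots> = (\<bar>B (Suc N)\<bar> + B N + \<bar>a (Suc N) N\<bar>) * X z ^ Suc N'"
          unfolding N' by (simp only: distrib_right add_ac)
        finally show ?case .
      qed
    qed
    from expansion_coeffs_zero[OF _ lim pos this, of j] j N' show ?thesis
      by (simp add: trivial_limit_at_top_linorder)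
  qed
  have eq: "a (Suc j + i) j = a (Suc j) j" for i j
    by (induction i) (auto simp: step)
  show ?thesis
  proof (intro exI[of _ "\<lambda>j. a (Suc j) j"], unfold has_asymp_expansion_def, intro allI)
    fix N
    have "(\<lambda>z. I z - (\<Sum>j<Suc N. a (Suc N) j * X z ^ j)) \<in> o(\<lambda>z. X z ^ N)"
      by (rule bigo_power_imp_smallo[OF lim pos, of _ "B (Suc N)"], rule eventually_mono[OF ge1])
         (rule aB)
    also have "?this \<longleftrightarrow> (\<lambda>z. I z - (\<Sum>j\<le>N. a (Suc j) j * z powr (- real j / k))) \<in> o(\<lambda>z. z powr (- real N / k))"
    proof (rule landau_o.small.cong_ex)
      show "\<forall>\<^sub>F z in at_top. I z - (\<Sum>j<Suc N. a (Suc N) j * X z ^ j) = I z - (\<Sum>j\<le>N. a (Suc j) j * z powr (- real j / k))"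
        using ge1
      proof eventually_elim
        case (elim z)
        have "a (Suc N) j = a (Suc j) j" if "j \<le> N" for j using eq[of j "N - j"] that by simp
        then show ?case unfolding lessThan_Suc_atMost Xpow[OF elim] by (auto intro!: sum.cong)
      qed
      show "\<forall>\<^sub>F z in at_top. X z ^ N = z powr (- real N / k)"
        using ge1 by eventually_elim (rule Xpow[symmetric])
    qed
    finally show "(\<lambda>z. I z - (\<Sum>j\<le>N. a (Suc j) j * z powr (- real j / k))) \<in> o(\<lambda>z. z powr (- real N / k))" .
  qed
qed

text \<open>Exponents below n / k receive the coefficient 0. For z \<ge> 1 all terms of index N and
  above are bounded by multiples of z^(-N/k) and join the error.\<close>

lemma asymp_expansion_shifted:
  fixes I :: "real \<Rightarrow> real" and k n :: nat
  assumes k: "0 < k"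
    and ex: "\<And>J. \<exists>a B. \<forall>z\<ge>1. \<bar>I z - (\<Sum>j<Suc J. a j * z powr (- real (n + j) / k))\<bar>
      \<le> B * z powr (- real (n + Suc J) / k)"
  shows "\<exists>c. has_asymp_expansion I k c"
proof (rule asymp_expansion_glue[OF k])
  fix N
  obtain a B where aB: "\<And>z. z \<ge> 1 \<Longrightarrow> \<bar>I z - (\<Sum>j<Suc N. a j * z powr (- real (n + j) / k))\<bar>
      \<le> B * z powr (- real (n + Suc N) / k)"
    using ex[of N] by blast
  define a' where "a' i = (if i < n then 0 else a (i - n))" for i
  have mono: "z powr (- real j / k) \<le> z powr (- real N / k)" if "z \<ge> 1" "N \<le> j" for z :: real and j
    using that by (intro powr_mono divide_right_mono) auto
  show "\<exists>a B. \<forall>z\<ge>1. \<bar>I z - (\<Sum>j<N. a j * z powr (- real j / k))\<bar> \<le> B * z powr (- real N / k)"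
  proof (intro exI[of _ a'] exI[of _ "\<bar>B\<bar> + (\<Sum>j\<in>{N..<n + Suc N}. \<bar>a' j\<bar>)"] allI impI)
    fix z :: real assume z: "z \<ge> 1"
    have "(\<Sum>j<Suc N. a j * z powr (- real (n + j) / k)) = (\<Sum>i\<in>{n..<n + Suc N}. a' i * z powr (- real i / k))"
      by (rule sum.reindex_bij_witness[of _ "\<lambda>i. i - n" "\<lambda>j. n + j"]) (auto simp: a'_def)
    also have "\<dots> = (\<Sum>i<n + Suc N. a' i * z powr (- real i / k))"
      by (rule sum.mono_neutral_left) (auto simp: a'_def)
    also have "\<dots> = (\<Sum>i<N. a' i * z powr (- real i / k)) + (\<Sum>i\<in>{N..<n + Suc N}. a' i * z powr (- real i / k))"
    proof -
      have u: "{..<N} \<union> {N..<n + Suc N} = {..<n + Suc N}" by auto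
      have "(\<Sum>i\<in>{..<N} \<union> {N..<n + Suc N}. a' i * z powr (- real i / k)) =
          (\<Sum>i<N. a' i * z powr (- real i / k)) + (\<Sum>i\<in>{N..<n + Suc N}. a' i * z powr (- real i / k))"
        by (rule sum.union_disjoint) auto
      then show ?thesis unfolding u .
    qed
    finally have eq: "I z - (\<Sum>i<N. a' i * z powr (- real i / k)) =
       (I z - (\<Sum>j<Suc N. a j * z powr (- real (n + j) / k))) + (\<Sum>i\<in>{N..<n + Suc N}. a' i * z powr (- real i / k))"
      by simp
    have 1: "\<bar>I z - (\<Sum>j<Suc N. a j * z powr (- real (n + j) / k))\<bar> \<le> \<bar>B\<bar> * z powr (- real N / k)"
      by (rule order_trans[OF aB[OF z]]) (intro mult_mono mono z, auto)
    have "\<bar>\<Sum>i\<in>{N..<n + Suc N}. a' i * z powr (- real i / k)\<bar> \<le> (\<Sum>i\<in>{N..<n + Suc N}. \<bar>a' i\<bar> * z powr (- real N / k))"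
    proof (rule order_trans[OF sum_abs sum_mono])
      fix i assume "i \<in> {N..<n + Suc N}"
      then have "z powr (- real i / k) \<le> z powr (- real N / k)" by (intro mono z) auto
      from mult_left_mono[OF this abs_ge_zero[of "a' i"]]
      show "\<bar>a' i * z powr (- real i / k)\<bar> \<le> \<bar>a' i\<bar> * z powr (- real N / k)"
        unfolding abs_mult abs_of_nonneg[OF powr_ge_zero] .
    qed
    with 1 show "\<bar>I z - (\<Sum>i<N. a' i * z powr (- real i / k))\<bar> \<le>
        (\<bar>B\<bar> + (\<Sum>j\<in>{N..<n + Suc N}. \<bar>a' j\<bar>)) * z powr (- real N / k)"
      unfolding eq distrib_right sum_distrib_right by linarith
  qed
qed

section \<open>From the manifold to one chart\<close>

lemma chart_integral:
  fixes \<mu> :: "'a::{t2_space, second_countable_topology} measure" and \<kappa> :: "'a \<Rightarrow> real ^ 'n::finite"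
  assumes \<mu>: "sets \<mu> = sets borel" and ch: "is_chart (U, \<kappa>)"
    and dens: "has_chart_density \<mu> (U, \<kappa>) (\<lambda>_. 1)"
    and out: "\<And>x. x \<notin> U \<Longrightarrow> h x = 0"
    and cont: "continuous_on (\<kappa> ` U) (\<lambda>y. h (inv_into U \<kappa> y) :: real)"
  shows "(LINT x|\<mu>. h x) = (LINT y|lborel. indicator (\<kappa> ` U) y * h (inv_into U \<kappa> y))"
proof -
  let ?H = "\<lambda>y. indicator (\<kappa> ` U) y * h (inv_into U \<kappa> y)"
  have U: "open U" and W: "open (\<kappa> ` U)" and hom: "homeomorphism U (\<kappa> ` U) \<kappa> (inv_into U \<kappa>)"
    using ch by (auto simp: is_chart_def)
  have sp: "space \<mu> = UNIV" using \<mu> sets_eq_imp_space_eq by fastforce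
  have US: "U \<inter> space \<mu> \<in> sets \<mu>" using U \<mu> sp by simp
  have \<kappa>m: "\<kappa> \<in> measurable (restrict_space \<mu> U) lborel"
  proof -
    have "\<kappa> \<in> borel_measurable (restrict_space borel U)"
      using hom by (intro borel_measurable_continuous_on_restrict) (auto simp: homeomorphism_def)
    then show ?thesis using \<mu> by (simp cong: measurable_cong_sets sets_restrict_space_cong)
  qed
  have Hm: "?H \<in> borel_measurable lborel"
    using borel_measurable_continuous_on_indicator[OF _ cont] W by simp
  \<comment> \<open>As h vanishes off U, the integral lives on U, where the chart pushes the measure
    forward to Lebesgue measure on its image.\<close>
  have "(LINT x|\<mu>. h x) = (LINT x|\<mu>. indicator U x *\<^sub>R h x)"
    using out by (intro Bochner_Integration.integral_cong) (auto split: split_indicator)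
  also have "\<dots> = (LINT x|restrict_space \<mu> U. h x)"
    by (rule integral_restrict_space[OF US, symmetric])
  also have "\<dots> = (LINT x|restrict_space \<mu> U. ?H (\<kappa> x))"
    using hom by (intro Bochner_Integration.integral_cong) (auto simp: space_restrict_space homeomorphism_def)
  also have "\<dots> = (LINT y|distr (restrict_space \<mu> U) lborel \<kappa>. ?H y)"
    by (rule integral_distr[OF \<kappa>m Hm, symmetric])
  also have "distr (restrict_space \<mu> U) lborel \<kappa> = density lborel (\<lambda>y. ennreal (indicator (\<kappa> ` U) y))"
    using dens by (simp add: has_chart_density_def ennreal_indicator)
  also have "(LINT y|density lborel (\<lambda>y. ennreal (indicator (\<kappa> ` U) y)). ?H y) = (LINT y|lborel. indicator (\<kappa> ` U) y *\<^sub>R ?H y)"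
    using W by (intro integral_density Hm) auto
  also have "\<dots> = (LINT y|lborel. ?H y)"
    by (intro Bochner_Integration.integral_cong) (auto split: split_indicator)
  finally show ?thesis .
qed

text \<open>The reflection t -> s t carries the half-line of a maximum to that of a minimum.\<close>

lemma half_line_integral:
  fixes h :: "real \<Rightarrow> real"
  assumes s: "s = 1 \<or> s = - 1"
  shows "(LINT t|lborel. max (s * t) 0 powr \<alpha> * h t) = (LINT t|lborel. indicator {0<..} t * (t powr \<alpha> * h (s * t)))"
proof -
  have "(LINT t|lborel. max (s * t) 0 powr \<alpha> * h t) = \<bar>s\<bar> *\<^sub>R (LINT t|lborel. max (s * (0 + s * t)) 0 powr \<alpha> * h (0 + s * t))"
    by (rule lborel_integral_real_affine) (use s in auto)
  also have "\<dots> = (LINT t|lborel. max t 0 powr \<alpha> * h (s * t))" using s by auto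
  also have "\<dots> = (LINT t|lborel. indicator {0<..} t * (t powr \<alpha> * h (s * t)))"
    by (intro Bochner_Integration.integral_cong) (auto split: split_indicator simp: max_def)
  finally show ?thesis .
qed

text \<open>The minimum over the compact sphere is attained, hence positive, and homogeneity carries
  it to all w.\<close>

lemma homogeneous_lower_bound:
  fixes fk :: "real ^ 'n::finite \<Rightarrow> real"
  assumes fk: "homogeneous_poly k fk" and pos: "\<And>v. v \<noteq> 0 \<Longrightarrow> 0 < s * fk v"
  obtains c where "0 < c" "\<And>\<theta>. norm \<theta> = 1 \<Longrightarrow> c \<le> s * fk \<theta>" "\<And>w. c * norm w ^ k \<le> s * fk w"
proof -
  have ne: "sphere (0 :: real ^ 'n) 1 \<noteq> {}" by simp
  have cont: "continuous_on (sphere 0 1) (\<lambda>\<theta>. s * fk \<theta>)"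
    by (intro continuous_intros homogeneous_poly_continuous[OF fk])
  obtain \<theta>0 where \<theta>0: "\<theta>0 \<in> sphere 0 1" and min: "\<And>\<theta>. \<theta> \<in> sphere 0 1 \<Longrightarrow> s * fk \<theta>0 \<le> s * fk \<theta>"
    using continuous_attains_inf[OF compact_sphere ne cont] by blast
  show ?thesis
  proof
    show "0 < s * fk \<theta>0" using \<theta>0 by (intro pos) auto
    show "s * fk \<theta>0 \<le> s * fk \<theta>" if "norm \<theta> = 1" for \<theta> using min that by simp
    show "s * fk \<theta>0 * norm w ^ k \<le> s * fk w" for w
    proof (cases "w = 0")
      case True
      \<comment> \<open>For k = 0 the left side does not vanish at w = 0, because 0^0 = 1; there f_k
        is constant and the two sides agree.\<close>
      show ?thesis
      proof (cases "k = 0")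
        case True
        then show ?thesis using homogeneous_poly_scale[OF fk, of 0 w] homogeneous_poly_scale[OF fk, of 0 \<theta>0]
          by (simp add: \<open>w = 0\<close>)
      next
        case False
        then show ?thesis using homogeneous_poly_scale[OF fk, of 0 w] by (simp add: True zero_power)
      qed
    next
      case False
      have "fk w = norm w ^ k * fk (sgn w)"
        using homogeneous_poly_scale[OF fk, of "norm w" "sgn w"] False by (simp add: sgn_div_norm)
      moreover have "s * fk \<theta>0 * norm w ^ k \<le> s * fk (sgn w) * norm w ^ k"
        using False by (intro mult_right_mono min) (auto simp: norm_sgn)
      ultimately show ?thesis by (simp add: mult_ac)
    qed
  qed
qed

text \<open>At the point r v divide 0 \<le> s * F by r^k: this gives 0 \<le> s * f_k(v) + K r with a
  fixed K, and r -> 0 yields the claim.\<close>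

lemma homogeneous_sign:
  fixes F fk :: "real ^ 'n::finite \<Rightarrow> real"
  assumes fk: "homogeneous_poly k fk" and d: "0 < d"
    and jet: "\<And>w. 0 < norm w \<Longrightarrow> norm w < d \<Longrightarrow> \<bar>F w - fk w\<bar> \<le> C * norm w ^ (k + 1)"
    and ge: "\<And>w. norm w < d \<Longrightarrow> 0 \<le> s * F w" and s: "s = 1 \<or> s = - 1" and v: "v \<noteq> 0"
  shows "0 \<le> s * fk v"
proof (rule tendsto_lowerbound)
  let ?K = "C * norm v ^ (k + 1)"
  show "((\<lambda>r. s * fk v + ?K * r) \<longlongrightarrow> s * fk v) (at_right 0)"
    by (auto intro!: tendsto_eq_intros)
  have "0 \<le> s * fk v + ?K * r" if r: "0 < r" "r < d / norm v" for r
  proof -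
    have n: "0 < norm (r *\<^sub>R v)" "norm (r *\<^sub>R v) < d" using r v by (auto simp: less_divide_eq)
    have "0 \<le> s * F (r *\<^sub>R v)" by (rule ge[OF n(2)])
    also have "\<dots> \<le> s * fk (r *\<^sub>R v) + C * norm (r *\<^sub>R v) ^ (k + 1)"
      using jet[OF n] s by auto
    also have "\<dots> = r ^ k * (s * fk v + ?K * r)"
      using r by (simp add: homogeneous_poly_scale[OF fk] power_mult_distrib algebra_simps)
    finally show ?thesis using r(1) by (metis mult_zero_right mult_le_cancel_left_pos zero_less_power)
  qed
  then show "\<forall>\<^sub>F r in at_right 0. 0 \<le> s * fk v + ?K * r"
    using d v by (auto simp: eventually_at_right_field intro!: exI[of _ "d / norm v"])
qed simp

text \<open>The minimum is s = 1 and the maximum is s = -1. Positivity of s * f_k belongs to the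
  conclusion because it later shows that both cases cannot occur together.\<close>

lemma extremum_expansion:
  fixes \<A> :: "('a::{t2_space, second_countable_topology}, 'n::finite) chart set"
    and \<mu> :: "'a measure" and f :: "'a \<Rightarrow> real" and g :: "real \<Rightarrow> 'a \<Rightarrow> real" and x0 :: 'a
    and U :: "'a set" and \<kappa> :: "'a \<Rightarrow> real ^ 'n" and k :: nat and fk :: "real ^ 'n \<Rightarrow> real" and s :: real
  assumes struct: "smooth_structure \<A>" and \<mu>: "sets \<mu> = sets borel"
    and f: "smooth_fun \<A> f" and g: "smooth_fun_time \<A> g"
    and U: "(U, \<kappa>) \<in> \<A>" "x0 \<in> U"
    and dens: "has_chart_density \<mu> (U, \<kappa>) (\<lambda>_. 1)"
    and decay: "x_derivs_rapidly_decreasing (U, \<kappa>) g"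
    and k: "k \<ge> 2" and fk: "homogeneous_poly k fk" and fk0: "\<forall>v. v \<noteq> 0 \<longrightarrow> fk v \<noteq> 0"
    and jet: "(\<lambda>y. f (inv_into U \<kappa> y) - fk (y - \<kappa> x0)) \<in> O[at (\<kappa> x0)](\<lambda>y. norm (y - \<kappa> x0) ^ (k + 1))"
    and s: "s = 1 \<or> s = - 1" and ext: "\<forall>\<^sub>F x in nhds x0. 0 \<le> s * f x"
  shows "(\<forall>v. v \<noteq> 0 \<longrightarrow> 0 < s * fk v) \<and> even k \<and>
    (\<exists>V. open V \<and> x0 \<in> V \<and> V \<subseteq> U \<and>
      (\<forall>\<Theta>. cutoff_function \<A> x0 V \<Theta> \<longrightarrow>
        (\<exists>c. has_asymp_expansion (I_s \<mu> f g \<Theta>) k c) \<and>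
        (\<lambda>z. I_s \<mu> f g \<Theta> z - leading_term (\<lambda>t. max (s * t) 0) k fk (\<lambda>t. g t x0) z)
            \<in> O(\<lambda>z. z powr (- (real CARD('n) + 1) / real k))))"
proof -
  let ?inv = "inv_into U \<kappa>"
  define W where "W = \<kappa> ` U"
  define y0 where "y0 = \<kappa> x0"
  define F where "F y = f (?inv y)" for y
  define G where "G t y = g t (?inv y)" for t y
  have ch: "is_chart (U, \<kappa>)" using struct U by (auto simp: smooth_structure_def)
  then have oU: "open U" and oW: "open W" and hom: "homeomorphism U W \<kappa> ?inv"
    by (auto simp: is_chart_def W_def)
  have inv_\<kappa>: "?inv (\<kappa> x) = x" if "x \<in> U" for x using hom that by (simp add: homeomorphism_def)
  have \<kappa>_inv: "\<kappa> (?inv y) = y" "?inv y \<in> U" if "y \<in> W" for y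
    using hom that by (auto simp: homeomorphism_def)
  have y0: "y0 \<in> W" "?inv y0 = x0" using U inv_\<kappa> by (auto simp: y0_def W_def)
  have sF: "smooth_on W F" using f U unfolding smooth_fun_def F_def[abs_def] W_def by blast
  have sG: "smooth_on (UNIV \<times> W) (\<lambda>(t, y). G t y)" using g U unfolding smooth_fun_time_def G_def W_def by blast
  have cF: "continuous_on W F" using smooth_on_continuous_iter[OF sF, of "[]"] by simp
  have cG: "continuous_on (UNIV \<times> W) (\<lambda>(t, y). G t y)"
    using smooth_on_continuous_iter[OF sG, of "[]"] by simp
  have pull: "\<exists>r>0. \<forall>y. dist y y0 < r \<longrightarrow> P (?inv y)" if "\<forall>\<^sub>F x in nhds x0. P x" for P
  proof -
    have "isCont ?inv y0"
      using hom oW y0(1) by (simp add: homeomorphism_def continuous_on_eq_continuous_at)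
    then have "(?inv \<longlongrightarrow> x0) (nhds y0)"
      using tendsto_at_iff_tendsto_nhds[of ?inv y0] y0(2) by (simp add: isCont_def)
    then have "\<forall>\<^sub>F y in nhds y0. P (?inv y)" using that by (rule eventually_compose_filterlim[rotated])
    then show ?thesis by (simp add: eventually_nhds_metric)
  qed
  obtain d1 where d1: "0 < d1" "\<And>y. dist y y0 < d1 \<Longrightarrow> 0 \<le> s * F y"
    using pull[OF ext] by (auto simp: F_def)
  obtain C where C: "\<forall>\<^sub>F y in at y0. norm (F y - fk (y - y0)) \<le> C * norm (norm (y - y0) ^ (k + 1))"
    using landau_o.bigE[OF jet] unfolding F_def y0_def by blast
  then obtain d2 where d2: "0 < d2" "\<And>y. y \<noteq> y0 \<Longrightarrow> dist y y0 < d2 \<Longrightarrow> \<bar>F y - fk (y - y0)\<bar> \<le> C * norm (y - y0) ^ (k + 1)"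
    by (auto simp: eventually_at)
  obtain d3 where d3: "0 < d3" "cball y0 d3 \<subseteq> W" using oW y0(1) open_contains_cball by blast
  have jet': "\<bar>F (y0 + w) - fk w\<bar> \<le> C * norm w ^ (k + 1)" if "0 < norm w" "norm w < d2" for w
    using d2(2)[of "y0 + w"] that by (simp add: dist_norm)
  have pos: "0 < s * fk v" if v: "v \<noteq> 0" for v
  proof -
    have "0 \<le> s * fk v"
    proof (rule homogeneous_sign[OF fk, where d = "min d1 d2" and F = "\<lambda>w. F (y0 + w)" and C = C])
      show "0 \<le> s * F (y0 + w)" if "norm w < min d1 d2" for w
        using d1(2)[of "y0 + w"] that by (simp add: dist_norm)
    qed (use d1 d2 jet' s v in auto)
    then show ?thesis using fk0 v s by (metis less_eq_real_def mult_eq_0_iff zero_neq_one neg_equal_0_iff_equal)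
  qed
  \<comment> \<open>An odd k would give f_k(-v) = -f_k(v), against the constant sign.\<close>
  have even: "even k"
  proof (rule ccontr)
    assume odd: "odd k"
    obtain v :: "real ^ 'n" where v: "v \<noteq> 0" using vector_choose_size[of 1] by fastforce
    have "fk (- v) = - fk v" using homogeneous_poly_scale[OF fk, of "- 1" v] odd by simp
    then show False using pos[OF v] pos[of "- v"] v by simp
  qed
  obtain c where c: "0 < c" and fk_lower: "\<And>\<theta>. norm \<theta> = 1 \<Longrightarrow> c \<le> s * fk \<theta>" and lower: "\<And>w. c * norm w ^ k \<le> s * fk w"
    using homogeneous_lower_bound[OF fk pos] by blast
  \<comment> \<open>d2 / 2 keeps the closed ball inside the open one where the jet estimate holds.
    The last bound makes the jet error at most half of c * |w|^k, whence the constant c / 2 in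
    \<open>F_lower\<close>.\<close>
  define d where "d = min (min (d2 / 2) d3) (c / (2 * (\<bar>C\<bar> + 1)))"
  have "d \<le> c / (2 * (\<bar>C\<bar> + 1))" by (simp add: d_def)
  then have "d * (2 * (\<bar>C\<bar> + 1)) \<le> c" by (subst (asm) pos_le_divide_eq) auto
  then have d: "0 < d" "d < d2" "d \<le> d3" "d * (2 * (\<bar>C\<bar> + 1)) \<le> c"
    using d2(1) d3(1) c by (auto simp: d_def)
  have F_lower: "c / 2 * norm w ^ k \<le> s * F (y0 + w)" if w: "norm w \<le> d" for w
  proof (cases "w = 0")
    case True
    have "0 \<le> s * F (y0 + w)" using d1 True by simp
    then show ?thesis using True k by (simp add: zero_power)
  next
    case False
    have "C * norm w ^ (k + 1) \<le> (c / 2) * norm w ^ k"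
    proof -
      have "C * norm w \<le> (\<bar>C\<bar> + 1) * d" using w by (intro mult_mono) auto
      then have "C * norm w \<le> c / 2" using d(4) by (simp add: algebra_simps)
      from mult_right_mono[OF this, of "norm w ^ k"] show ?thesis by (simp add: mult.assoc)
    qed
    moreover have "s * fk w - C * norm w ^ (k + 1) \<le> s * F (y0 + w)"
      using jet'[of w] False w d(2) s by auto
    ultimately show ?thesis using lower[of w] by (simp add: field_simps)
  qed
  have ball: "cball y0 d \<subseteq> W" using d d3 by auto
  interpret chart_extremum W F G y0 d k fk s "c / 2"
  proof
    show "\<exists>C. \<forall>t. \<forall>y\<in>cball y0 d. \<bar>t\<bar> ^ m * \<bar>iter_deriv vs (G t) y\<bar> \<le> C" if "set vs \<subseteq> Basis" for m vs
      using decay that ball compact_cball[of y0 d] unfolding x_derivs_rapidly_decreasing_def G_def[abs_def] W_def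
      by (simp add: case_prod_beta)
    show "\<exists>C. \<forall>w. 0 < norm w \<longrightarrow> norm w < d \<longrightarrow> \<bar>F (y0 + w) - fk w\<bar> \<le> C * norm w ^ (k + 1)"
      using jet' d(2) by (intro exI[of _ C]) auto
    show "c / 2 \<le> s * fk \<theta>" if "norm \<theta> = 1" for \<theta> using fk_lower[OF that] c by simp
  qed (use oW ball d sF sG fk k s c F_lower in auto)
  \<comment> \<open>The neighborhood is fixed before the cut-off is chosen: whatever is supported in
    V is supported, in coordinates, in the ball of the estimates.\<close>
  define V where "V = U \<inter> \<kappa> -` ball y0 d"
  have V: "open V" "x0 \<in> V" "V \<subseteq> U"
  proof -
    have "continuous_on U \<kappa>" using hom by (simp add: homeomorphism_def)
    then show "open V" unfolding V_def by (rule continuous_open_preimage[OF _ oU]) simp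
  qed (use U d in \<open>auto simp: V_def y0_def\<close>)
  have main: "(\<exists>c. has_asymp_expansion (I_s \<mu> f g \<Theta>) k c) \<and>
        (\<lambda>z. I_s \<mu> f g \<Theta> z - leading_term (\<lambda>t. max (s * t) 0) k fk (\<lambda>t. g t x0) z)
            \<in> O(\<lambda>z. z powr (- (real CARD('n) + 1) / real k))" if cut: "cutoff_function \<A> x0 V \<Theta>" for \<Theta>
  proof -
    \<comment> \<open>The cut-off in coordinates, set to 0 off W, where \<open>inv_into\<close> has
      no prescribed values.\<close>
    define H where "H y = indicator W y * \<Theta> (?inv y)" for y
    let ?K = "closure {x. \<Theta> x \<noteq> 0}"
    have s\<Theta>: "smooth_on W (\<lambda>y. \<Theta> (?inv y))" and K: "compact ?K" "?K \<subseteq> V" and one: "\<forall>\<^sub>F x in nhds x0. \<Theta> x = 1"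
      using cut U unfolding cutoff_function_def smooth_fun_def W_def by blast+
    have c\<Theta>: "continuous_on W (\<lambda>y. \<Theta> (?inv y))" using smooth_on_continuous_iter[OF s\<Theta>, of "[]"] by simp
    have \<Theta>V: "\<Theta> x = 0" if "x \<notin> ?K" for x using that closure_subset[of "{x. \<Theta> x \<noteq> 0}"] by auto
    have Hm: "H \<in> borel_measurable borel"
      using borel_measurable_continuous_on_indicator[OF _ c\<Theta>] oW unfolding H_def by simp
    have H0: "H y = 0" if "y \<notin> cball y0 d" for y
    proof (cases "y \<in> W")
      case True
      then have "?inv y \<notin> V" using that \<kappa>_inv[OF True] by (auto simp: V_def)
      then have "\<Theta> (?inv y) = 0" using K \<Theta>V by blast
      then show ?thesis by (simp add: H_def)
    qed (simp add: H_def)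
    have "\<exists>X. \<forall>y. \<bar>H y\<bar> \<le> X"
    proof -
      have "compact ((\<lambda>y. \<Theta> (?inv y)) ` cball y0 d)"
        by (intro compact_continuous_image continuous_on_subset[OF c\<Theta> ball]) auto
      from compact_imp_bounded[OF this]
      obtain X where "\<forall>x\<in>(\<lambda>y. \<Theta> (?inv y)) ` cball y0 d. norm x \<le> X" unfolding bounded_iff by blast
      then have X: "\<bar>\<Theta> (?inv y)\<bar> \<le> X" if "y \<in> cball y0 d" for y
        using that unfolding real_norm_def by blast
      have "\<bar>H y\<bar> \<le> \<bar>X\<bar>" for y
      proof (cases "y \<in> cball y0 d")
        case True
        then show ?thesis using X[OF True] by (auto simp: H_def split: split_indicator)
      qed (simp add: H0)
      then show ?thesis by blast
    qed
    then obtain X where X: "\<And>y. \<bar>H y\<bar> \<le> X" by blast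
    obtain r where r: "0 < r" "\<And>y. dist y y0 < r \<Longrightarrow> \<Theta> (?inv y) = 1" using pull[OF one] by blast
    define \<rho> where "\<rho> = min r d"
    have \<rho>: "0 < \<rho>" using r d by (simp add: \<rho>_def)
    have H1: "H y = 1" if "y \<in> ball y0 \<rho>" for y
    proof -
      have "y \<in> W" using that ball by (intro subsetD[OF ball]) (auto simp: \<rho>_def)
      then show ?thesis using r(2)[of y] that by (simp add: H_def \<rho>_def dist_commute)
    qed
    have I: "I_s \<mu> f g \<Theta> z = (LINT y|lborel. G (z * F y) y * H y)" for z
    proof -
      have "continuous_on W (\<lambda>y. case (z * F y, y) of (t, y) \<Rightarrow> G t y)"
        by (rule continuous_on_compose2[OF cG]) (auto intro!: continuous_intros cF)
      then have cont: "continuous_on (\<kappa> ` U) (\<lambda>y. g (z * f (?inv y)) (?inv y) * \<Theta> (?inv y))"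
        using c\<Theta> unfolding W_def[symmetric] by (intro continuous_intros) (auto simp: G_def F_def)
      have "I_s \<mu> f g \<Theta> z = (LINT y|lborel. indicator (\<kappa> ` U) y * (g (z * f (?inv y)) (?inv y) * \<Theta> (?inv y)))"
        unfolding I_s_def
      proof (rule chart_integral[where h = "\<lambda>x. g (z * f x) x * \<Theta> x", OF \<mu> ch dens _ cont])
        fix x assume "x \<notin> U"
        then have "\<Theta> x = 0" using K(2) V(3) by (intro \<Theta>V) blast
        then show "g (z * f x) x * \<Theta> x = 0" by simp
      qed
      then show ?thesis by (simp add: H_def G_def F_def W_def mult_ac)
    qed
    note exp = localized_integral_expansion[OF Hm X H0 \<rho> H1]
    have "\<exists>c. has_asymp_expansion (I_s \<mu> f g \<Theta>) k c"
    proof (rule asymp_expansion_shifted[where n = "CARD('n)"])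
      show "\<exists>a B. \<forall>z\<ge>1. \<bar>I_s \<mu> f g \<Theta> z - (\<Sum>j<Suc J. a j * z powr (- real (CARD('n) + j) / k))\<bar>
          \<le> B * z powr (- real (CARD('n) + Suc J) / k)" for J
        unfolding I using exp[of J] by blast
    qed (use k in simp)
    moreover have "(\<lambda>z. I_s \<mu> f g \<Theta> z - leading_term (\<lambda>t. max (s * t) 0) k fk (\<lambda>t. g t x0) z)
        \<in> O(\<lambda>z. z powr (- (real CARD('n) + 1) / real k))"
    proof -
      obtain a B where a0: "a 0 = (1 / k) * (LINT t|lborel. indicator {0<..} t * (t powr (real CARD('n) / k - 1) * G (s * t) y0)) *
          (LINT \<theta>|sphere_measure. \<bar>fk \<theta>\<bar> powr (- real CARD('n) / k))"
        and B: "\<And>z. z \<ge> 1 \<Longrightarrow> \<bar>I_s \<mu> f g \<Theta> z - (\<Sum>j<Suc 0. a j * z powr (- real (CARD('n) + j) / k))\<bar>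
          \<le> B * z powr (- real (CARD('n) + Suc 0) / k)"
        unfolding I using exp[of 0] by blast
      have \<alpha>: "(real CARD('n) - real k) / real k = real CARD('n) / k - 1" using k by (simp add: diff_divide_distrib)
      have lead: "leading_term (\<lambda>t. max (s * t) 0) k fk (\<lambda>t. g t x0) z = a 0 * z powr (- real CARD('n) / k)" for z
        unfolding leading_term_def \<alpha> half_line_integral[OF s] a0 by (simp add: G_def y0(2))
      show ?thesis
      proof (rule landau_o.bigI[of "\<bar>B\<bar> + 1"])
        show "\<forall>\<^sub>F z in at_top. norm (I_s \<mu> f g \<Theta> z - leading_term (\<lambda>t. max (s * t) 0) k fk (\<lambda>t. g t x0) z)
           \<le> (\<bar>B\<bar> + 1) * norm (z powr (- (real CARD('n) + 1) / real k))"
          using eventually_ge_at_top[of "1::real"]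
        proof eventually_elim
          case (elim z)
          have card_Suc: "real (CARD('n) + Suc 0) = real CARD('n) + 1" by simp
          have "\<bar>I_s \<mu> f g \<Theta> z - leading_term (\<lambda>t. max (s * t) 0) k fk (\<lambda>t. g t x0) z\<bar>
              \<le> B * z powr (- (real CARD('n) + 1) / real k)"
            using B[OF elim] unfolding lead card_Suc by simp
          also have "\<dots> \<le> (\<bar>B\<bar> + 1) * z powr (- (real CARD('n) + 1) / real k)"
            by (intro mult_right_mono) auto
          finally show ?case by simp
        qed
      qed simp
    qed
    ultimately show ?thesis by blast
  qed
  show ?thesis using pos even V main by blast
qed

theorem theorem3:
  fixes \<A> :: "('a::{t2_space, second_countable_topology}, 'n::finite) chart set"
    and \<mu> :: "'a measure"
    and f :: "'a \<Rightarrow> real"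
    and g :: "real \<Rightarrow> 'a \<Rightarrow> real"
    and x0 :: 'a
    and U :: "'a set"
    and \<kappa> :: "'a \<Rightarrow> real ^ 'n"
    and k :: nat
    and fk :: "real ^ 'n \<Rightarrow> real"
  assumes "smooth_structure \<A>"
    and "smooth_density \<A> \<mu>"
    and "smooth_fun \<A> f"
    and "smooth_fun_time \<A> g"
    and "\<exists>K. compact K \<and> (\<forall>x. x \<notin> K \<longrightarrow> \<bar>f x\<bar> > 0)"
    and "fourier_admissible \<mu> g"
    and "isolated_critical_point_on \<A> f (f -` {0}) x0"
    and "(U, \<kappa>) \<in> \<A>" and "x0 \<in> U"
    and "has_chart_density \<mu> (U, \<kappa>) (\<lambda>_. 1)"
    and "x_derivs_rapidly_decreasing (U, \<kappa>) g"
    and "local_min f x0 \<or> local_max f x0"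
    and "k \<ge> 2"
    and "homogeneous_poly k fk"
    and "\<forall>v. v \<noteq> 0 \<longrightarrow> fk v \<noteq> 0"
    and "(\<lambda>y. f (inv_into U \<kappa> y) - fk (y - \<kappa> x0))
           \<in> O[at (\<kappa> x0)](\<lambda>y. norm (y - \<kappa> x0) ^ (k + 1))"
  shows "even k \<and>
    (\<exists>V. open V \<and> x0 \<in> V \<and> V \<subseteq> U \<and>
      (\<forall>\<Theta>. cutoff_function \<A> x0 V \<Theta> \<longrightarrow>
        (\<exists>c. has_asymp_expansion (I_s \<mu> f g \<Theta>) k c) \<and>
        (local_min f x0 \<longrightarrow>
          (\<lambda>z. I_s \<mu> f g \<Theta> z - leading_term (\<lambda>t. max t 0) k fk (\<lambda>t. g t x0) z)
            \<in> O(\<lambda>z. z powr (- (real CARD('n) + 1) / real k))) \<and>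
        (local_max f x0 \<longrightarrow>
          (\<lambda>z. I_s \<mu> f g \<Theta> z - leading_term (\<lambda>t. max (- t) 0) k fk (\<lambda>t. g t x0) z)
            \<in> O(\<lambda>z. z powr (- (real CARD('n) + 1) / real k)))))"
proof -
  \<comment> \<open>Since x0 is a zero of f, the extremum condition becomes 0 \<le> s * f near
    x0.\<close>
  have x0: "f x0 = 0" using assms(7) by (simp add: isolated_critical_point_on_def)
  have \<mu>: "sets \<mu> = sets borel" using assms(2) by (simp add: smooth_density_def)
  note expansion = extremum_expansion[OF assms(1) \<mu> assms(3,4,8,9,10,11,13,14,15,16)]
  have min: "(\<forall>v. v \<noteq> 0 \<longrightarrow> 0 < fk v) \<and> even k \<and>
    (\<exists>V. open V \<and> x0 \<in> V \<and> V \<subseteq> U \<and>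
      (\<forall>\<Theta>. cutoff_function \<A> x0 V \<Theta> \<longrightarrow>
        (\<exists>c. has_asymp_expansion (I_s \<mu> f g \<Theta>) k c) \<and>
        (\<lambda>z. I_s \<mu> f g \<Theta> z - leading_term (\<lambda>t. max t 0) k fk (\<lambda>t. g t x0) z)
            \<in> O(\<lambda>z. z powr (- (real CARD('n) + 1) / real k))))" if "local_min f x0"
    using expansion[of 1] that by (simp add: local_min_def x0)
  have max: "(\<forall>v. v \<noteq> 0 \<longrightarrow> fk v < 0) \<and> even k \<and>
    (\<exists>V. open V \<and> x0 \<in> V \<and> V \<subseteq> U \<and>
      (\<forall>\<Theta>. cutoff_function \<A> x0 V \<Theta> \<longrightarrow>
        (\<exists>c. has_asymp_expansion (I_s \<mu> f g \<Theta>) k c) \<and>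
        (\<lambda>z. I_s \<mu> f g \<Theta> z - leading_term (\<lambda>t. max (- t) 0) k fk (\<lambda>t. g t x0) z)
            \<in> O(\<lambda>z. z powr (- (real CARD('n) + 1) / real k))))" if "local_max f x0"
    using expansion[of "- 1"] that by (simp add: local_max_def x0)
  \<comment> \<open>Each case comes with its own neighborhood V, while the conclusion asks for one V
    serving both implications. A nonzero vector, at which f_k would be both positive and negative,
    shows that only one case occurs.\<close>
  have "axis undefined 1 \<noteq> (0 :: real ^ 'n)" by simp
  then have "\<not> (local_min f x0 \<and> local_max f x0)" using min max by (meson less_asym)
  then consider "local_min f x0" "\<not> local_max f x0" | "local_max f x0" "\<not> local_min f x0"
    using assms(12) by blast
  then show ?thesis
  proof cases
    case 1
    then show ?thesis using min by simp
  next
    case 2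
    then show ?thesis using max by simp
  qed
qed

end
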